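(* Let $c>0$, $\sigma>0$, let $n\ge0$ be an integer, $\gamma=-nc$ and $r=\lfloor n/2\rfloor$. Let $A_3$ be the three-dimensional Ornstein-Uhlenbeck operator (generator in $L^2_\mu$) with differential expression $$A_3=(-cx+y)\frac{\partial}{\partial x}+(-cy+z)\frac{\partial}{\partial y}-cz\frac{\partial}{\partial z}+\sigma^2\Big(\frac{\partial^2}{\partial x^2}+\frac{\partial^2}{\partial y^2}+\frac{\partial^2}{\partial z^2}\Big).$$ Then the geometric multiplicity of the eigenvalue $\gamma$ of $A_3$ is $r+1$.
   Context: Operator: let $B=\begin{bmatrix}-c&1&0\\0&-c&1\\0&0&-c\end{bmatrix}$ and $Q_t=\sigma^2\int_0^te^{sB}e^{sB^*}\,ds$, where $B^*$ is the transpose of $B$. The Ornstein-Uhlenbeck semigroup is $(T(t)f)(x)=\frac{1}{(4\pi)^{3/2}(\det Q_t)^{1/2}}\int_{\mathbb R^3}e^{-\langle Q_t^{-1}y,y\rangle/4}f(e^{tB}x-y)\,dy$ for $t>0$, $T(0)=\mathrm{Id}$. It has a unique invariant probability measure $\mu$ and extends to a strongly continuous contraction semigroup on the real Hilbert space $L^2_\mu=L^2(\mathbb R^3,d\mu)$; its generator is $A_3$. Polynomials lie in the domain of $A_3$, and on them $A_3$ acts as the displayed differential expression. It is known that the spectrum of $A_3$ is $\{-nc:n=0,1,2,\dots\}$ and that all generalised eigenfunctions are polynomials. The geometric multiplicity of $\gamma$ is $\dim\mathrm{Ker}(\gamma-A_3)$. *)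

theory Defs
  imports "HOL-Probability.Probability"
begin

text \<open>
  Borel functions on \<open>\<real>\<^sup>3\<close> modulo equality almost everywhere.  The invariant measure \<open>\<mu>\<close> of the
  semigroup below has the same null sets as Lebesgue measure: invariance reads
  \<open>\<mu> N = \<integral> T(t) 1\<^sub>N d\<mu>\<close>, where \<open>T(t) 1\<^sub>N\<close> vanishes identically if \<open>N\<close> is Lebesgue null and is
  strictly positive everywhere otherwise.  So this type contains \<open>L\<^sup>2\<^sub>\<mu>\<close> with its proper notion of
  equality, whatever the parameters of the semigroup are.
\<close>

definition ae_eq :: "(real^3 \<Rightarrow> real) \<Rightarrow> (real^3 \<Rightarrow> real) \<Rightarrow> bool" where
  "ae_eq f g \<longleftrightarrow>
     f \<in> borel_measurable borel \<and> g \<in> borel_measurable borel \<and> (AE x in lborel. f x = g x)"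

lemma part_equivp_ae_eq: "part_equivp ae_eq"
proof (rule part_equivpI)
  show "\<exists>f. ae_eq f f"
    by (rule exI[of _ "\<lambda>_. 0"]) (simp add: ae_eq_def)
  show "symp ae_eq"
    by (rule sympI) (auto simp: ae_eq_def elim: AE_mp)
  show "transp ae_eq"
  proof (rule transpI)
    fix f g h assume "ae_eq f g" "ae_eq g h"
    then have m: "f \<in> borel_measurable borel" "h \<in> borel_measurable borel"
      and a: "AE x in lborel. f x = g x" "AE x in lborel. g x = h x"
      by (auto simp: ae_eq_def)
    from a have "AE x in lborel. f x = h x" by eventually_elim simp
    with m show "ae_eq f h" by (simp add: ae_eq_def)
  qed
qed

quotient_type ae_fun = "real^3 \<Rightarrow> real" / partial: ae_eq
  by (rule part_equivp_ae_eq)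

instantiation ae_fun :: real_vector
begin

lift_definition zero_ae_fun :: ae_fun is "\<lambda>_. 0"
  by (simp add: ae_eq_def)

lift_definition plus_ae_fun :: "ae_fun \<Rightarrow> ae_fun \<Rightarrow> ae_fun" is "\<lambda>f g x. f x + g x"
  unfolding ae_eq_def by (auto elim!: AE_mp)

lift_definition minus_ae_fun :: "ae_fun \<Rightarrow> ae_fun \<Rightarrow> ae_fun" is "\<lambda>f g x. f x - g x"
  unfolding ae_eq_def by (auto elim!: AE_mp)

lift_definition uminus_ae_fun :: "ae_fun \<Rightarrow> ae_fun" is "\<lambda>f x. - f x"
  unfolding ae_eq_def by (auto elim!: AE_mp)

lift_definition scaleR_ae_fun :: "real \<Rightarrow> ae_fun \<Rightarrow> ae_fun" is "\<lambda>a f x. a * f x"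
  unfolding ae_eq_def by (auto elim!: AE_mp)

instance
  by standard (transfer; auto simp: ae_eq_def algebra_simps elim!: AE_mp)+

end

definition mat_exp :: "real^'n^'n \<Rightarrow> real^'n^'n" where
  "mat_exp A = (\<Sum>k. (1 / fact k) *\<^sub>R (((**) A ^^ k) (mat 1)))"

definition drift :: "real \<Rightarrow> real^3^3" where
  "drift c = vector [vector [-c, 1, 0], vector [0, -c, 1], vector [0, 0, -c]]"

text \<open>
  The first-order part of the differential expression is \<open>\<langle>drift c *v v, \<nabla>f(v)\<rangle>\<close>.
\<close>

lemma drift_mult_vector:
  "drift c *v vector [x, y, z] = vector [- c * x + y, - c * y + z, - c * z]"
  by (simp add: drift_def vec_eq_iff forall_3 matrix_vector_mult_def sum_3)

definition ou_cov :: "real \<Rightarrow> real \<Rightarrow> real \<Rightarrow> real^3^3" where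
  "ou_cov c \<sigma> t =
     \<sigma>\<^sup>2 *\<^sub>R integral {0..t} (\<lambda>s. mat_exp (s *\<^sub>R drift c) ** mat_exp (s *\<^sub>R transpose (drift c)))"

text \<open>
  The Gaussian kernel is the density of the normal law with covariance \<open>2 Q\<^sub>t\<close>, which is why the
  second-order part of the generator is \<open>\<sigma>\<^sup>2 \<Delta>\<close> rather than half of it.  For \<open>f\<close> square integrable
  with respect to the invariant measure the integral converges absolutely for every \<open>x\<close>, so that
  the extension of the semigroup to \<open>L\<^sup>2\<^sub>\<mu>\<close> is given by the same formula.
\<close>

definition ou_fun :: "real \<Rightarrow> real \<Rightarrow> real \<Rightarrow> (real^3 \<Rightarrow> real) \<Rightarrow> real^3 \<Rightarrow> real" where
  "ou_fun c \<sigma> t f x =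
     (if t = 0 then f x
      else 1 / ((4 * pi) powr (3/2) * det (ou_cov c \<sigma> t) powr (1/2)) *
        (LINT y|lborel. exp (- ((matrix_inv (ou_cov c \<sigma> t) *v y) \<bullet> y) / 4)
                        * f (mat_exp (t *\<^sub>R drift c) *v x - y)))"

lemma AE_lborel_reflect:
  fixes a :: "real^3"
  assumes "AE y in lborel. P y"
  shows "AE y in lborel. P (a - y)"
proof -
  have d: "distr lborel borel (\<lambda>y. a - y) = (lborel :: (real^3) measure)"
    using lborel_affine[of "-1" a] by (simp add: density_1)
  have "AE y in distr lborel borel (\<lambda>y. a - y). P y"
    using assms unfolding d .
  then show ?thesis
    by (rule AE_distrD[rotated]) simp
qed

lemma borel_measurable_ou_fun:
  assumes "f \<in> borel_measurable borel"
  shows "ou_fun c \<sigma> t f \<in> borel_measurable borel"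
proof (cases "t = 0")
  case True
  then show ?thesis using assms by (simp add: ou_fun_def[abs_def])
next
  case False
  have [measurable]: "f \<in> borel_measurable borel" by fact
  have [measurable]: "(\<lambda>x. A *v x) \<in> borel_measurable borel" for A :: "real^3^3"
    by (intro borel_measurable_continuous_onI linear_continuous_on
        matrix_vector_mul_bounded_linear)
  have [measurable]: "(\<lambda>x. (A *v snd x) \<bullet> snd x) \<in> borel_measurable (borel \<Otimes>\<^sub>M lborel)"
    for A :: "real^3^3"
    by measurable
  show ?thesis
    using False unfolding ou_fun_def[abs_def] by simp
qed

lift_definition ou_semigroup :: "real \<Rightarrow> real \<Rightarrow> real \<Rightarrow> ae_fun \<Rightarrow> ae_fun" is ou_fun
proof -
  fix c \<sigma> t f g assume "ae_eq f g"
  then have [measurable]: "f \<in> borel_measurable borel" "g \<in> borel_measurable borel"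
    and ae: "AE x in lborel. f x = g x"
    by (auto simp: ae_eq_def)
  have "AE x in lborel. ou_fun c \<sigma> t f x = ou_fun c \<sigma> t g x"
  proof (cases "t = 0")
    case True
    then show ?thesis using ae by (simp add: ou_fun_def)
  next
    case False
    have "ou_fun c \<sigma> t f x = ou_fun c \<sigma> t g x" for x
    proof -
      have "AE y in lborel. f (mat_exp (t *\<^sub>R drift c) *v x - y)
                          = g (mat_exp (t *\<^sub>R drift c) *v x - y)"
        by (rule AE_lborel_reflect[OF ae])
      moreover have [measurable]: "(\<lambda>x. A *v x) \<in> borel_measurable borel" for A :: "real^3^3"
        by (intro borel_measurable_continuous_onI linear_continuous_on
            matrix_vector_mul_bounded_linear)
      ultimately have
        "(LINT y|lborel. exp (- ((matrix_inv (ou_cov c \<sigma> t) *v y) \<bullet> y) / 4)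
            * f (mat_exp (t *\<^sub>R drift c) *v x - y))
         = (LINT y|lborel. exp (- ((matrix_inv (ou_cov c \<sigma> t) *v y) \<bullet> y) / 4)
            * g (mat_exp (t *\<^sub>R drift c) *v x - y))"
        by (intro integral_cong_AE) auto
      then show ?thesis
        using False by (simp add: ou_fun_def)
    qed
    then show ?thesis by simp
  qed
  then show "ae_eq (ou_fun c \<sigma> t f) (ou_fun c \<sigma> t g)"
    by (simp add: ae_eq_def borel_measurable_ou_fun)
qed

definition ou_invariant :: "real \<Rightarrow> real \<Rightarrow> (real^3) measure \<Rightarrow> bool" where
  "ou_invariant c \<sigma> \<mu> \<longleftrightarrow>
     prob_space \<mu> \<and> sets \<mu> = sets borel \<and>
     (\<forall>t>0. \<forall>f \<in> borel_measurable borel. bounded (range f) \<longrightarrow>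
        (LINT x|\<mu>. ou_fun c \<sigma> t f x) = (LINT x|\<mu>. f x))"

text \<open>For \<open>c, \<sigma> > 0\<close> there is exactly one invariant probability measure.\<close>

definition ou_measure :: "real \<Rightarrow> real \<Rightarrow> (real^3) measure" where
  "ou_measure c \<sigma> = (THE \<mu>. ou_invariant c \<sigma> \<mu>)"

definition L2 :: "(real^3) measure \<Rightarrow> ae_fun set" where
  "L2 \<mu> = {F. integrable \<mu> (\<lambda>x. (rep_ae_fun F x)\<^sup>2)}"

definition L2_norm :: "(real^3) measure \<Rightarrow> ae_fun \<Rightarrow> real" where
  "L2_norm \<mu> F = sqrt (LINT x|\<mu>. (rep_ae_fun F x)\<^sup>2)"

text \<open>
  \<open>ou_has_generator_value c \<sigma> F G\<close> means that \<open>F\<close> lies in the domain of the generator and is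
  mapped to \<open>G\<close>.  The difference quotient is again in \<open>L\<^sup>2\<^sub>\<mu>\<close>, since the semigroup is contractive
  there, so \<open>L2_norm\<close> is its genuine norm.
\<close>

definition ou_has_generator_value :: "real \<Rightarrow> real \<Rightarrow> ae_fun \<Rightarrow> ae_fun \<Rightarrow> bool" where
  "ou_has_generator_value c \<sigma> F G \<longleftrightarrow>
     F \<in> L2 (ou_measure c \<sigma>) \<and> G \<in> L2 (ou_measure c \<sigma>) \<and>
     ((\<lambda>t. L2_norm (ou_measure c \<sigma>) ((1 / t) *\<^sub>R (ou_semigroup c \<sigma> t F - F) - G)) \<longlongrightarrow> 0)
       (at_right 0)"

definition ou_domain :: "real \<Rightarrow> real \<Rightarrow> ae_fun set" where
  "ou_domain c \<sigma> = {F. \<exists>G. ou_has_generator_value c \<sigma> F G}"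

definition ou_operator :: "real \<Rightarrow> real \<Rightarrow> ae_fun \<Rightarrow> ae_fun" where
  "ou_operator c \<sigma> F = (THE G. ou_has_generator_value c \<sigma> F G)"

text \<open>
  \<open>dim\<close> is \<open>0\<close> on infinite-dimensional subspaces, so a positive value includes finiteness.
\<close>

definition geometric_multiplicity ::
    "'a::real_vector set \<Rightarrow> ('a \<Rightarrow> 'a) \<Rightarrow> real \<Rightarrow> nat" where
  "geometric_multiplicity D A \<gamma> = dim {F \<in> D. \<gamma> *\<^sub>R F - A F = 0}"

end

theory Submission
  imports Defs
begin

text \<open>
  An eigenfunction satisfies \<open>F = e\<^sup>n\<^sup>c\<^sup>t T(t) F\<close> for all \<open>t\<close>, and \<open>T(t) F (x)\<close> is the integral of
  \<open>F\<close> against the Gaussian density with covariance \<open>2Q\<^sub>t\<close> centred at \<open>w = e\<^sup>t\<^sup>B x\<close>.  Expanding that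
  density to order \<open>n\<close> in \<open>w\<close> leaves an error \<open>O(|w|\<^sup>n\<^sup>+\<^sup>1)\<close>, which even after multiplication by
  \<open>e\<^sup>n\<^sup>c\<^sup>t\<close> tends to \<open>0\<close> as \<open>t \<rightarrow> \<infinity>\<close>; so \<open>F\<close> is a limit of polynomials of bounded degree, hence a
  polynomial.  On polynomials the map \<open>S g (h) = \<integral> g(h + y) d\<mu>(y)\<close> is a bijection, as it preserves
  the leading part, and invariance of \<open>\<mu>\<close> gives \<open>S T(t) g = (S g) \<circ> e\<^sup>t\<^sup>B\<close>.  Thus the eigenspace
  corresponds to the polynomials with \<open>g \<circ> e\<^sup>t\<^sup>B = e\<^sup>-\<^sup>n\<^sup>c\<^sup>t g\<close>: those homogeneous of degree \<open>n\<close> that are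
  invariant under the unipotent group \<open>e\<^sup>c\<^sup>t e\<^sup>t\<^sup>B\<close>.  They are spanned by the \<open>r + 1\<close> products
  \<open>z\<^sup>n\<^sup>-\<^sup>2\<^sup>j (y\<^sup>2 - 2xz)\<^sup>j\<close>.
\<close>

text \<open>F lies only in L^2 of mu and may grow faster than any exponential, so the density has to
  be expanded uniformly relative to mu itself. This is why covariances are compared: Q_t increases
  with t to Q = \<open>cov_inf c \<sigma>\<close>, so for t >= 1 the centred kernel is at most a
  constant times the density of mu, and recentring it at w multiplies it by the exponential of a
  quantity of size K |w| (1 + |z|), with K independent of t. Exponential weights belong to L^2 of
  mu, hence the remainder of order n + 1 is integrable against F. The Jordan block makes |w| decay
  like e^{-ct} only up to a factor quadratic in t; the surplus power of |w| absorbs all such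
  factors. The rescaled coefficients of the expansions have no visible limit, but a pointwise limit
  of functions from one finite-dimensional space stays in its span. Finally, Q solves the Lyapunov
  equation B Q + Q B^T = - sigma^2, which gives Q_t = Q - e^{tB} Q e^{tB^T}; invariance, the
  semigroup law and the monotonicity of Q_t are read off from this form.\<close>

section \<open>Symmetric positive definite matrices\<close>

text \<open>Adjoints are moved across inner products as columns \<open>transpose A *v x\<close>; the
  simp rule would turn these into rows.\<close>

declare transpose_matrix_vector [simp del]

lemma matrix_inv_cancel:
  fixes A :: "real^'n^'n"
  assumes "invertible A"
  shows "A ** matrix_inv A = mat 1" "matrix_inv A ** A = mat 1"
  using someI_ex[of "\<lambda>A'. A ** A' = mat 1 \<and> A' ** A = mat 1"] assms
  unfolding matrix_inv_def invertible_def by auto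

lemma matrix_inv_cancel_vec:
  fixes A :: "real^'n^'n"
  assumes "invertible A"
  shows "A *v (matrix_inv A *v x) = x" "matrix_inv A *v (A *v x) = x"
  by (simp_all add: matrix_vector_mul_assoc matrix_inv_cancel[OF assms])

lemma det_matrix_inv:
  fixes A :: "real^'n^'n"
  assumes "invertible A"
  shows "det (matrix_inv A) = 1 / det A"
proof -
  have "det A * det (matrix_inv A) = 1"
    by (simp flip: det_mul add: matrix_inv_cancel[OF assms])
  then show ?thesis by (metis mult_zero_left nonzero_mult_div_cancel_left zero_neq_one)
qed

lemma inner_matrix_transpose:
  fixes A :: "real^'n^'m"
  shows "x \<bullet> (A *v y) = (transpose A *v x) \<bullet> y"
  by (metis dot_lmul_matrix transpose_matrix_vector)

definition spd :: "real^3^3 \<Rightarrow> bool" where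
  "spd Q \<longleftrightarrow> transpose Q = Q \<and> (\<forall>v. v \<noteq> 0 \<longrightarrow> 0 < v \<bullet> (Q *v v))"

lemma spd_nonneg: "spd Q \<Longrightarrow> 0 \<le> v \<bullet> (Q *v v)"
  unfolding spd_def by (cases "v = 0") (auto intro: less_imp_le)

lemma spd_sym: "spd Q \<Longrightarrow> v \<bullet> (Q *v w) = w \<bullet> (Q *v v)"
  by (metis inner_commute inner_matrix_transpose spd_def)

lemma spd_invertible:
  assumes "spd Q" shows "invertible Q"
  unfolding invertible_left_inverse matrix_left_invertible_ker
  using assms unfolding spd_def by (metis inner_zero_right less_irrefl)

lemma spd_matrix_inv:
  assumes "spd Q" shows "spd (matrix_inv Q)"
proof -
  note i = spd_invertible[OF assms]
  let ?J = "matrix_inv Q"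
  have "transpose ?J = transpose ?J ** (Q ** ?J)"
    by (simp add: matrix_inv_cancel[OF i])
  also have "\<dots> = transpose (Q ** ?J) ** ?J"
    using assms by (simp add: matrix_transpose_mul matrix_mul_assoc spd_def)
  also have "\<dots> = ?J"
    by (simp add: matrix_inv_cancel[OF i])
  finally have "transpose ?J = ?J" .
  moreover have "0 < v \<bullet> (?J *v v)" if "v \<noteq> 0" for v
  proof -
    have "?J *v v \<noteq> 0"
      using that matrix_inv_cancel_vec(1)[OF i, of v] by auto
    then have "0 < (?J *v v) \<bullet> (Q *v (?J *v v))"
      using assms by (simp add: spd_def)
    then show ?thesis
      by (simp add: matrix_inv_cancel_vec[OF i] inner_commute)
  qed
  ultimately show ?thesis by (simp add: spd_def)
qed

lemma transpose_add:
  fixes A B :: "'a::plus^'n^'m"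
  shows "transpose (A + B) = transpose A + transpose B"
  by (simp add: transpose_def vec_eq_iff)

lemma spd_add:
  assumes "spd P" "spd Q" shows "spd (P + Q)"
  using assms
  by (auto simp: spd_def transpose_add matrix_vector_mult_add_rdistrib inner_add_right intro: add_pos_pos)

lemma spd_congruence:
  assumes "spd Q" "invertible M" shows "spd (M ** Q ** transpose M)"
proof -
  have "0 < v \<bullet> ((M ** Q ** transpose M) *v v)" if "v \<noteq> 0" for v
  proof -
    have "transpose M *v v \<noteq> 0"
      using that transpose_invertible[OF assms(2)]
      by (metis matrix_inv_cancel_vec(2) matrix_vector_mult_0_right)
    then show ?thesis
      using assms(1)
      by (simp add: spd_def inner_matrix_transpose[of v M] flip: matrix_vector_mul_assoc)
  qed
  then show ?thesis
    using assms(1) by (simp add: spd_def matrix_transpose_mul matrix_mul_assoc)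
qed

text \<open>Squares are completed one variable at a time; each new pivot is positive because the
  form is evaluated at a vector on which the squares already split off vanish. The factor L reduces
  every Gaussian integral to the standard one.\<close>

lemma spd_cholesky:
  assumes "spd J"
  obtains L :: "real^3^3" where "J = transpose L ** L"
proof -
  define a b d e f h where defs: "a = J$1$1" "b = J$1$2" "d = J$1$3" "e = J$2$2" "f = J$2$3" "h = J$3$3"
  have sym: "J$2$1 = b" "J$3$1 = d" "J$3$2 = f"
    using assms unfolding spd_def transpose_def defs by (metis (no_types, lifting) vec_lambda_beta)+
  have pos: "0 < a*x^2 + 2*b*x*y + 2*d*x*z + e*y^2 + 2*f*y*z + h*z^2"
    if "x \<noteq> 0 \<or> y \<noteq> 0 \<or> z \<noteq> 0" for x y z
  proof -
    let ?v = "vector [x, y, z] :: real^3"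
    have "?v \<noteq> 0" using that by (auto simp: vec_eq_iff forall_3)
    then have "0 < ?v \<bullet> (J *v ?v)" using assms by (simp add: spd_def)
    also have "\<dots> = a*x^2 + 2*b*x*y + 2*d*x*z + e*y^2 + 2*f*y*z + h*z^2"
      by (simp add: inner_vec_def sum_3 matrix_vector_mult_def sym defs(1-6)[symmetric]
          power2_eq_square algebra_simps)
    finally show ?thesis .
  qed
  have a: "a > 0" using pos[of 1 0 0] by simp
  define l1 where "l1 = sqrt a"
  define l2 where "l2 = b / l1"
  define l3 where "l3 = d / l1"
  have l1: "l1 > 0" "l1 * l1 = a" "l1 * l2 = b" "l1 * l3 = d"
    using a by (simp_all add: l1_def l2_def l3_def)
  have q1: "a*x^2 + 2*b*x*y + 2*d*x*z + e*y^2 + 2*f*y*z + h*z^2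
      = (l1*x+l2*y+l3*z)^2 + (e - l2*l2)*y^2 + 2*(f - l2*l3)*y*z + (h-l3*l3)*z^2" for x y z
    by (simp add: l1(2-4)[symmetric] power2_eq_square algebra_simps)
  \<comment> \<open>\<open>- l2 / l1\<close> solves \<open>l1 * x + l2 = 0\<close>, so at (x, 1, 0)
    only the second pivot is left.\<close>
  have e: "e - l2*l2 > 0"
    using pos[of "- l2/l1" 1 0] l1(1) unfolding q1 by simp
  define m1 where "m1 = sqrt (e - l2*l2)"
  define m2 where "m2 = (f - l2*l3) / m1"
  have m: "m1 > 0" "m1*m1 = e - l2*l2" "m1*m2 = f - l2*l3"
    using e by (simp_all add: m1_def m2_def)
  have q2: "a*x^2 + 2*b*x*y + 2*d*x*z + e*y^2 + 2*f*y*z + h*z^2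
      = (l1*x+l2*y+l3*z)^2 + (m1*y+m2*z)^2 + (h-l3*l3-m2*m2)*z^2" for x y z
    unfolding q1 m(2,3)[symmetric] by (simp add: power2_eq_square algebra_simps)
  \<comment> \<open>With z = 1, first y and then x are solved for so that both squares vanish; the
    last pivot remains.\<close>
  have h: "h - l3*l3 - m2*m2 > 0"
    using pos[of "- (l2*(-m2/m1)+l3)/l1" "-m2/m1" 1] l1(1) m(1) unfolding q2 by simp
  define n where "n = sqrt (h - l3*l3 - m2*m2)"
  have n: "n * n = h - l3*l3 - m2*m2" using h by (simp add: n_def)
  define L :: "real^3^3" where "L = vector [vector [l1,l2,l3], vector [0,m1,m2], vector [0,0,n]]"
  have "J = transpose L ** L"
    using l1(2-4) m(2,3) n
    by (simp add: vec_eq_iff forall_3 matrix_matrix_mult_def transpose_def sum_3 L_def sym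
        defs(1-6)[symmetric] mult.commute)
  then show ?thesis by (rule that)
qed

section \<open>Linear substitution in Lebesgue integrals\<close>

lemma borel_measurable_matrix_vector [measurable]:
  "(\<lambda>x. A *v x) \<in> borel_measurable borel" for A :: "real^3^3"
  by (intro borel_measurable_continuous_onI linear_continuous_on matrix_vector_mul_bounded_linear)

text \<open>Lebesgue measure is determined by its values on boxes, and the preimage of a box under M
  is its image under the inverse, whose volume is that of the box divided by \<bar>det
  M\<bar>.\<close>

lemma lborel_linear_image:
  fixes M :: "real^3^3"
  assumes M: "det M \<noteq> 0"
  shows "lborel = density (distr lborel borel (\<lambda>x. M *v x)) (\<lambda>_. ennreal \<bar>det M\<bar>)"
proof (rule lborel_eqI)
  fix l u :: "real^3"
  assume le: "\<And>b. b \<in> Basis \<Longrightarrow> l \<bullet> b \<le> u \<bullet> b"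
  have inv: "invertible M" using M invertible_det_nz by blast
  let ?N = "matrix_inv M"
  have pre: "(\<lambda>x. M *v x) -` box l u = (\<lambda>x. ?N *v x) ` box l u"
    by (force simp: matrix_inv_cancel_vec[OF inv] intro: image_eqI[of _ _ "M *v _"])
  have meas: "(\<lambda>x. M *v x) -` box l u \<in> sets borel"
    using measurable_sets[OF borel_measurable_matrix_vector[of M], of "box l u"] by simp
  have lm: "(\<lambda>x. ?N *v x) ` box l u \<in> lmeasurable"
    and ml: "measure lebesgue ((\<lambda>x. ?N *v x) ` box l u) = \<bar>det ?N\<bar> * measure lebesgue (box l u)"
    using measurable_linear_image[of "(*v) ?N" "box l u"] measure_linear_image[of "(*v) ?N" "box l u"]
    by (auto)
  have "emeasure lborel ((\<lambda>x. M *v x) -` box l u) = emeasure lebesgue ((\<lambda>x. M *v x) -` box l u)"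
    using meas by simp
  also have "\<dots> = ennreal (\<bar>det ?N\<bar> * measure lebesgue (box l u))"
    using emeasure_eq_measure2[OF lm] unfolding pre ml .
  also have "measure lebesgue (box l u) = (\<Prod>b\<in>Basis. (u - l) \<bullet> b)"
    using le by (simp add: measure_lborel_box_eq)
  finally have e: "emeasure lborel ((\<lambda>x. M *v x) -` box l u)
      = ennreal (\<bar>det ?N\<bar> * (\<Prod>b\<in>Basis. (u - l) \<bullet> b))" .
  have "emeasure (density (distr lborel borel (\<lambda>x. M *v x)) (\<lambda>_. ennreal \<bar>det M\<bar>)) (box l u)
      = ennreal \<bar>det M\<bar> * emeasure lborel ((\<lambda>x. M *v x) -` box l u)"
    by (simp add: emeasure_density_const emeasure_distr)
  also have "\<dots> = ennreal (\<bar>det M\<bar> * (\<bar>det ?N\<bar> * (\<Prod>b\<in>Basis. (u - l) \<bullet> b)))"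
    unfolding e by (rule ennreal_mult'[symmetric]) simp
  also have "\<bar>det M\<bar> * (\<bar>det ?N\<bar> * (\<Prod>b\<in>Basis. (u - l) \<bullet> b)) = (\<Prod>b\<in>Basis. (u - l) \<bullet> b)"
    using M by (simp add: det_matrix_inv[OF inv])
  finally show "emeasure (density (distr lborel borel (\<lambda>x. M *v x)) (\<lambda>_. ennreal \<bar>det M\<bar>)) (box l u)
      = (\<Prod>b\<in>Basis. (u - l) \<bullet> b)" .
qed simp

lemma nn_integral_matrix:
  fixes M :: "real^3^3"
  assumes [measurable]: "f \<in> borel_measurable borel" and M: "det M \<noteq> 0"
  shows "(\<integral>\<^sup>+x. f x \<partial>lborel) = ennreal \<bar>det M\<bar> * (\<integral>\<^sup>+x. f (M *v x) \<partial>lborel)"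
  by (subst lborel_linear_image[OF M])
     (simp add: nn_integral_density nn_integral_distr nn_integral_cmult)

section \<open>Gaussian measures\<close>

text \<open>The integrand is the unnormalised normal density of variance 2; the factor 4 instead of
  2 in the exponent runs through all kernels below.\<close>

lemma nn_integral_exp_square:
  "(\<integral>\<^sup>+x. ennreal (exp (- x\<^sup>2 / 4)) \<partial>lborel) = ennreal (sqrt (4 * pi))"
proof -
  have "(\<integral>\<^sup>+x. ennreal (normal_density 0 (sqrt 2) x) \<partial>lborel) = 1"
    using prob_space.emeasure_space_1[OF prob_space_normal_density[of "sqrt 2" 0]]
    by (simp add: emeasure_density)
  moreover have "ennreal (exp (- x\<^sup>2 / 4)) = ennreal (sqrt (4 * pi)) * ennreal (normal_density 0 (sqrt 2) x)" for x
    by (simp add: normal_density_def flip: ennreal_mult)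
  ultimately show ?thesis
    by (simp add: nn_integral_cmult)
qed

lemma nn_integral_exp_norm_square:
  "(\<integral>\<^sup>+x. ennreal (exp (- (x \<bullet> x) / 4)) \<partial>(lborel :: (real^3) measure)) = ennreal ((4 * pi) powr (3/2))"
proof -
  have norm2: "x \<bullet> x = (\<Sum>b\<in>Basis. (x \<bullet> b)\<^sup>2)" for x :: "real^3"
    by (subst euclidean_inner) (simp add: power2_eq_square)
  have "(\<integral>\<^sup>+x. ennreal (exp (- (x \<bullet> x) / 4)) \<partial>(lborel :: (real^3) measure))
     = (\<integral>\<^sup>+x. (\<Prod>b\<in>Basis. ennreal (exp (- (x \<bullet> b)\<^sup>2 / 4))) \<partial>(lborel :: (real^3) measure))"
    by (intro nn_integral_cong)
       (simp add: norm2 prod_ennreal exp_sum[symmetric] sum_negf sum_divide_distrib)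
  also have "\<dots> = ennreal (sqrt (4 * pi)) ^ 3"
    by (subst nn_integral_lborel_prod) (simp_all add: nn_integral_exp_square del: divide_minus_left)
  also have "\<dots> = ennreal (sqrt (4 * pi) ^ 3)"
    by (simp add: ennreal_power)
  also have "sqrt (4 * pi) ^ 3 = (4 * pi) powr (3/2)"
    by (simp add: powr_half_sqrt[symmetric] powr_powr powr_realpow[symmetric])
  finally show ?thesis .
qed

text \<open>With J = L^T L the substitution u = L x turns the form into u . u, and its Jacobian is
  |det L| = sqrt (det J).\<close>

lemma nn_integral_gaussian:
  assumes "spd J"
  shows "(\<integral>\<^sup>+x. ennreal (exp (- ((J *v x) \<bullet> x) / 4)) \<partial>lborel) = ennreal ((4 * pi) powr (3/2) / sqrt (det J))"
    and "det J > 0"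
proof -
  obtain L :: "real^3^3" where L: "J = transpose L ** L" using spd_cholesky[OF assms] .
  have dJ: "det J = (det L)\<^sup>2" by (simp add: L det_mul power2_eq_square)
  moreover have "det J \<noteq> 0" using spd_invertible[OF assms] invertible_det_nz by blast
  ultimately have dL: "det L \<noteq> 0" by auto
  then show "det J > 0" using dJ by simp
  have eq: "(J *v x) \<bullet> x = (L *v x) \<bullet> (L *v x)" for x
    by (simp add: L inner_commute inner_matrix_transpose[of x "transpose L"] flip: matrix_vector_mul_assoc)
  let ?I = "\<integral>\<^sup>+x. ennreal (exp (- ((J *v x) \<bullet> x) / 4)) \<partial>lborel"
  have "ennreal ((4 * pi) powr (3/2)) = ennreal \<bar>det L\<bar> * ?I"
    unfolding eq nn_integral_exp_norm_square[symmetric] by (rule nn_integral_matrix[OF _ dL]) measurable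
  then have "ennreal (1 / \<bar>det L\<bar>) * ennreal ((4 * pi) powr (3/2)) = (ennreal (1 / \<bar>det L\<bar>) * ennreal \<bar>det L\<bar>) * ?I"
    by (simp add: mult.assoc)
  also have "ennreal (1 / \<bar>det L\<bar>) * ennreal \<bar>det L\<bar> = 1"
    using dL by (simp flip: ennreal_mult)
  finally show "?I = ennreal ((4 * pi) powr (3/2) / sqrt (det J))"
    by (simp add: dJ flip: ennreal_mult)
qed

lemma matrix_add_rdistrib: "(A + B) ** C = A ** C + B ** C" for A B :: "'a::semiring_1^'n^'m"
  by (vector matrix_matrix_mult_def sum.distrib[symmetric] distrib_right)

lemma spd_det_pos: "spd Q \<Longrightarrow> det Q > 0"
  by (rule nn_integral_gaussian)

text \<open>The centred normal density with covariance 2 Q, written as in \<open>ou_fun_def\<close>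
  so that the semigroup becomes an average against it without rescaling.\<close>

definition gauss :: "real^3^3 \<Rightarrow> real^3 \<Rightarrow> real" where
  "gauss Q y = 1 / ((4 * pi) powr (3/2) * det Q powr (1/2)) * exp (- ((matrix_inv Q *v y) \<bullet> y) / 4)"

lemma borel_measurable_gauss [measurable]: "gauss Q \<in> borel_measurable borel"
  unfolding gauss_def[abs_def] by measurable

lemma gauss_pos: "spd Q \<Longrightarrow> gauss Q y > 0"
  using spd_det_pos by (force simp: gauss_def)

lemma gauss_nonneg [simp]: "gauss Q y \<ge> 0"
  by (simp add: gauss_def)

lemma matrix_vector_mult_uminus_right: "A *v (- x) = - (A *v x)" for A :: "real^'n^'m"
  by (metis matrix_vector_mult_diff_distrib diff_0 matrix_vector_mult_0_right)

lemma gauss_uminus [simp]: "gauss Q (- y) = gauss Q y"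
  by (simp add: gauss_def matrix_vector_mult_uminus_right)

lemma nn_integral_gauss:
  assumes "spd Q"
  shows "(\<integral>\<^sup>+x. ennreal (gauss Q x) \<partial>lborel) = 1"
proof -
  have d: "det Q > 0" "det (matrix_inv Q) = 1 / det Q"
    using assms spd_det_pos det_matrix_inv spd_invertible by blast+
  have "(\<integral>\<^sup>+x. ennreal (gauss Q x) \<partial>lborel)
    = ennreal (1 / ((4 * pi) powr (3/2) * det Q powr (1/2)))
       * (\<integral>\<^sup>+x. ennreal (exp (- ((matrix_inv Q *v x) \<bullet> x) / 4)) \<partial>lborel)"
    by (subst nn_integral_cmult[symmetric]) (auto simp: gauss_def simp flip: ennreal_mult')
  also have "\<dots> = 1"
    using d by (simp add: nn_integral_gaussian(1)[OF spd_matrix_inv[OF assms]] powr_half_sqrt real_sqrt_divide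
        del: divide_minus_left flip: ennreal_mult')
  finally show ?thesis .
qed

text \<open>In y the joint exponent is stationary at y = Q r with r = (P + Q)^{-1} v; a displacement
  u from there adds only the form of J = P^{-1} + Q^{-1}. The normalising constants match because P
  J Q = P + Q.\<close>

lemma gauss_convolution:
  assumes P: "spd P" and Q: "spd Q"
  shows "(\<integral>\<^sup>+y. ennreal (gauss P (v - y) * gauss Q y) \<partial>lborel) = ennreal (gauss (P + Q) v)"
proof -
  define R where "R = P + Q"
  define J where "J = matrix_inv P + matrix_inv Q"
  define r where "r = matrix_inv R *v v"
  note i = spd_invertible[OF P] spd_invertible[OF Q]
  have R: "spd R" unfolding R_def by (rule spd_add[OF P Q])
  have J: "spd J" unfolding J_def by (intro spd_add spd_matrix_inv P Q)
  have det: "det P * det J * det Q = det R"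
  proof -
    have "P ** J ** Q = R"
      by (simp add: J_def R_def matrix_add_ldistrib matrix_add_rdistrib matrix_inv_cancel[OF i(1)]
        matrix_inv_cancel[OF i(2)] matrix_mul_assoc[symmetric])
    then show ?thesis by (metis det_mul)
  qed
  have v: "v = P *v r + Q *v r"
    using matrix_inv_cancel_vec(1)[OF spd_invertible[OF R], of v]
    by (simp add: r_def R_def matrix_vector_mult_add_rdistrib)
  have square: "(matrix_inv P *v (v - (Q *v r + u))) \<bullet> (v - (Q *v r + u))
      + (matrix_inv Q *v (Q *v r + u)) \<bullet> (Q *v r + u)
     = (matrix_inv R *v v) \<bullet> v + (J *v u) \<bullet> u" for u
  proof -
    have "(matrix_inv P *v (P *v r - u)) \<bullet> (P *v r - u) =
      r \<bullet> (P *v r) - 2 * (r \<bullet> u) + (matrix_inv P *v u) \<bullet> u"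
      using spd_sym[OF spd_matrix_inv[OF P], of u "P *v r"]
      by (simp add: matrix_vector_mult_diff_distrib matrix_inv_cancel_vec[OF i(1)] inner_diff inner_commute)
    moreover have "(matrix_inv Q *v (Q *v r + u)) \<bullet> (Q *v r + u) =
      r \<bullet> (Q *v r) + 2 * (r \<bullet> u) + (matrix_inv Q *v u) \<bullet> u"
      using spd_sym[OF spd_matrix_inv[OF Q], of u "Q *v r"]
      by (simp add: matrix_vector_right_distrib matrix_inv_cancel_vec[OF i(2)] inner_add inner_commute)
    moreover have "v - (Q *v r + u) = P *v r - u" by (simp add: v)
    moreover have "(matrix_inv R *v v) \<bullet> v = r \<bullet> (P *v r) + r \<bullet> (Q *v r)"
      unfolding r_def[symmetric] by (simp add: v inner_add_right)
    ultimately show ?thesis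
      by (simp only: J_def matrix_vector_mult_add_rdistrib inner_add_left)
  qed
  let ?c = "1 / ((4 * pi) powr (3/2) * det P powr (1/2)) * (1 / ((4 * pi) powr (3/2) * det Q powr (1/2)))
     * exp (- ((matrix_inv R *v v) \<bullet> v) / 4)"
  have "(\<integral>\<^sup>+y. ennreal (gauss P (v - y) * gauss Q y) \<partial>lborel)
    = (\<integral>\<^sup>+u. ennreal (gauss P (v - (Q *v r + u)) * gauss Q (Q *v r + u)) \<partial>lborel)"
    by (subst lborel_distr_plus[of "Q *v r", symmetric], subst nn_integral_distr) auto
  also have "\<dots> = (\<integral>\<^sup>+u. ennreal ?c * ennreal (exp (- ((J *v u) \<bullet> u) / 4)) \<partial>lborel)"
  proof (intro nn_integral_cong)
    fix u
    have "exp (- ((matrix_inv P *v (v - (Q *v r + u))) \<bullet> (v - (Q *v r + u))) / 4)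
      * exp (- ((matrix_inv Q *v (Q *v r + u)) \<bullet> (Q *v r + u)) / 4)
      = exp (- ((matrix_inv R *v v) \<bullet> v) / 4) * exp (- ((J *v u) \<bullet> u) / 4)"
      using square[of u] unfolding exp_add[symmetric] by (simp add: field_simps)
    then show "ennreal (gauss P (v - (Q *v r + u)) * gauss Q (Q *v r + u))
        = ennreal ?c * ennreal (exp (- ((J *v u) \<bullet> u) / 4))"
      unfolding gauss_def by (subst ennreal_mult[symmetric]) (simp_all)
  qed
  also have "\<dots> = ennreal ?c * ennreal ((4 * pi) powr (3/2) / sqrt (det J))"
    by (simp add: nn_integral_cmult nn_integral_gaussian(1)[OF J] del: divide_minus_left)
  also have "\<dots> = ennreal (gauss R v)"
    using spd_det_pos[OF P] spd_det_pos[OF Q] spd_det_pos[OF J]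
    by (simp add: gauss_def powr_half_sqrt real_sqrt_mult flip: ennreal_mult' det)
  finally show ?thesis by (simp add: R_def)
qed

text \<open>The transformed form takes at M y the value of the old one at y, and \<bar>det M\<bar>
  enters both the Jacobian and the normalisation.\<close>

lemma nn_integral_gauss_matrix:
  assumes "spd Q" "invertible M" and [measurable]: "g \<in> borel_measurable borel"
  shows "(\<integral>\<^sup>+y. ennreal (gauss Q y) * g (M *v y) \<partial>lborel)
     = (\<integral>\<^sup>+w. ennreal (gauss (M ** Q ** transpose M) w) * g w \<partial>lborel)"
proof -
  let ?Q = "M ** Q ** transpose M"
  note iQ = spd_invertible[OF assms(1)]
  have Q': "spd ?Q" using assms by (intro spd_congruence)
  have dM: "det M \<noteq> 0" using assms invertible_det_nz by blast
  have inv: "matrix_inv ?Q *v (M *v y) = matrix_inv (transpose M) *v (matrix_inv Q *v y)" for y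
  proof -
    have "M *v y = ?Q *v (matrix_inv (transpose M) *v (matrix_inv Q *v y))"
      by (simp add: matrix_inv_cancel_vec[OF iQ] matrix_inv_cancel_vec[OF transpose_invertible[OF assms(2)]]
           flip: matrix_vector_mul_assoc)
    then show ?thesis by (simp add: matrix_inv_cancel_vec[OF spd_invertible[OF Q']])
  qed
  have form: "(matrix_inv ?Q *v (M *v y)) \<bullet> (M *v y) = (matrix_inv Q *v y) \<bullet> y" for y
    unfolding inv by (simp add: inner_matrix_transpose matrix_inv_cancel_vec[OF transpose_invertible[OF assms(2)]])
  have d: "det ?Q powr (1/2) = \<bar>det M\<bar> * det Q powr (1/2)"
    using spd_det_pos[OF assms(1)]
    by (simp add: det_mul powr_half_sqrt real_sqrt_mult mult.assoc mult.left_commute[of "det M" "det Q"]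
        zero_le_mult_iff flip: power2_eq_square)
  have g: "\<bar>det M\<bar> * gauss ?Q (M *v y) = gauss Q y" for y
    using dM unfolding gauss_def form d by simp
  show ?thesis
    by (subst nn_integral_matrix[OF _ dM])
       (auto simp: nn_integral_cmult[symmetric] mult.assoc[symmetric] g simp flip: ennreal_mult')
qed

section \<open>Gaussian laws and sums of independent Gaussian variables\<close>

definition gmeas :: "real^3^3 \<Rightarrow> (real^3) measure" where
  "gmeas Q = density lborel (\<lambda>y. ennreal (gauss Q y))"

lemma sets_gmeas [simp, measurable_cong]: "sets (gmeas Q) = sets borel"
  and space_gmeas [simp]: "space (gmeas Q) = UNIV"
  by (simp_all add: gmeas_def)

lemma prob_space_gmeas: "spd Q \<Longrightarrow> prob_space (gmeas Q)"
  by (rule prob_spaceI) (simp add: gmeas_def emeasure_density nn_integral_gauss)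

lemma nn_integral_gmeas:
  "f \<in> borel_measurable borel \<Longrightarrow> (\<integral>\<^sup>+y. f y \<partial>gmeas Q) = (\<integral>\<^sup>+y. ennreal (gauss Q y) * f y \<partial>lborel)"
  by (simp add: gmeas_def nn_integral_density)

lemma integral_gmeas:
  "f \<in> borel_measurable borel \<Longrightarrow> (LINT y|gmeas Q. f y) = (LINT y|lborel. gauss Q y * f y)" for f :: "_ \<Rightarrow> real"
  by (simp add: gmeas_def integral_density)

text \<open>The density vanishes nowhere. Hence the equality of \<open>ae_fun\<close>, which refers
  to Lebesgue measure, agrees with equality almost everywhere for the Gaussian law.\<close>

lemma AE_gmeas: "spd Q \<Longrightarrow> (AE x in gmeas Q. P x) \<longleftrightarrow> (AE x in lborel. P x)"
  unfolding gmeas_def by (subst AE_density) (auto simp: gauss_pos)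

lemma lborel_distr_uminus_3: "distr lborel borel uminus = (lborel :: (real^3) measure)"
  using lborel_affine[of "-1" "0::real^3"] by (simp add: density_1)

lemma nn_integral_gmeas_uminus:
  assumes [measurable]: "f \<in> borel_measurable borel"
  shows "(\<integral>\<^sup>+y. f (- y) \<partial>gmeas Q) = (\<integral>\<^sup>+y. f y \<partial>gmeas Q)"
proof -
  have "(\<integral>\<^sup>+y. f y \<partial>gmeas Q) = (\<integral>\<^sup>+y. ennreal (gauss Q y) * f y \<partial>distr lborel borel uminus)"
    by (simp add: nn_integral_gmeas lborel_distr_uminus_3)
  also have "\<dots> = (\<integral>\<^sup>+y. f (- y) \<partial>gmeas Q)"
    by (simp add: nn_integral_gmeas nn_integral_distr)
  finally show ?thesis ..
qed

text \<open>The substitution s = w + y and an exchange of the integrals leave, for fixed s, the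
  convolution of two Gaussian densities.\<close>

lemma nn_integral_gmeas_convolution:
  assumes P: "spd P" and Q: "spd Q" and M: "invertible M" and [measurable]: "f \<in> borel_measurable borel"
  shows "(\<integral>\<^sup>+x. (\<integral>\<^sup>+y. f (M *v x + y) \<partial>gmeas Q) \<partial>gmeas P) = (\<integral>\<^sup>+s. f s \<partial>gmeas (M ** P ** transpose M + Q))"
proof -
  let ?P = "M ** P ** transpose M"
  note P' = spd_congruence[OF P M]
  interpret Q: prob_space "gmeas Q" by (rule prob_space_gmeas[OF Q])
  have [measurable]: "(\<lambda>p. f (fst p + snd p)) \<in> borel_measurable (borel \<Otimes>\<^sub>M gmeas Q)"
    by measurable
  have m: "(\<lambda>w. \<integral>\<^sup>+y. f (w + y) \<partial>gmeas Q) \<in> borel_measurable borel"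
    using Q.borel_measurable_nn_integral_fst[of "\<lambda>p. f (fst p + snd p)" borel] by simp
  have mx: "(\<lambda>x. \<integral>\<^sup>+y. f (M *v x + y) \<partial>gmeas Q) \<in> borel_measurable borel"
    using measurable_compose[OF borel_measurable_matrix_vector[of M] m] by simp
  have "(\<integral>\<^sup>+x. (\<integral>\<^sup>+y. f (M *v x + y) \<partial>gmeas Q) \<partial>gmeas P)
     = (\<integral>\<^sup>+w. ennreal (gauss ?P w) * (\<integral>\<^sup>+y. f (w + y) \<partial>gmeas Q) \<partial>lborel)"
    using nn_integral_gauss_matrix[OF P M m] by (simp add: nn_integral_gmeas mx)
  also have "\<dots> = (\<integral>\<^sup>+w. (\<integral>\<^sup>+y. ennreal (gauss ?P w) * (ennreal (gauss Q y) * f (w + y)) \<partial>lborel) \<partial>lborel)"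
    by (simp add: nn_integral_gmeas nn_integral_cmult)
  also have "\<dots> = (\<integral>\<^sup>+w. (\<integral>\<^sup>+s. ennreal (gauss ?P w) * (ennreal (gauss Q (s - w)) * f s) \<partial>lborel) \<partial>lborel)"
  proof (rule nn_integral_cong)
    fix w :: "real^3"
    show "(\<integral>\<^sup>+y. ennreal (gauss ?P w) * (ennreal (gauss Q y) * f (w + y)) \<partial>lborel)
        = (\<integral>\<^sup>+s. ennreal (gauss ?P w) * (ennreal (gauss Q (s - w)) * f s) \<partial>lborel)"
      using nn_integral_distr[of "(+) w" lborel borel
          "\<lambda>s. ennreal (gauss ?P w) * (ennreal (gauss Q (s - w)) * f s)"]
      by (simp add: lborel_distr_plus)
  qed
  also have "\<dots> = (\<integral>\<^sup>+s. (\<integral>\<^sup>+w. ennreal (gauss ?P w) * (ennreal (gauss Q (s - w)) * f s) \<partial>lborel) \<partial>lborel)"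
    by (rule lborel_pair.Fubini') measurable
  also have "\<dots> = (\<integral>\<^sup>+s. (\<integral>\<^sup>+w. ennreal (gauss Q (s - w) * gauss ?P w) \<partial>lborel) * f s \<partial>lborel)"
    by (intro nn_integral_cong, subst nn_integral_multc[symmetric])
       (auto simp: ennreal_mult mult_ac)
  also have "\<dots> = (\<integral>\<^sup>+s. f s \<partial>gmeas (?P + Q))"
    by (simp add: gauss_convolution[OF Q P'] nn_integral_gmeas add.commute)
  finally show ?thesis .
qed

text \<open>The minus sign is that of the kernel in \<open>ou_fun\<close> and yields invariance; the
  plus sign is for the semigroup law, where two noise terms are added.\<close>

lemma distr_gmeas_convolution:
  assumes P: "spd P" and Q: "spd Q" and M: "invertible M"
  shows "distr (gmeas P \<Otimes>\<^sub>M gmeas Q) borel (\<lambda>(x, y). M *v x + y) = gmeas (M ** P ** transpose M + Q)"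
    and "distr (gmeas P \<Otimes>\<^sub>M gmeas Q) borel (\<lambda>(x, y). M *v x - y) = gmeas (M ** P ** transpose M + Q)"
proof -
  interpret Q: prob_space "gmeas Q" by (rule prob_space_gmeas[OF Q])
  have [measurable]: "(\<lambda>(x, y). M *v x + y) \<in> gmeas P \<Otimes>\<^sub>M gmeas Q \<rightarrow>\<^sub>M borel"
     "(\<lambda>(x, y). M *v x - y) \<in> gmeas P \<Otimes>\<^sub>M gmeas Q \<rightarrow>\<^sub>M borel"
    by measurable
  show "distr (gmeas P \<Otimes>\<^sub>M gmeas Q) borel (\<lambda>(x, y). M *v x + y) = gmeas (M ** P ** transpose M + Q)"
  proof (rule measure_eqI)
    fix A assume "A \<in> sets (distr (gmeas P \<Otimes>\<^sub>M gmeas Q) borel (\<lambda>(x, y). M *v x + y))"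
    then have [measurable]: "A \<in> sets borel" by simp
    have "emeasure (distr (gmeas P \<Otimes>\<^sub>M gmeas Q) borel (\<lambda>(x, y). M *v x + y)) A
      = (\<integral>\<^sup>+p. indicator A (M *v fst p + snd p) \<partial>(gmeas P \<Otimes>\<^sub>M gmeas Q))"
      by (subst nn_integral_indicator[symmetric], simp, subst nn_integral_distr) (auto simp: case_prod_unfold)
    also have "\<dots> = (\<integral>\<^sup>+x. (\<integral>\<^sup>+y. indicator A (M *v x + y) \<partial>gmeas Q) \<partial>gmeas P)"
      by (subst Q.nn_integral_fst[symmetric]) auto
    finally show "emeasure (distr (gmeas P \<Otimes>\<^sub>M gmeas Q) borel (\<lambda>(x, y). M *v x + y)) A
        = emeasure (gmeas (M ** P ** transpose M + Q)) A"
      by (simp add: nn_integral_gmeas_convolution[OF assms])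
  qed simp
  show "distr (gmeas P \<Otimes>\<^sub>M gmeas Q) borel (\<lambda>(x, y). M *v x - y) = gmeas (M ** P ** transpose M + Q)"
  proof (rule measure_eqI)
    fix A assume "A \<in> sets (distr (gmeas P \<Otimes>\<^sub>M gmeas Q) borel (\<lambda>(x, y). M *v x - y))"
    then have [measurable]: "A \<in> sets borel" by simp
    have "emeasure (distr (gmeas P \<Otimes>\<^sub>M gmeas Q) borel (\<lambda>(x, y). M *v x - y)) A
      = (\<integral>\<^sup>+p. indicator A (M *v fst p - snd p) \<partial>(gmeas P \<Otimes>\<^sub>M gmeas Q))"
      by (subst nn_integral_indicator[symmetric], simp, subst nn_integral_distr) (auto simp: case_prod_unfold)
    also have "\<dots> = (\<integral>\<^sup>+x. (\<integral>\<^sup>+y. indicator A (M *v x - y) \<partial>gmeas Q) \<partial>gmeas P)"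
      by (subst Q.nn_integral_fst[symmetric]) auto
    also have "\<dots> = (\<integral>\<^sup>+x. (\<integral>\<^sup>+y. indicator A (M *v x + y) \<partial>gmeas Q) \<partial>gmeas P)"
    proof (rule nn_integral_cong)
      fix x
      show "(\<integral>\<^sup>+y. indicator A (M *v x - y) \<partial>gmeas Q) = (\<integral>\<^sup>+y. indicator A (M *v x + y) \<partial>gmeas Q)"
        using nn_integral_gmeas_uminus[of "\<lambda>y. indicator A (M *v x + y)" Q] by simp
    qed
    finally show "emeasure (distr (gmeas P \<Otimes>\<^sub>M gmeas Q) borel (\<lambda>(x, y). M *v x - y)) A
        = emeasure (gmeas (M ** P ** transpose M + Q)) A"
      by (simp add: nn_integral_gmeas_convolution[OF assms])
  qed simp
qed

section \<open>The flow of the drift and the covariance matrices\<close>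

lemma matrix_mul_scaleR_left: "(k *\<^sub>R A) ** B = k *\<^sub>R (A ** B)" for A :: "real^'n^'m"
  by (simp add: vec_eq_iff matrix_matrix_mult_def sum_distrib_left mult.assoc)

lemma matrix_mul_scaleR_right: "A ** (k *\<^sub>R B) = k *\<^sub>R (A ** B)" for A :: "real^'n^'m"
  by (simp add: vec_eq_iff matrix_matrix_mult_def sum_distrib_left mult.left_commute)

lemma matrix_vector_mul_scaleR_left: "(k *\<^sub>R A) *v x = k *\<^sub>R (A *v x)" for A :: "real^'n^'m"
  by (simp add: vec_eq_iff matrix_vector_mult_def sum_distrib_left mult.assoc)

text \<open>The scalar part commutes with N and N^3 = 0, so the binomial formula for the k-th power
  stops after three terms, each of which sums to an exponential series shifted by 0, 1 or 2.\<close>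

lemma mat_exp_nilpotent:
  fixes N :: "real^'n^'n"
  assumes N: "N ** (N ** N) = 0"
  shows "mat_exp (a *\<^sub>R mat 1 + b *\<^sub>R N) = exp a *\<^sub>R (mat 1 + b *\<^sub>R N + (b\<^sup>2 / 2) *\<^sub>R (N ** N))"
proof -
  let ?A = "a *\<^sub>R mat 1 + b *\<^sub>R N"
  \<comment> \<open>The truncated exponents \<open>k - 1\<close> and \<open>k - 2\<close> do no
    harm: their factors \<open>k\<close> and \<open>k * (real k - 1)\<close> vanish where truncation
    occurs.\<close>
  have pow: "((**) ?A ^^ k) (mat 1) = a ^ k *\<^sub>R mat 1 + (k * a ^ (k - 1) * b) *\<^sub>R N
      + (k * (real k - 1) / 2 * a ^ (k - 2) * b\<^sup>2) *\<^sub>R (N ** N)" for k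
  proof (induction k)
    case (Suc k)
    consider "k = 0" | "k = 1" | j where "k = Suc (Suc j)"
      by (metis One_nat_def not0_implies_Suc)
    then show ?case
    proof cases
      case 3
      then show ?thesis
        using Suc N by (simp add: matrix_add_ldistrib matrix_add_rdistrib matrix_mul_scaleR_left
          matrix_mul_scaleR_right algebra_simps power2_eq_square)
           (simp add: field_simps flip: scaleR_add_left)
    qed (use Suc N in \<open>simp_all add: matrix_add_ldistrib matrix_add_rdistrib matrix_mul_scaleR_left
          matrix_mul_scaleR_right algebra_simps power2_eq_square flip: scaleR_add_left\<close>,
          simp add: vec_eq_iff)
  qed simp
  have s0: "(\<lambda>k. 1 / fact k * a ^ k) sums exp a"
    using exp_converges[of a] by (simp add: divide_inverse)
  have s1: "(\<lambda>k. 1 / fact k * (k * a ^ (k - 1) * b)) sums (exp a * b)"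
  proof -
    have "(\<lambda>k. (1 / fact (Suc k) * (Suc k * a ^ (Suc k - 1) * b))) sums (exp a * b)"
      using sums_mult2[OF s0, of b] by (simp add: field_simps del: of_nat_Suc)
    then show ?thesis by (subst (asm) sums_Suc_iff) simp
  qed
  have s2: "(\<lambda>k. 1 / fact k * (k * (real k - 1) / 2 * a ^ (k - 2) * b\<^sup>2)) sums (exp a * (b\<^sup>2 / 2))"
  proof -
    have "(\<lambda>k. (1 / fact (Suc (Suc k)) * (Suc (Suc k) * (real (Suc (Suc k)) - 1) / 2 * a ^ (Suc (Suc k) - 2) * b\<^sup>2)))
      sums (exp a * (b\<^sup>2 / 2))"
    proof (rule sums_cong[THEN iffD1, OF _ sums_mult2[OF s0, of "b\<^sup>2/2"]])
      fix k
      have "real (Suc (Suc k)) - 1 = Suc k" by simp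
      then show "1 / fact k * a ^ k * (b\<^sup>2 / 2) = 1 / fact (Suc (Suc k)) * (Suc (Suc k) * (real (Suc (Suc k)) - 1) / 2 * a ^ (Suc (Suc k) - 2) * b\<^sup>2)"
        by (simp only: fact_Suc) (simp add: divide_simps)
    qed
    then show ?thesis by (subst (asm) sums_Suc_iff, subst (asm) sums_Suc_iff) simp
  qed
  have "(\<lambda>k. (1 / fact k) *\<^sub>R (((**) ?A ^^ k) (mat 1))) sums
     (exp a *\<^sub>R mat 1 + (exp a * b) *\<^sub>R N + (exp a * (b\<^sup>2 / 2)) *\<^sub>R (N ** N))"
    unfolding pow scaleR_add_right scaleR_scaleR
    by (intro sums_add sums_scaleR_left s0 s1 s2)
  then show ?thesis
    unfolding mat_exp_def by (simp add: sums_unique[symmetric] scaleR_add_right)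
qed

definition shift3 :: "real^3^3" where
  "shift3 = vector [vector [0, 1, 0], vector [0, 0, 1], vector [0, 0, 0]]"

lemma shift3_nth:
  "shift3 $ 1 = vector [0, 1, 0]" "shift3 $ 2 = vector [0, 0, 1]" "shift3 $ 3 = vector [0, 0, 0]"
  by (simp_all add: shift3_def)

lemma matrix_matrix_mult_3: "(A ** B) $ i $ j = A$i$1 * B$1$j + A$i$2 * B$2$j + A$i$3 * B$3$j"
  for A B :: "real^3^3"
  by (simp add: matrix_matrix_mult_def sum_3)

lemma matrix_vector_mult_3: "(A *v x) $ i = A$i$1 * x$1 + A$i$2 * x$2 + A$i$3 * x$3"
  for A :: "real^3^3"
  by (simp add: matrix_vector_mult_def sum_3)

lemma transpose_nth: "transpose A $ i $ j = A $ j $ i"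
  by (simp add: transpose_def)

lemma mat_nth: "mat k $ i $ j = (if i = j then k else 0)"
  by (simp add: mat_def)

lemmas matrix_3_simps = vec_eq_iff forall_3 matrix_matrix_mult_3 matrix_vector_mult_3 transpose_nth mat_nth

lemma drift_shift3: "drift c = - c *\<^sub>R mat 1 + shift3"
  by (simp add: drift_def shift3_def matrix_3_simps)

text \<open>The closed form of e^{tB}. The scalar decay will separate homogeneous degrees, and the
  unipotent factor, polynomial in t, will single out the invariants.\<close>

definition flow :: "real \<Rightarrow> real \<Rightarrow> real^3^3" where
  "flow c t = exp (- c * t) *\<^sub>R vector [vector [1, t, t\<^sup>2 / 2], vector [0, 1, t], vector [0, 0, 1]]"

lemma flow_shift3: "flow c t = exp (- c * t) *\<^sub>R (mat 1 + t *\<^sub>R shift3 + (t\<^sup>2 / 2) *\<^sub>R (shift3 ** shift3))"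
  by (simp add: flow_def shift3_nth matrix_3_simps)

lemma mat_exp_drift: "mat_exp (t *\<^sub>R drift c) = flow c t"
proof -
  have "shift3 ** (shift3 ** shift3) = 0"
    by (simp add: shift3_nth matrix_3_simps)
  moreover have "t *\<^sub>R drift c = (- c * t) *\<^sub>R mat 1 + t *\<^sub>R shift3"
    by (simp add: drift_shift3 algebra_simps)
  ultimately show ?thesis
    by (simp only: mat_exp_nilpotent flow_shift3)
qed

lemma mat_exp_transpose_drift: "mat_exp (t *\<^sub>R transpose (drift c)) = transpose (flow c t)"
proof -
  have *: "transpose shift3 ** (transpose shift3 ** transpose shift3) = 0"
    by (simp add: shift3_nth matrix_3_simps)
  have "t *\<^sub>R transpose (drift c) = (- c * t) *\<^sub>R mat 1 + t *\<^sub>R transpose shift3"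
    by (simp add: drift_def shift3_nth matrix_3_simps mult.commute)
  then show ?thesis
    by (simp only: mat_exp_nilpotent[OF *]) (simp add: flow_def shift3_nth matrix_3_simps)
qed

lemma flow_add: "flow c (s + t) = flow c s ** flow c t"
proof -
  have "exp (- c * (s + t)) = exp (- c * s) * exp (- c * t)"
    by (simp add: algebra_simps flip: exp_add)
  then show ?thesis
    by (simp add: flow_def matrix_3_simps power2_eq_square) (simp add: field_simps)
qed

lemma flow_0 [simp]: "flow c 0 = mat 1"
  by (simp add: flow_def matrix_3_simps)

lemma invertible_flow: "invertible (flow c t)"
  unfolding invertible_def
  by (rule exI[of _ "flow c (- t)"]) (simp flip: flow_add)

lemma norm_shift3: "norm (shift3 *v x) \<le> norm x" "norm (transpose shift3 *v x) \<le> norm x"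
  unfolding norm_le by (simp_all add: inner_vec_def sum_3 matrix_vector_mult_3 transpose_nth shift3_nth)

text \<open>The Jordan block costs a factor quadratic in t but leaves the exponential rate c intact,
  so the power n + 1 of the flow still beats e^{nct}.\<close>

lemma norm_flow_le:
  assumes "t \<ge> 0"
  shows "norm (flow c t *v x) \<le> exp (- c * t) * (1 + t + t\<^sup>2 / 2) * norm x"
    and "norm (transpose (flow c t) *v x) \<le> exp (- c * t) * (1 + t + t\<^sup>2 / 2) * norm x"
proof -
  have gen: "norm (exp (- c * t) *\<^sub>R (x + t *\<^sub>R (N *v x) + (t\<^sup>2 / 2) *\<^sub>R (N *v (N *v x))))
    \<le> exp (- c * t) * (1 + t + t\<^sup>2 / 2) * norm x" if N: "\<And>x. norm (N *v x) \<le> norm x" for N :: "real^3^3"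
  proof -
    have "norm (x + t *\<^sub>R (N *v x) + (t\<^sup>2 / 2) *\<^sub>R (N *v (N *v x)))
       \<le> norm x + t * norm (N *v x) + (t\<^sup>2 / 2) * norm (N *v (N *v x))"
      using assms by (intro order_trans[OF norm_triangle_ineq] add_mono) auto
    also have "\<dots> \<le> norm x + t * norm x + (t\<^sup>2 / 2) * norm x"
      using assms N[of x] N[of "N *v x"] by (intro add_mono mult_left_mono) auto
    also have "\<dots> = (1 + t + t\<^sup>2 / 2) * norm x" by (simp add: algebra_simps)
    finally show ?thesis by (simp add: mult.assoc)
  qed
  show "norm (flow c t *v x) \<le> exp (- c * t) * (1 + t + t\<^sup>2 / 2) * norm x"
    using gen[of shift3, OF norm_shift3(1)]
    by (simp add: flow_shift3 matrix_vector_mul_scaleR_left matrix_vector_mult_add_rdistrib matrix_vector_mul_assoc)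
  have "transpose (flow c t) = exp (- c * t) *\<^sub>R (mat 1 + t *\<^sub>R transpose shift3 + (t\<^sup>2 / 2) *\<^sub>R (transpose shift3 ** transpose shift3))"
    by (simp add: flow_def shift3_nth matrix_3_simps)
  then show "norm (transpose (flow c t) *v x) \<le> exp (- c * t) * (1 + t + t\<^sup>2 / 2) * norm x"
    using gen[of "transpose shift3", OF norm_shift3(2)]
    by (simp add: matrix_vector_mul_scaleR_left matrix_vector_mult_add_rdistrib matrix_vector_mul_assoc)
qed

lemma has_vector_derivative_flow_transpose:
  "((\<lambda>t. transpose (flow c t) *v v) has_vector_derivative transpose (drift c) *v (transpose (flow c t) *v v)) (at t within S)"
proof -
  let ?N = "transpose shift3"
  have f: "transpose (flow c t) *v v = exp (- c * t) *\<^sub>R (v + t *\<^sub>R (?N *v v) + (t\<^sup>2 / 2) *\<^sub>R (?N *v (?N *v v)))" for t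
    by (simp add: flow_def shift3_nth matrix_3_simps algebra_simps)
  show ?thesis
    unfolding f
    by (rule has_vector_derivative_eq_rhs, (rule derivative_eq_intros refl | simp)+)
      (simp add: drift_def shift3_nth matrix_3_simps algebra_simps power2_eq_square)
qed

text \<open>The limit of Q_t, that is sigma^2 times the integral of e^{sB} e^{sB^T} over s >= 0; the
  entries come from the integrals of s^k e^{-2cs}, equal to k! / (2c)^{k+1}.\<close>

definition cov_inf :: "real \<Rightarrow> real \<Rightarrow> real^3^3" where
  "cov_inf c \<sigma> = \<sigma>\<^sup>2 *\<^sub>R vector
     [vector [1 / (2 * c) + 1 / (4 * c^3) + 3 / (16 * c^5), 1 / (4 * c^2) + 3 / (16 * c^4), 1 / (8 * c^3)],
      vector [1 / (4 * c^2) + 3 / (16 * c^4), 1 / (2 * c) + 1 / (4 * c^3), 1 / (4 * c^2)],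
      vector [1 / (8 * c^3), 1 / (4 * c^2), 1 / (2 * c)]]"

lemma transpose_cov_inf: "transpose (cov_inf c \<sigma>) = cov_inf c \<sigma>"
  by (simp add: cov_inf_def matrix_3_simps)

text \<open>It says that e^{tB} Q e^{tB^T} has derivative - sigma^2 e^{tB} e^{tB^T}; the value of
  the covariance integral and its monotonicity both come from there.\<close>

lemma cov_inf_lyapunov:
  assumes "c \<noteq> 0"
  shows "drift c ** cov_inf c \<sigma> + cov_inf c \<sigma> ** transpose (drift c) = - \<sigma>\<^sup>2 *\<^sub>R mat 1"
  using assms by (simp add: cov_inf_def drift_def matrix_3_simps) (simp add: field_simps eval_nat_numeral)

text \<open>Q_t with the integral already evaluated, see \<open>ou_cov_eq\<close>. In this form the
  composition identities below are plain matrix algebra.\<close>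

definition cov_fin :: "real \<Rightarrow> real \<Rightarrow> real \<Rightarrow> real^3^3" where
  "cov_fin c \<sigma> t = cov_inf c \<sigma> - flow c t ** cov_inf c \<sigma> ** transpose (flow c t)"

lemma has_real_derivative_cov_form:
  assumes "c \<noteq> 0"
  shows "((\<lambda>t. (transpose (flow c t) *v v) \<bullet> (cov_inf c \<sigma> *v (transpose (flow c t) *v w))) has_real_derivative
     - \<sigma>\<^sup>2 * ((transpose (flow c t) *v v) \<bullet> (transpose (flow c t) *v w))) (at t within S)"
proof -
  let ?x = "\<lambda>v. transpose (flow c t) *v v" and ?B = "transpose (drift c)" and ?Q = "cov_inf c \<sigma>"
  have dQ: "((\<lambda>t. ?Q *v (transpose (flow c t) *v w)) has_vector_derivative ?Q *v (?B *v ?x w)) (at t within S)"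
    by (rule bounded_linear.has_vector_derivative[OF matrix_vector_mul_bounded_linear has_vector_derivative_flow_transpose])
  have "((\<lambda>t. (transpose (flow c t) *v v) \<bullet> (?Q *v (transpose (flow c t) *v w))) has_vector_derivative
     ?x v \<bullet> (?Q *v (?B *v ?x w)) + (?B *v ?x v) \<bullet> (?Q *v ?x w)) (at t within S)"
    by (rule bounded_bilinear.has_vector_derivative[OF bounded_bilinear_inner has_vector_derivative_flow_transpose dQ])
  moreover have "?x v \<bullet> (?Q *v (?B *v ?x w)) + (?B *v ?x v) \<bullet> (?Q *v ?x w)
      = ?x v \<bullet> ((drift c ** ?Q + ?Q ** ?B) *v ?x w)"
    by (simp add: matrix_vector_mult_add_rdistrib inner_add_right inner_matrix_transpose[of _ "drift c"]
        flip: matrix_vector_mul_assoc)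
  moreover have "\<dots> = - \<sigma>\<^sup>2 * (?x v \<bullet> ?x w)"
    by (simp add: cov_inf_lyapunov[OF assms] matrix_vector_mul_scaleR_left del: scaleR_minus_left)
  ultimately show ?thesis
    by (simp add: has_real_derivative_iff_has_vector_derivative)
qed

lemma matrix_eqI_inner:
  fixes A B :: "real^'n^'m"
  assumes "\<And>v w. v \<bullet> (A *v w) = v \<bullet> (B *v w)"
  shows "A = B"
  using assms by (metis matrix_eq vector_eq_ldot)

lemma continuous_on_flow: "continuous_on S (\<lambda>s. flow c s ** transpose (flow c s))"
proof -
  have bil: "bounded_bilinear ((**) :: real^3^3 \<Rightarrow> real^3^3 \<Rightarrow> real^3^3)"
    unfolding bilinear_conv_bounded_bilinear[symmetric] bilinear_def
    by (auto intro!: linearI simp: matrix_add_ldistrib matrix_add_rdistrib matrix_mul_scaleR_left matrix_mul_scaleR_right)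
  have "transpose (flow c s) = exp (- c * s) *\<^sub>R (mat 1 + s *\<^sub>R transpose shift3 + (s\<^sup>2 / 2) *\<^sub>R (transpose shift3 ** transpose shift3))" for s
    by (simp add: flow_def shift3_nth matrix_3_simps)
  then show ?thesis
    by (simp only: flow_shift3) (intro bounded_bilinear.continuous_on[OF bil] continuous_intros; simp)
qed

text \<open>Testing both matrices against v and w turns the matrix integral into a scalar one, with
  antiderivative supplied by \<open>has_real_derivative_cov_form\<close>.\<close>

lemma ou_cov_eq:
  assumes "c \<noteq> 0" "t \<ge> 0"
  shows "ou_cov c \<sigma> t = cov_fin c \<sigma> t"
proof (rule matrix_eqI_inner)
  fix v w :: "real^3"
  let ?G = "\<lambda>s. flow c s ** transpose (flow c s)"
  let ?\<phi> = "\<lambda>t. (transpose (flow c t) *v v) \<bullet> (cov_inf c \<sigma> *v (transpose (flow c t) *v w))"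
  have int: "?G integrable_on {0..t}"
    by (rule integrable_continuous_interval[OF continuous_on_flow])
  have bl: "bounded_linear (\<lambda>A :: real^3^3. v \<bullet> (A *v w))"
    by (intro linear_conv_bounded_linear[THEN iffD1] linearI)
       (simp_all add: matrix_vector_mult_add_rdistrib matrix_vector_mul_scaleR_left inner_add_right)
  have G: "v \<bullet> (?G s *v w) = (transpose (flow c s) *v v) \<bullet> (transpose (flow c s) *v w)" for s
    by (simp add: inner_matrix_transpose[of v] flip: matrix_vector_mul_assoc)
  have "((\<lambda>s. - \<sigma>\<^sup>2 * (v \<bullet> (?G s *v w))) has_integral (?\<phi> t - ?\<phi> 0)) {0..t}"
    using assms(2)
    unfolding G
    by (intro fundamental_theorem_of_calculus)
       (use has_real_derivative_cov_form[OF assms(1)] in \<open>simp_all flip: has_real_derivative_iff_has_vector_derivative\<close>)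
  moreover have "((\<lambda>s. - \<sigma>\<^sup>2 * (v \<bullet> (?G s *v w))) has_integral (- \<sigma>\<^sup>2 * (v \<bullet> (integral {0..t} ?G *v w)))) {0..t}"
    using has_integral_linear[OF integrable_integral[OF int] bl]
    by (intro has_integral_mult_right) (simp add: o_def)
  ultimately have "?\<phi> t - ?\<phi> 0 = - \<sigma>\<^sup>2 * (v \<bullet> (integral {0..t} ?G *v w))"
    by (rule has_integral_unique)
  then show "v \<bullet> (ou_cov c \<sigma> t *v w) = v \<bullet> (cov_fin c \<sigma> t *v w)"
    by (simp add: ou_cov_def cov_fin_def mat_exp_drift mat_exp_transpose_drift matrix_vector_mul_scaleR_left
        matrix_vector_mult_diff_rdistrib inner_diff_right inner_matrix_transpose[of v "flow c t"] flip: matrix_vector_mul_assoc)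
qed

lemma transpose_cov_fin: "transpose (cov_fin c \<sigma> t) = cov_fin c \<sigma> t"
proof -
  have "transpose (A - B) = transpose A - transpose B" for A B :: "real^3^3"
    by (simp add: transpose_def vec_eq_iff)
  then show ?thesis
    by (simp add: cov_fin_def matrix_transpose_mul matrix_mul_assoc transpose_cov_inf)
qed

lemma matrix_diff_ldistrib: "A ** (B - C) = A ** B - A ** C" for B C :: "'a::ring_1^'n^'m"
  by (simp add: vec_eq_iff matrix_matrix_mult_def sum_subtractf right_diff_distrib)

lemma matrix_diff_rdistrib: "(A - B) ** C = A ** C - B ** C" for A B :: "'a::ring_1^'n^'m"
  by (simp add: vec_eq_iff matrix_matrix_mult_def sum_subtractf left_diff_distrib)

context
  fixes c \<sigma> :: real
  assumes c: "c > 0" and \<sigma>: "\<sigma> > 0"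
begin

text \<open>The derivative is - sigma^2 |e^{rB^T} v|^2, and e^{rB^T} is injective. Positivity and
  monotonicity of the covariances rest on this.\<close>

lemma cov_form_strict_antimono:
  assumes "s < t" "v \<noteq> 0"
  shows "(transpose (flow c t) *v v) \<bullet> (cov_inf c \<sigma> *v (transpose (flow c t) *v v))
     < (transpose (flow c s) *v v) \<bullet> (cov_inf c \<sigma> *v (transpose (flow c s) *v v))"
proof (rule DERIV_neg_imp_decreasing[OF assms(1)])
  fix r
  have "transpose (flow c r) *v v \<noteq> 0"
    using assms(2) transpose_invertible[OF invertible_flow]
    by (metis matrix_inv_cancel_vec(2) matrix_vector_mult_0_right)
  then have "- \<sigma>\<^sup>2 * ((transpose (flow c r) *v v) \<bullet> (transpose (flow c r) *v v)) < 0"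
    using \<sigma> by (simp add: mult_pos_pos)
  then show "\<exists>y. ((\<lambda>r. (transpose (flow c r) *v v) \<bullet> (cov_inf c \<sigma> *v (transpose (flow c r) *v v))) has_real_derivative y) (at r) \<and> y < 0"
    using has_real_derivative_cov_form[of c v \<sigma> v r UNIV] c by blast
qed

lemma cov_fin_form:
  "v \<bullet> (cov_fin c \<sigma> t *v v) = v \<bullet> (cov_inf c \<sigma> *v v)
      - (transpose (flow c t) *v v) \<bullet> (cov_inf c \<sigma> *v (transpose (flow c t) *v v))"
  by (simp add: cov_fin_def matrix_vector_mult_diff_rdistrib inner_diff_right
      inner_matrix_transpose[of v "flow c t"] flip: matrix_vector_mul_assoc)

lemma flow_tendsto_0:
  "((\<lambda>t. flow c t *v x) \<longlongrightarrow> 0) at_top" "((\<lambda>t. transpose (flow c t) *v x) \<longlongrightarrow> 0) at_top"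
proof -
  have lim: "((\<lambda>t. exp (- c * t) * (1 + t + t\<^sup>2 / 2) * norm x) \<longlongrightarrow> 0) at_top"
    using c by real_asymp
  show "((\<lambda>t. flow c t *v x) \<longlongrightarrow> 0) at_top" "((\<lambda>t. transpose (flow c t) *v x) \<longlongrightarrow> 0) at_top"
    by (rule Lim_null_comparison[OF _ lim], rule eventually_mono[OF eventually_ge_at_top[of 0]], use norm_flow_le in blast)+
qed

text \<open>Along the flow the form decreases strictly and tends to 0, so it is positive at time 0;
  the intermediate value at time 1 makes the inequality strict.\<close>

lemma spd_cov_inf: "spd (cov_inf c \<sigma>)"
proof -
  let ?\<phi> = "\<lambda>v t. (transpose (flow c t) *v v) \<bullet> (cov_inf c \<sigma> *v (transpose (flow c t) *v v))"
  have "0 < v \<bullet> (cov_inf c \<sigma> *v v)" if v: "v \<noteq> 0" for v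
  proof -
    have "(?\<phi> v \<longlongrightarrow> 0 \<bullet> (cov_inf c \<sigma> *v 0)) at_top"
      by (intro tendsto_inner bounded_linear.tendsto[OF matrix_vector_mul_bounded_linear] flow_tendsto_0)
    moreover have "eventually (\<lambda>t. ?\<phi> v t \<le> ?\<phi> v 1) at_top"
      using eventually_gt_at_top[of 1] by eventually_elim (use cov_form_strict_antimono[OF _ v] less_imp_le in blast)
    ultimately have "0 \<bullet> (cov_inf c \<sigma> *v 0) \<le> ?\<phi> v 1"
      by (rule tendsto_upperbound) simp
    then have "0 \<le> ?\<phi> v 1" by simp
    also have "\<dots> < ?\<phi> v 0" by (rule cov_form_strict_antimono[OF _ v]) simp
    finally show ?thesis by (simp add: transpose_mat)
  qed
  then show ?thesis by (simp add: spd_def transpose_cov_inf)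
qed

lemma spd_cov_fin:
  assumes "t > 0" shows "spd (cov_fin c \<sigma> t)"
  using cov_form_strict_antimono[OF assms]
  by (simp add: spd_def transpose_cov_fin cov_fin_form transpose_mat)

lemma cov_fin_le: "v \<bullet> (cov_fin c \<sigma> t *v v) \<le> v \<bullet> (cov_inf c \<sigma> *v v)"
  using spd_nonneg[OF spd_cov_inf] by (simp add: cov_fin_form)

lemma cov_fin_mono: "s \<le> t \<Longrightarrow> v \<bullet> (cov_fin c \<sigma> s *v v) \<le> v \<bullet> (cov_fin c \<sigma> t *v v)"
  using cov_form_strict_antimono[of s t v]
  by (cases "s = t"; cases "v = 0") (auto simp: cov_fin_form)

text \<open>The covariance side of the semigroup law: noise accumulated during t is carried along by
  the flow for time s, and fresh noise of duration s is added.\<close>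

lemma cov_fin_add:
  "flow c s ** cov_fin c \<sigma> t ** transpose (flow c s) + cov_fin c \<sigma> s = cov_fin c \<sigma> (s + t)"
  by (simp add: cov_fin_def flow_add matrix_transpose_mul matrix_mul_assoc matrix_diff_ldistrib matrix_diff_rdistrib)

text \<open>The covariance side of the invariance of mu.\<close>

lemma cov_inf_add:
  "flow c s ** cov_inf c \<sigma> ** transpose (flow c s) + cov_fin c \<sigma> s = cov_inf c \<sigma>"
  by (simp add: cov_fin_def)

end

text \<open>Expand the nonnegative form of P at w - P^{-1} v with w = Q^{-1} v, and use w . P w <= w
  . Q w = v . w. An ordering of covariances thereby becomes an ordering of Gaussian
  exponents.\<close>

lemma spd_inv_antimono:
  assumes P: "spd P" and Q: "spd Q" and le: "\<And>v. v \<bullet> (P *v v) \<le> v \<bullet> (Q *v v)"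
  shows "v \<bullet> (matrix_inv Q *v v) \<le> v \<bullet> (matrix_inv P *v v)"
proof -
  define w where "w = matrix_inv Q *v v"
  let ?J = "matrix_inv P"
  note iP = spd_invertible[OF P]
  have v: "v = Q *v w" by (simp add: w_def matrix_inv_cancel_vec[OF spd_invertible[OF Q]])
  have "0 \<le> (w - ?J *v v) \<bullet> (P *v (w - ?J *v v))"
    by (rule spd_nonneg[OF P])
  also have "\<dots> = w \<bullet> (P *v w) - 2 * (v \<bullet> w) + v \<bullet> (?J *v v)"
    using spd_sym[OF P, of "?J *v v" w]
    by (simp add: matrix_vector_mult_diff_distrib matrix_inv_cancel_vec[OF iP] inner_diff inner_commute)
  also have "\<dots> \<le> v \<bullet> (?J *v v) - v \<bullet> w"
    using le[of w] by (simp add: v inner_commute)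
  finally show ?thesis by (simp add: w_def)
qed

section \<open>The invariant measure and the semigroup on \<open>L\<^sup>2\<close>\<close>

text \<open>Fubini on a product of two Gaussian laws. The map \<phi> is kept abstract because
  invariance needs e^{tB} x - y and the semigroup law e^{sB} y + z.\<close>

lemma
  fixes f :: "real^3 \<Rightarrow> real"
  assumes P: "spd P" and Q: "spd Q" and R: "spd R"
    and \<phi> [measurable]: "\<phi> \<in> borel_measurable (gmeas P \<Otimes>\<^sub>M gmeas Q)"
    and D: "distr (gmeas P \<Otimes>\<^sub>M gmeas Q) borel \<phi> = gmeas R"
    and f: "integrable (gmeas R) f"
  shows AE_integrable_convolution: "AE x in gmeas P. integrable (gmeas Q) (\<lambda>y. f (\<phi> (x, y)))"
    and integral_convolution: "(LINT x|gmeas P. LINT y|gmeas Q. f (\<phi> (x, y))) = (LINT s|gmeas R. f s)"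
proof -
  interpret P: prob_space "gmeas P" by (rule prob_space_gmeas[OF P])
  interpret Q: prob_space "gmeas Q" by (rule prob_space_gmeas[OF Q])
  interpret PQ: pair_prob_space "gmeas P" "gmeas Q" ..
  have [measurable]: "f \<in> borel_measurable borel" using f by auto
  have i: "integrable (gmeas P \<Otimes>\<^sub>M gmeas Q) (\<lambda>p. f (\<phi> p))"
    using f unfolding D[symmetric] by (subst (asm) integrable_distr_eq) auto
  show "AE x in gmeas P. integrable (gmeas Q) (\<lambda>y. f (\<phi> (x, y)))"
    by (rule PQ.AE_integrable_fst'[OF i])
  show "(LINT x|gmeas P. LINT y|gmeas Q. f (\<phi> (x, y))) = (LINT s|gmeas R. f s)"
    unfolding D[symmetric] PQ.integral_fst'[OF i] by (simp add: integral_distr)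
qed

text \<open>Nonnegativity of the variance. The right-hand side is an extended integral, which is
  infinite when f is not square integrable, so the contraction estimate can be stated for all
  classes.\<close>

lemma integral_power2_le_nn_integral:
  fixes f :: "'a \<Rightarrow> real"
  assumes "prob_space M" and [measurable]: "f \<in> borel_measurable M"
  shows "ennreal ((LINT x|M. f x)\<^sup>2) \<le> (\<integral>\<^sup>+x. ennreal ((f x)\<^sup>2) \<partial>M)"
proof (cases "integrable M (\<lambda>x. (f x)\<^sup>2)")
  case True
  interpret prob_space M by fact
  have f: "integrable M f"
    by (rule square_integrable_imp_integrable[OF _ True]) simp
  have "0 \<le> (LINT x|M. (f x - (LINT x|M. f x))\<^sup>2)" by simp
  also have "\<dots> = (LINT x|M. (f x)\<^sup>2) - (LINT x|M. f x)\<^sup>2"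
    by (rule variance_eq[OF f True])
  finally show ?thesis
    using True by (simp add: nn_integral_eq_integral ennreal_leI)
next
  case False
  then have "\<not> (\<integral>\<^sup>+x. ennreal ((f x)\<^sup>2) \<partial>M) < \<infinity>"
    using integrableI_nonneg[of "\<lambda>x. (f x)\<^sup>2" M] assms(2) by fastforce
  then have "(\<integral>\<^sup>+x. ennreal ((f x)\<^sup>2) \<partial>M) = \<infinity>"
    by (metis top.not_eq_extremum infinity_ennreal_def)
  then show ?thesis by simp
qed

section \<open>Passing between almost everywhere classes and representatives\<close>

lemma rep_ae_fun_measurable [measurable]: "rep_ae_fun F \<in> borel_measurable borel"
  using Quotient3_rep_reflp[OF Quotient3_ae_fun, of F] by (simp add: ae_eq_def)

lemma abs_rep_ae_fun [simp]: "abs_ae_fun (rep_ae_fun F) = F"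
  by (rule Quotient3_abs_rep[OF Quotient3_ae_fun])

lemma abs_ae_fun_eq_iff:
  assumes "f \<in> borel_measurable borel" "g \<in> borel_measurable borel"
  shows "abs_ae_fun f = abs_ae_fun g \<longleftrightarrow> (AE x in lborel. f x = g x)"
  using Quotient3_rel[OF Quotient3_ae_fun, of f g] assms by (auto simp: ae_eq_def)

lemma rep_abs_ae_fun:
  assumes "f \<in> borel_measurable borel"
  shows "AE x in lborel. rep_ae_fun (abs_ae_fun f) x = f x"
  using abs_ae_fun_eq_iff[OF rep_ae_fun_measurable assms] by (metis abs_rep_ae_fun)

lemma ae_eq_refl: "f \<in> borel_measurable borel \<Longrightarrow> ae_eq f f"
  by (simp add: ae_eq_def)

lemma abs_ae_fun_plus:
  "f \<in> borel_measurable borel \<Longrightarrow> g \<in> borel_measurable borel \<Longrightarrow>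
    abs_ae_fun f + abs_ae_fun g = abs_ae_fun (\<lambda>x. f x + g x)"
  by (rule plus_ae_fun.abs_eq; rule ae_eq_refl)

lemma abs_ae_fun_scaleR:
  "f \<in> borel_measurable borel \<Longrightarrow> a *\<^sub>R abs_ae_fun f = abs_ae_fun (\<lambda>x. a * f x)"
  by (rule scaleR_ae_fun.abs_eq; rule ae_eq_refl)

lemma abs_ae_fun_zero: "0 = abs_ae_fun (\<lambda>_. 0)"
  by (rule zero_ae_fun.abs_eq)

lemma ou_semigroup_abs:
  "f \<in> borel_measurable borel \<Longrightarrow> ou_semigroup c \<sigma> t (abs_ae_fun f) = abs_ae_fun (ou_fun c \<sigma> t f)"
  by (rule ou_semigroup.abs_eq; rule ae_eq_refl)

lemma rep_ae_fun_plus: "AE x in lborel. rep_ae_fun (F + G) x = rep_ae_fun F x + rep_ae_fun G x"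
  using rep_abs_ae_fun[of "\<lambda>x. rep_ae_fun F x + rep_ae_fun G x"]
  by (simp flip: abs_ae_fun_plus)

lemma rep_ae_fun_scaleR: "AE x in lborel. rep_ae_fun (a *\<^sub>R F) x = a * rep_ae_fun F x"
  using rep_abs_ae_fun[of "\<lambda>x. a * rep_ae_fun F x"]
  by (simp flip: abs_ae_fun_scaleR)

lemma rep_ou_semigroup: "AE x in lborel. rep_ae_fun (ou_semigroup c \<sigma> t F) x = ou_fun c \<sigma> t (rep_ae_fun F) x"
  using rep_abs_ae_fun[OF borel_measurable_ou_fun[OF rep_ae_fun_measurable], of c \<sigma> t F]
  by (simp flip: ou_semigroup_abs)

lemma ou_semigroup_0 [simp]: "ou_semigroup c \<sigma> 0 F = F"
proof -
  have "ou_fun c \<sigma> 0 f = f" for f by (simp add: ou_fun_def fun_eq_iff)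
  then show ?thesis
    using ou_semigroup_abs[of "rep_ae_fun F" c \<sigma> 0] by simp
qed

section \<open>Existence and uniqueness of the invariant measure\<close>

context
  fixes c \<sigma> :: real
  assumes c: "c > 0" and \<sigma>: "\<sigma> > 0"
begin

lemma ou_fun_eq:
  assumes "t > 0" and [measurable]: "f \<in> borel_measurable borel"
  shows "ou_fun c \<sigma> t f x = (LINT y|gmeas (cov_fin c \<sigma> t). f (flow c t *v x - y))"
  using assms c
  by (subst integral_gmeas) (simp_all add: ou_fun_def mat_exp_drift ou_cov_eq gauss_def flip: integral_mult_right_zero)

lemma measurable_flow_minus [measurable]:
  "(\<lambda>(x, y). flow c t *v x - y) \<in> borel_measurable (gmeas P \<Otimes>\<^sub>M gmeas Q)"
  "(\<lambda>(x, y). flow c t *v x + y) \<in> borel_measurable (gmeas P \<Otimes>\<^sub>M gmeas Q)"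
  by measurable

lemma distr_cov_inf:
  assumes "t > 0"
  shows "distr (gmeas (cov_inf c \<sigma>) \<Otimes>\<^sub>M gmeas (cov_fin c \<sigma> t)) borel (\<lambda>(x, y). flow c t *v x - y) = gmeas (cov_inf c \<sigma>)"
  using distr_gmeas_convolution(2)[OF spd_cov_inf[OF c \<sigma>] spd_cov_fin[OF c \<sigma> assms] invertible_flow]
  by (simp add: cov_inf_add[OF c \<sigma>])

lemma
  assumes t: "t > 0" and f: "integrable (gmeas (cov_inf c \<sigma>)) f"
  shows AE_integrable_ou_fun:
      "AE x in gmeas (cov_inf c \<sigma>). integrable (gmeas (cov_fin c \<sigma> t)) (\<lambda>y. f (flow c t *v x - y))"
    and integral_ou_fun: "(LINT x|gmeas (cov_inf c \<sigma>). ou_fun c \<sigma> t f x) = (LINT x|gmeas (cov_inf c \<sigma>). f x)"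
proof -
  have [measurable]: "f \<in> borel_measurable borel" using f by auto
  note args = spd_cov_inf[OF c \<sigma>] spd_cov_fin[OF c \<sigma> t] spd_cov_inf[OF c \<sigma>] measurable_flow_minus(1) distr_cov_inf[OF t] f
  show "AE x in gmeas (cov_inf c \<sigma>). integrable (gmeas (cov_fin c \<sigma> t)) (\<lambda>y. f (flow c t *v x - y))"
    using AE_integrable_convolution[OF args] by simp
  show "(LINT x|gmeas (cov_inf c \<sigma>). ou_fun c \<sigma> t f x) = (LINT x|gmeas (cov_inf c \<sigma>). f x)"
    using integral_convolution[OF args] by (simp add: ou_fun_eq[OF t])
qed

lemma prob_space_inf: "prob_space (gmeas (cov_inf c \<sigma>))"
  and prob_space_fin: "t > 0 \<Longrightarrow> prob_space (gmeas (cov_fin c \<sigma> t))"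
  using prob_space_gmeas spd_cov_inf[OF c \<sigma>] spd_cov_fin[OF c \<sigma>] by blast+

lemma ou_invariant_gmeas: "ou_invariant c \<sigma> (gmeas (cov_inf c \<sigma>))"
  unfolding ou_invariant_def
proof (intro conjI allI impI ballI)
  interpret prob_space "gmeas (cov_inf c \<sigma>)" by (rule prob_space_inf)
  fix t :: real and f :: "real^3 \<Rightarrow> real"
  assume t: "t > 0" and [measurable]: "f \<in> borel_measurable borel" and "bounded (range f)"
  then obtain B where "\<And>x. \<bar>f x\<bar> \<le> B" by (auto simp: bounded_iff)
  then have "integrable (gmeas (cov_inf c \<sigma>)) f"
    by (intro integrable_const_bound[of _ B]) auto
  then show "(LINT x|gmeas (cov_inf c \<sigma>). ou_fun c \<sigma> t f x) = (LINT x|gmeas (cov_inf c \<sigma>). f x)"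
    by (rule integral_ou_fun[OF t])
qed (simp_all add: prob_space_inf)

text \<open>The flow contracts, so \<open>T(t) f\<close> flattens to a constant for Lipschitz \<open>f\<close>.\<close>

lemma ou_invariant_limit:
  assumes inv: "ou_invariant c \<sigma> \<nu>" and [measurable]: "f \<in> borel_measurable borel"
    and b: "\<And>x. \<bar>f x\<bar> \<le> 1" and lip: "\<And>x y. \<bar>f x - f y\<bar> \<le> K * norm (x - y)"
  shows "(\<lambda>n. ou_fun c \<sigma> (real (Suc n)) f 0) \<longlonglongrightarrow> (LINT x|\<nu>. f x)"
proof -
  have [measurable_cong]: "sets \<nu> = sets borel" and "prob_space \<nu>" using inv by (simp_all add: ou_invariant_def)
  interpret prob_space \<nu> by fact
  let ?u = "\<lambda>n x. ou_fun c \<sigma> (real (Suc n)) f x"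
  have [measurable]: "ou_fun c \<sigma> t f \<in> borel_measurable borel" for t
    by (rule borel_measurable_ou_fun) fact
  have int: "integrable (gmeas (cov_fin c \<sigma> t)) (\<lambda>y. f (x - y))" if "t > 0" for x t
  proof -
    interpret F: prob_space "gmeas (cov_fin c \<sigma> t)" by (rule prob_space_fin[OF that])
    show ?thesis using b by (intro F.integrable_const_bound[of _ 1]) auto
  qed
  have ub: "\<bar>ou_fun c \<sigma> t f x\<bar> \<le> 1" if t: "t > 0" for t x
  proof -
    interpret F: prob_space "gmeas (cov_fin c \<sigma> t)" by (rule prob_space_fin[OF t])
    have "\<bar>ou_fun c \<sigma> t f x\<bar> \<le> (LINT y|gmeas (cov_fin c \<sigma> t). 1)"
      unfolding ou_fun_eq[OF t assms(2)]
      by (rule order_trans[OF integral_abs_bound integral_mono])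
         (use b int[OF t] in \<open>auto intro: F.integrable_const\<close>)
    then show ?thesis using F.prob_space by simp
  qed
  have ud: "\<bar>ou_fun c \<sigma> t f x - ou_fun c \<sigma> t f 0\<bar> \<le> K * norm (flow c t *v x)" if t: "t > 0" for t x
  proof -
    interpret F: prob_space "gmeas (cov_fin c \<sigma> t)" by (rule prob_space_fin[OF t])
    have i: "integrable (gmeas (cov_fin c \<sigma> t)) (\<lambda>y. f (flow c t *v x - y) - f (0 - y))"
      by (intro Bochner_Integration.integrable_diff int t)
    have "ou_fun c \<sigma> t f x - ou_fun c \<sigma> t f 0 = (LINT y|gmeas (cov_fin c \<sigma> t). f (flow c t *v x - y) - f (0 - y))"
      using Bochner_Integration.integral_diff[OF int[OF t] int[OF t], of "flow c t *v x" 0]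
      by (simp add: ou_fun_eq[OF t assms(2)])
    also have "\<bar>\<dots>\<bar> \<le> (LINT y|gmeas (cov_fin c \<sigma> t). K * norm (flow c t *v x))"
    proof (rule order_trans[OF integral_abs_bound integral_mono])
      show "\<bar>f (flow c t *v x - y) - f (0 - y)\<bar> \<le> K * norm (flow c t *v x)" for y
        using lip[of "flow c t *v x - y" "0 - y"] by simp
    qed (use i in \<open>auto intro: F.integrable_const\<close>)
    finally show ?thesis using F.prob_space by simp
  qed
  \<comment> \<open>Invariance keeps the integral of \<open>?u n\<close> equal to that of f for
    every n, so it suffices that the deviation from the value at 0 tends to 0; the constant 2
    dominates it.\<close>
  have "(\<lambda>n. LINT x|\<nu>. ?u n x - ?u n 0) \<longlonglongrightarrow> (LINT x|\<nu>. 0)"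
  proof (rule integral_dominated_convergence[where w = "\<lambda>_. 2"])
    show "AE x in \<nu>. (\<lambda>n. ?u n x - ?u n 0) \<longlonglongrightarrow> 0"
    proof (rule AE_I2)
      fix x
      have "filterlim (\<lambda>n. real (Suc n)) at_top sequentially"
        by (rule filterlim_compose[OF filterlim_real_sequentially filterlim_Suc])
      then have "(\<lambda>n. flow c (real (Suc n)) *v x) \<longlonglongrightarrow> 0"
        by (rule filterlim_compose[OF flow_tendsto_0(1)[OF c \<sigma>]])
      then have "(\<lambda>n. K * norm (flow c (real (Suc n)) *v x)) \<longlonglongrightarrow> 0"
        by (intro tendsto_mult_right_zero tendsto_norm_zero)
      then show "(\<lambda>n. ?u n x - ?u n 0) \<longlonglongrightarrow> 0"
        by (rule Lim_null_comparison[rotated], intro always_eventually allI)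
          (unfold real_norm_def, rule ud, simp)
    qed
    show "AE x in \<nu>. norm (?u n x - ?u n 0) \<le> 2" for n
    proof (rule AE_I2)
      fix x
      have "real (Suc n) > 0" by simp
      from ub[OF this, of x] ub[OF this, of 0] show "norm (?u n x - ?u n 0) \<le> 2"
        unfolding real_norm_def by linarith
    qed
  qed (simp_all del: of_nat_Suc)
  moreover have "(LINT x|\<nu>. ?u n x - ?u n 0) = (LINT x|\<nu>. f x) - ?u n 0" for n
  proof -
    have "integrable \<nu> (?u n)" using ub[of "real (Suc n)"] by (intro integrable_const_bound[of _ 1]) auto
    moreover have "(LINT x|\<nu>. ?u n x) = (LINT x|\<nu>. f x)"
    proof -
      have "bounded (range f)" using b by (auto simp: bounded_iff)
      then show ?thesis using inv unfolding ou_invariant_def by simp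
    qed
    ultimately show ?thesis by (simp add: prob_space)
  qed
  ultimately have "(\<lambda>n. (LINT x|\<nu>. f x) - ?u n 0) \<longlonglongrightarrow> 0" by simp
  from tendsto_diff[OF tendsto_const[of "LINT x|\<nu>. f x"] this] show ?thesis by simp
qed

text \<open>The sequence in \<open>ou_invariant_limit\<close> does not mention the measure, so all
  invariant measures integrate such Lipschitz functions alike; Lipschitz cut-offs of the distance to
  C decrease to its indicator.\<close>

lemma ou_invariant_emeasure_closed:
  assumes inv: "ou_invariant c \<sigma> \<nu>" and C: "closed C" "C \<noteq> {}"
  shows "measure \<nu> C = measure (gmeas (cov_inf c \<sigma>)) C"
proof -
  \<comment> \<open>\<open>infdist\<close> to the empty set is 0, which would make every cut-off
    constantly 1; hence C is taken nonempty.\<close>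
  define f where "f = (\<lambda>k x. max 0 (1 - real k * infdist x C))"
  have [measurable]: "f k \<in> borel_measurable borel" for k
    unfolding f_def by (intro borel_measurable_continuous_onI continuous_intros)
  have b: "\<bar>f k x\<bar> \<le> 1" for k x by (auto simp: f_def infdist_nonneg)
  have lip: "\<bar>f k x - f k y\<bar> \<le> real k * norm (x - y)" for k x y
  proof -
    have "\<bar>infdist x C - infdist y C\<bar> \<le> norm (x - y)"
      using infdist_triangle_abs[of x C y] by (simp add: dist_norm)
    then have "real k * \<bar>infdist x C - infdist y C\<bar> \<le> real k * norm (x - y)"
      by (rule mult_left_mono) simp
    then have "\<bar>real k * infdist x C - real k * infdist y C\<bar> \<le> real k * norm (x - y)"
      by (simp add: abs_mult flip: right_diff_distrib)
    then show ?thesis unfolding f_def by linarith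
  qed
  have eq: "(LINT x|\<nu>. f k x) = (LINT x|gmeas (cov_inf c \<sigma>). f k x)" for k
    by (rule LIMSEQ_unique[OF ou_invariant_limit[OF inv _ b lip] ou_invariant_limit[OF ou_invariant_gmeas _ b lip]]) measurable
  have pt: "(\<lambda>k. f k x) \<longlonglongrightarrow> indicator C x" for x
  proof (cases "x \<in> C")
    case False
    then have d: "infdist x C > 0"
      using C in_closed_iff_infdist_zero[OF C, of x] infdist_nonneg[of x C] by linarith
    have "eventually (\<lambda>k. f k x = 0) sequentially"
      using eventually_ge_at_top[of "nat \<lceil>1 / infdist x C\<rceil>"]
    proof eventually_elim
      case (elim k)
      then have "1 / infdist x C \<le> real k" by linarith
      then have "1 \<le> real k * infdist x C" using d by (simp add: field_simps)
      then show ?case by (simp add: f_def)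
    qed
    then show ?thesis using False by (simp add: tendsto_eventually)
  qed (simp add: f_def)
  have lim: "(\<lambda>k. LINT x|M. f k x) \<longlonglongrightarrow> measure M C" if "prob_space M" and [measurable_cong]: "sets M = sets borel" for M
  proof -
    interpret prob_space M by fact
    have [measurable]: "C \<in> sets M" using C that by simp
    have "space M = UNIV" using sets_eq_imp_space_eq[OF that(2)] by simp
    then have "measure M C = (LINT x|M. indicator C x)" by simp
    then show ?thesis
      using integral_dominated_convergence[of "\<lambda>x. indicator C x" M f "\<lambda>_. 1"] pt b by simp
  qed
  show ?thesis
    using LIMSEQ_unique[OF lim[of \<nu>] lim[of "gmeas (cov_inf c \<sigma>)", folded eq]] inv prob_space_inf
    by (simp add: ou_invariant_def)
qed

lemma ou_measure_eq: "ou_measure c \<sigma> = gmeas (cov_inf c \<sigma>)"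
  unfolding ou_measure_def
proof (rule the_equality[where P = "ou_invariant c \<sigma>", OF ou_invariant_gmeas])
  fix \<nu> assume inv: "ou_invariant c \<sigma> \<nu>"
  then have sets: "sets \<nu> = sets borel" and "prob_space \<nu>" by (simp_all add: ou_invariant_def)
  interpret prob_space \<nu> by fact
  interpret G: prob_space "gmeas (cov_inf c \<sigma>)" by (rule prob_space_inf)
  show "\<nu> = gmeas (cov_inf c \<sigma>)"
  proof (rule measure_eqI_generator_eq[where E = "Collect closed" and \<Omega> = UNIV and A = "\<lambda>_. UNIV"])
    show "emeasure \<nu> X = emeasure (gmeas (cov_inf c \<sigma>)) X" if "X \<in> Collect closed" for X
      using that ou_invariant_emeasure_closed[OF inv, of X]
      by (cases "X = {}") (auto simp: emeasure_eq_measure G.emeasure_eq_measure)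
    show "sets \<nu> = sigma_sets UNIV (Collect closed)" "sets (gmeas (cov_inf c \<sigma>)) = sigma_sets UNIV (Collect closed)"
      by (simp_all add: sets borel_eq_closed)
  qed (auto simp: Int_stable_def)
qed

section \<open>The norm of L2, contraction and the semigroup law\<close>

abbreviation "\<mu>inf \<equiv> gmeas (cov_inf c \<sigma>)"

text \<open>An extended real, so that estimates can be chained before finiteness is known;
  finiteness is membership in \<open>L2\<close>, by \<open>L2_iff\<close>.\<close>

definition sqnorm :: "ae_fun \<Rightarrow> ennreal" where
  "sqnorm F = (\<integral>\<^sup>+x. ennreal ((rep_ae_fun F x)\<^sup>2) \<partial>\<mu>inf)"

lemma AE_inf: "(AE x in lborel. P x) \<Longrightarrow> (AE x in \<mu>inf. P x)"
  by (simp add: AE_gmeas[OF spd_cov_inf[OF c \<sigma>]])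

lemma L2_iff: "F \<in> L2 (ou_measure c \<sigma>) \<longleftrightarrow> sqnorm F < \<infinity>"
  by (auto simp: L2_def ou_measure_eq sqnorm_def integrable_iff_bounded)

lemma L2_norm_eq: "L2_norm (ou_measure c \<sigma>) F = sqrt (enn2real (sqnorm F))"
  by (simp add: L2_norm_def ou_measure_eq sqnorm_def integral_eq_nn_integral)

lemma sqnorm_abs:
  assumes "f \<in> borel_measurable borel"
  shows "sqnorm (abs_ae_fun f) = (\<integral>\<^sup>+x. ennreal ((f x)\<^sup>2) \<partial>\<mu>inf)"
  unfolding sqnorm_def
  by (rule nn_integral_cong_AE) (use AE_inf[OF rep_abs_ae_fun[OF assms]] in auto)

lemma sqnorm_0_iff: "sqnorm F = 0 \<longleftrightarrow> F = 0"
proof -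
  have "sqnorm F = 0 \<longleftrightarrow> (AE x in lborel. rep_ae_fun F x = 0)"
    unfolding sqnorm_def
    by (subst nn_integral_0_iff_AE) (auto simp: AE_gmeas[OF spd_cov_inf[OF c \<sigma>]])
  also have "\<dots> \<longleftrightarrow> F = 0"
    using abs_ae_fun_eq_iff[OF rep_ae_fun_measurable, of "\<lambda>_. 0" F] by (simp add: abs_ae_fun_zero)
  finally show ?thesis .
qed

lemma sqnorm_scaleR: "sqnorm (a *\<^sub>R F) = ennreal (a\<^sup>2) * sqnorm F"
proof -
  have "sqnorm (a *\<^sub>R F) = (\<integral>\<^sup>+x. ennreal (a\<^sup>2) * ennreal ((rep_ae_fun F x)\<^sup>2) \<partial>\<mu>inf)"
    unfolding sqnorm_def
    by (rule nn_integral_cong_AE) (use AE_inf[OF rep_ae_fun_scaleR[of a F]] in \<open>auto simp: power_mult_distrib ennreal_mult\<close>)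
  then show ?thesis by (simp add: sqnorm_def nn_integral_cmult)
qed

lemma rep_ae_fun_sum:
  "finite I \<Longrightarrow> AE x in lborel. rep_ae_fun (\<Sum>i\<in>I. F i) x = (\<Sum>i\<in>I. rep_ae_fun (F i) x)"
proof (induction I rule: finite_induct)
  case empty
  show ?case using rep_abs_ae_fun[of "\<lambda>_. 0"] by (simp add: abs_ae_fun_zero)
next
  case (insert i I)
  show ?case
    using insert.IH rep_ae_fun_plus[of "F i" "\<Sum>i\<in>I. F i"] insert.hyps by (auto elim: AE_mp)
qed

text \<open>Cauchy-Schwarz. For m terms with a common bound the total factor is m^2, the square of
  what the triangle inequality for the norm gives, which is what the telescoping below can
  afford.\<close>

lemma sqnorm_sum_le:
  assumes "finite I"
  shows "sqnorm (\<Sum>i\<in>I. F i) \<le> of_nat (card I) * (\<Sum>i\<in>I. sqnorm (F i))"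
proof -
  have "sqnorm (\<Sum>i\<in>I. F i) \<le> (\<integral>\<^sup>+x. ennreal (card I) * (\<Sum>i\<in>I. ennreal ((rep_ae_fun (F i) x)\<^sup>2)) \<partial>\<mu>inf)"
    unfolding sqnorm_def
  proof (rule nn_integral_mono_AE)
    show "AE x in \<mu>inf. ennreal ((rep_ae_fun (\<Sum>i\<in>I. F i) x)\<^sup>2) \<le> ennreal (card I) * (\<Sum>i\<in>I. ennreal ((rep_ae_fun (F i) x)\<^sup>2))"
      using AE_inf[OF rep_ae_fun_sum[OF assms, of F]]
    proof eventually_elim
      case (elim x)
      then show ?case
        using sum_squared_le_sum_of_squares[of "\<lambda>i. rep_ae_fun (F i) x" I]
        by (simp add: sum_nonneg mult.commute ennreal_leI flip: ennreal_mult)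
    qed
  qed
  then show ?thesis
    by (simp add: sqnorm_def nn_integral_cmult nn_integral_sum ennreal_of_nat_eq_real_of_nat del: sum_ennreal)
qed

lemma sqnorm_plus_le: "sqnorm (F + G) \<le> 2 * (sqnorm F + sqnorm G)"
\<comment> \<open>For F = G the set \<open>{F, G}\<close> has one element and the sum over it is F,
  so this case goes through scaling by 2.\<close>
proof (cases "F = G")
  case True
  have "sqnorm (F + G) = sqnorm (2 *\<^sub>R F)" by (simp add: True scaleR_2)
  also have "\<dots> = 2 * (sqnorm F + sqnorm G)"
    by (simp add: sqnorm_scaleR True flip: mult_2)
  finally show ?thesis by simp
next
  case False
  then show ?thesis using sqnorm_sum_le[of "{F, G}" id] by simp
qed

lemma L2_subspace: "subspace (L2 (ou_measure c \<sigma>))"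
proof (rule subspaceI)
  show "0 \<in> L2 (ou_measure c \<sigma>)" using sqnorm_0_iff[of 0] by (simp add: L2_iff)
  show "F + G \<in> L2 (ou_measure c \<sigma>)" if "F \<in> L2 (ou_measure c \<sigma>)" "G \<in> L2 (ou_measure c \<sigma>)" for F G
    using that sqnorm_plus_le[of F G] unfolding L2_iff
    by (auto intro: le_less_trans simp: ennreal_mult_less_top ennreal_add_eq_top less_top)
  show "a *\<^sub>R F \<in> L2 (ou_measure c \<sigma>)" if "F \<in> L2 (ou_measure c \<sigma>)" for a F
    using that unfolding L2_iff sqnorm_scaleR by (auto simp: ennreal_mult_less_top)
qed

lemma L2_integrable: "F \<in> L2 (ou_measure c \<sigma>) \<Longrightarrow> integrable \<mu>inf (rep_ae_fun F)"
  using finite_measure.square_integrable_imp_integrable[of \<mu>inf "rep_ae_fun F"] prob_space_inf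
  by (simp add: L2_def ou_measure_eq prob_space.finite_measure)

lemma AE_integrable_L2:
  assumes "F \<in> L2 (ou_measure c \<sigma>)" "t > 0"
  shows "AE x in lborel. integrable (gmeas (cov_fin c \<sigma> t)) (\<lambda>y. rep_ae_fun F (flow c t *v x - y))"
  using AE_integrable_ou_fun[OF assms(2) L2_integrable[OF assms(1)]]
  by (simp add: AE_gmeas[OF spd_cov_inf[OF c \<sigma>]])

lemma ou_semigroup_eq: "ou_semigroup c \<sigma> t F = abs_ae_fun (ou_fun c \<sigma> t (rep_ae_fun F))"
  using ou_semigroup_abs[of "rep_ae_fun F" c \<sigma> t] by simp

lemma ou_semigroup_scaleR: "ou_semigroup c \<sigma> t (a *\<^sub>R F) = a *\<^sub>R ou_semigroup c \<sigma> t F"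
proof -
  have "a *\<^sub>R F = abs_ae_fun (\<lambda>x. a * rep_ae_fun F x)"
    by (simp flip: abs_ae_fun_scaleR)
  moreover have "ou_fun c \<sigma> t (\<lambda>x. a * f x) = (\<lambda>x. a * ou_fun c \<sigma> t f x)" for f
    by (rule ext) (simp add: ou_fun_def mult.left_commute[of _ a])
  ultimately show ?thesis
    by (simp add: ou_semigroup_abs ou_semigroup_eq[of t F] abs_ae_fun_scaleR borel_measurable_ou_fun)
qed

text \<open>The kernel integrals of both summands have to converge for additivity; on
  \<open>L2\<close> they do so for almost every x, which suffices for an equality of
  classes.\<close>

lemma ou_semigroup_plus:
  assumes F: "F \<in> L2 (ou_measure c \<sigma>)" and G: "G \<in> L2 (ou_measure c \<sigma>)" and t: "t \<ge> 0"
  shows "ou_semigroup c \<sigma> t (F + G) = ou_semigroup c \<sigma> t F + ou_semigroup c \<sigma> t G"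
proof (cases "t = 0")
  case False
  with t have t: "t > 0" by simp
  let ?f = "rep_ae_fun F" and ?g = "rep_ae_fun G"
  have "F + G = abs_ae_fun (\<lambda>x. ?f x + ?g x)"
    by (simp flip: abs_ae_fun_plus)
  moreover have "AE x in lborel. ou_fun c \<sigma> t (\<lambda>x. ?f x + ?g x) x = ou_fun c \<sigma> t ?f x + ou_fun c \<sigma> t ?g x"
    using AE_integrable_L2[OF F t] AE_integrable_L2[OF G t]
    by eventually_elim (simp add: ou_fun_eq[OF t])
  then have "abs_ae_fun (ou_fun c \<sigma> t (\<lambda>x. ?f x + ?g x)) = abs_ae_fun (\<lambda>x. ou_fun c \<sigma> t ?f x + ou_fun c \<sigma> t ?g x)"
    by (subst abs_ae_fun_eq_iff) (auto intro!: borel_measurable_ou_fun borel_measurable_add)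
  ultimately show ?thesis
    by (simp add: ou_semigroup_abs ou_semigroup_eq[of t F] ou_semigroup_eq[of t G] abs_ae_fun_plus borel_measurable_ou_fun)
qed simp

text \<open>Jensen for the Gaussian average at each x, then invariance of mu applied to the square
  of the function.\<close>

lemma ou_semigroup_contraction:
  assumes t: "t \<ge> 0"
  shows "sqnorm (ou_semigroup c \<sigma> t F) \<le> sqnorm F"
proof (cases "t = 0")
  case False
  with t have t: "t > 0" by simp
  let ?f = "rep_ae_fun F"
  interpret Q: prob_space "gmeas (cov_fin c \<sigma> t)" by (rule prob_space_fin[OF t])
  have "sqnorm (ou_semigroup c \<sigma> t F) = (\<integral>\<^sup>+x. ennreal ((ou_fun c \<sigma> t ?f x)\<^sup>2) \<partial>\<mu>inf)"
    unfolding ou_semigroup_eq by (rule sqnorm_abs) (simp add: borel_measurable_ou_fun)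
  also have "\<dots> \<le> (\<integral>\<^sup>+x. (\<integral>\<^sup>+y. ennreal ((?f (flow c t *v x - y))\<^sup>2) \<partial>gmeas (cov_fin c \<sigma> t)) \<partial>\<mu>inf)"
    unfolding ou_fun_eq[OF t rep_ae_fun_measurable]
    by (intro nn_integral_mono integral_power2_le_nn_integral prob_space_fin t) measurable
  also have "\<dots> = (\<integral>\<^sup>+p. ennreal ((?f ((\<lambda>(x, y). flow c t *v x - y) p))\<^sup>2) \<partial>(\<mu>inf \<Otimes>\<^sub>M gmeas (cov_fin c \<sigma> t)))"
    by (subst Q.nn_integral_fst[symmetric]) auto
  also have "\<dots> = (\<integral>\<^sup>+s. ennreal ((?f s)\<^sup>2) \<partial>distr (\<mu>inf \<Otimes>\<^sub>M gmeas (cov_fin c \<sigma> t)) borel (\<lambda>(x, y). flow c t *v x - y))"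
    by (subst nn_integral_distr) auto
  also have "\<dots> = sqnorm F" by (simp add: distr_cov_inf[OF t] sqnorm_def)
  finally show ?thesis .
qed simp

lemma ou_semigroup_L2: "F \<in> L2 (ou_measure c \<sigma>) \<Longrightarrow> t \<ge> 0 \<Longrightarrow> ou_semigroup c \<sigma> t F \<in> L2 (ou_measure c \<sigma>)"
  using ou_semigroup_contraction[of t F] by (auto simp: L2_iff)

lemma ou_semigroup_add:
  assumes F: "F \<in> L2 (ou_measure c \<sigma>)" and t: "t \<ge> 0" and s: "s \<ge> 0"
  shows "ou_semigroup c \<sigma> t (ou_semigroup c \<sigma> s F) = ou_semigroup c \<sigma> (s + t) F"
proof (cases "t = 0 \<or> s = 0")
  case False
  with t s have t: "t > 0" and s: "s > 0" by auto
  let ?f = "rep_ae_fun F"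
  have [measurable]: "ou_fun c \<sigma> s ?f \<in> borel_measurable borel"
    by (simp add: borel_measurable_ou_fun)
  have D: "distr (gmeas (cov_fin c \<sigma> t) \<Otimes>\<^sub>M gmeas (cov_fin c \<sigma> s)) borel (\<lambda>(x, y). flow c s *v x + y)
      = gmeas (cov_fin c \<sigma> (s + t))"
    using distr_gmeas_convolution(1)[OF spd_cov_fin[OF c \<sigma> t] spd_cov_fin[OF c \<sigma> s] invertible_flow]
    by (simp add: cov_fin_add[OF c \<sigma>])
  have "AE x in lborel. ou_fun c \<sigma> t (ou_fun c \<sigma> s ?f) x = ou_fun c \<sigma> (s + t) ?f x"
    using AE_integrable_L2[OF F add_pos_pos[OF s t]]
  proof eventually_elim
    case (elim x)
    \<comment> \<open>The noise y of the outer average is transported by the flow of the inner one;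
      together with the inner noise z it has the covariance computed in
      \<open>cov_fin_add\<close>.\<close>
    have "ou_fun c \<sigma> t (ou_fun c \<sigma> s ?f) x = (LINT y|gmeas (cov_fin c \<sigma> t). LINT z|gmeas (cov_fin c \<sigma> s).
        ?f (flow c (s + t) *v x - (flow c s *v y + z)))"
      using t s by (simp add: ou_fun_eq matrix_vector_mult_diff_distrib flow_add matrix_vector_mul_assoc diff_diff_add)
    also have "\<dots> = (LINT y|gmeas (cov_fin c \<sigma> (s + t)). ?f (flow c (s + t) *v x - y))"
      using integral_convolution[OF spd_cov_fin[OF c \<sigma> t] spd_cov_fin[OF c \<sigma> s] spd_cov_fin[OF c \<sigma> add_pos_pos[OF s t]]
        measurable_flow_minus(2) D elim] by simp
    also have "\<dots> = ou_fun c \<sigma> (s + t) ?f x"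
      using t s by (simp add: ou_fun_eq)
    finally show ?case .
  qed
  then show ?thesis
    by (simp add: ou_semigroup_eq[of s] ou_semigroup_eq[of "s + t"] ou_semigroup_abs abs_ae_fun_eq_iff borel_measurable_ou_fun)
qed auto

section \<open>The generator and its eigenvectors\<close>

lemma generator_value_unique:
  assumes "ou_has_generator_value c \<sigma> F G" "ou_has_generator_value c \<sigma> F H"
  shows "G = H"
proof -
  let ?D = "\<lambda>t. (1 / t) *\<^sub>R (ou_semigroup c \<sigma> t F - F)"
  have F: "F \<in> L2 (ou_measure c \<sigma>)" and G: "G \<in> L2 (ou_measure c \<sigma>)" and H: "H \<in> L2 (ou_measure c \<sigma>)"
    and lG: "((\<lambda>t. L2_norm (ou_measure c \<sigma>) (?D t - G)) \<longlongrightarrow> 0) (at_right 0)"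
    and lH: "((\<lambda>t. L2_norm (ou_measure c \<sigma>) (?D t - H)) \<longlongrightarrow> 0) (at_right 0)"
    using assms by (auto simp: ou_has_generator_value_def)
  have bound: "enn2real (sqnorm (G - H)) \<le> 2 * ((L2_norm (ou_measure c \<sigma>) (?D t - G))\<^sup>2 + (L2_norm (ou_measure c \<sigma>) (?D t - H))\<^sup>2)"
    if "t > 0" for t
  proof -
    have D: "?D t \<in> L2 (ou_measure c \<sigma>)"
      using F that by (intro subspace_scale[OF L2_subspace] subspace_diff[OF L2_subspace] ou_semigroup_L2) auto
    have fin: "sqnorm (?D t - G) < \<infinity>" "sqnorm (?D t - H) < \<infinity>"
      unfolding L2_iff[symmetric] by (intro subspace_diff[OF L2_subspace] D G H)+
    have "G - H = (?D t - H) + (- 1) *\<^sub>R (?D t - G)" by simp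
    then have "sqnorm (G - H) \<le> 2 * (sqnorm (?D t - H) + sqnorm (?D t - G))"
      using sqnorm_plus_le[of "?D t - H" "(- 1) *\<^sub>R (?D t - G)"] by (simp only: sqnorm_scaleR) simp
    also have "\<dots> = ennreal (2 * (enn2real (sqnorm (?D t - G)) + enn2real (sqnorm (?D t - H))))"
      using fin by (simp add: ennreal_mult ennreal_plus add.commute)
    finally show ?thesis
      by (simp add: L2_norm_eq enn2real_leI)
  qed
  have "((\<lambda>t. 2 * ((L2_norm (ou_measure c \<sigma>) (?D t - G))\<^sup>2 + (L2_norm (ou_measure c \<sigma>) (?D t - H))\<^sup>2)) \<longlongrightarrow> 2 * (0\<^sup>2 + 0\<^sup>2)) (at_right 0)"
    by (intro tendsto_intros lG lH)
  then have "enn2real (sqnorm (G - H)) \<le> 2 * (0\<^sup>2 + 0\<^sup>2)"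
    by (rule tendsto_lowerbound) (use bound in \<open>auto simp: eventually_at_right_field simp del: distrib_left_numeral intro!: exI[of _ 1]\<close>)
  then have "enn2real (sqnorm (G - H)) = 0"
    using enn2real_nonneg[of "sqnorm (G - H)"] by simp
  moreover have "sqnorm (G - H) < \<infinity>"
    unfolding L2_iff[symmetric] by (intro subspace_diff[OF L2_subspace] G H)
  ultimately have "sqnorm (G - H) = 0" by (auto simp: enn2real_eq_0_iff)
  then show ?thesis by (simp add: sqnorm_0_iff)
qed

lemma ou_semigroup_diff:
  assumes F: "F \<in> L2 (ou_measure c \<sigma>)" and G: "G \<in> L2 (ou_measure c \<sigma>)" and t: "t \<ge> 0"
  shows "ou_semigroup c \<sigma> t (F - G) = ou_semigroup c \<sigma> t F - ou_semigroup c \<sigma> t G"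
  using ou_semigroup_plus[OF subspace_diff[OF L2_subspace F G] G t] by (simp add: algebra_simps)

text \<open>\<open>T(mh) F - e\<^sup>\<gamma>\<^sup>m\<^sup>h F\<close> telescopes into \<open>m\<close> terms, each no larger than
  \<open>T(h) F - e\<^sup>\<gamma>\<^sup>h F = o(h)\<close>.\<close>

lemma ou_semigroup_telescope:
  assumes F: "F \<in> L2 (ou_measure c \<sigma>)" and h: "h \<ge> 0" and q: "0 \<le> q" "q \<le> 1"
  shows "sqnorm (ou_semigroup c \<sigma> (real m * h) F - q ^ m *\<^sub>R F)
     \<le> ennreal ((real m)\<^sup>2) * sqnorm (ou_semigroup c \<sigma> h F - q *\<^sub>R F)"
proof -
  let ?T = "ou_semigroup c \<sigma>"
  let ?d = "?T h F - q *\<^sub>R F"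
  have d: "?d \<in> L2 (ou_measure c \<sigma>)"
    by (intro subspace_diff[OF L2_subspace] subspace_scale[OF L2_subspace] ou_semigroup_L2 F h)
  have "?T (real m * h) F - q ^ m *\<^sub>R F = (\<Sum>k<m. q ^ (m - Suc k) *\<^sub>R ?T (real k * h) ?d)"
  proof (induction m)
    case (Suc m)
    have "?T (real (Suc m) * h) F - q ^ Suc m *\<^sub>R F
       = ?T (real m * h) ?d + q *\<^sub>R (?T (real m * h) F - q ^ m *\<^sub>R F)"
      using h by (simp add: ou_semigroup_diff ou_semigroup_L2 F subspace_scale[OF L2_subspace] ou_semigroup_scaleR
          ou_semigroup_add algebra_simps)
    also have "\<dots> = ?T (real m * h) ?d + (\<Sum>k<m. q ^ (Suc m - Suc k) *\<^sub>R ?T (real k * h) ?d)"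
      unfolding Suc.IH scaleR_sum_right
      by (intro arg_cong2[where f = "(+)"] refl sum.cong) (auto simp: Suc_diff_Suc simp flip: power_Suc)
    finally show ?case by simp
  qed simp
  then have "sqnorm (?T (real m * h) F - q ^ m *\<^sub>R F)
     \<le> of_nat (card {..<m}) * (\<Sum>k<m. sqnorm (q ^ (m - Suc k) *\<^sub>R ?T (real k * h) ?d))"
    using sqnorm_sum_le[of "{..<m}"] by simp
  also have "\<dots> \<le> of_nat (card {..<m}) * (\<Sum>k<m. sqnorm ?d)"
  proof (intro mult_left_mono sum_mono)
    fix k
    have "(q ^ (m - Suc k))\<^sup>2 \<le> 1" using q by (simp add: power_le_one)
    then have "sqnorm (q ^ (m - Suc k) *\<^sub>R ?T (real k * h) ?d) \<le> 1 * sqnorm ?d"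
      unfolding sqnorm_scaleR using h
      by (intro mult_mono ou_semigroup_contraction) (auto simp: ennreal_le_1)
    then show "sqnorm (q ^ (m - Suc k) *\<^sub>R ?T (real k * h) ?d) \<le> sqnorm ?d" by simp
  qed simp
  also have "\<dots> = ennreal ((real m)\<^sup>2) * sqnorm ?d"
    by (simp add: power2_eq_square ennreal_mult ennreal_of_nat_eq_real_of_nat mult.assoc)
  finally show ?thesis .
qed

text \<open>Splitting t into m + 1 steps of length h bounds the squared error by (m + 1)^2 h^2 e(h)
  = t^2 e(h), where e(h) collects the errors of the two difference quotients and tends to 0. With
  \<gamma> \<le> 0 the factors exp (gamma h) stay at most 1, as the telescoping requires.\<close>

lemma generator_eigen_imp_semigroup_eigen:
  assumes gen: "ou_has_generator_value c \<sigma> F (\<gamma> *\<^sub>R F)" and \<gamma>: "\<gamma> \<le> 0" and t: "t > 0"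
  shows "ou_semigroup c \<sigma> t F = exp (\<gamma> * t) *\<^sub>R F"
proof -
  let ?T = "ou_semigroup c \<sigma>" and ?N = "L2_norm (ou_measure c \<sigma>)"
  have F: "F \<in> L2 (ou_measure c \<sigma>)"
    and lim: "((\<lambda>h. ?N ((1 / h) *\<^sub>R (?T h F - F) - \<gamma> *\<^sub>R F)) \<longlongrightarrow> 0) (at_right 0)"
    using gen by (auto simp: ou_has_generator_value_def)
  define R where "R h = (1 / h) *\<^sub>R (?T h F - F) - \<gamma> *\<^sub>R F" for h
  define e where "e h = 2 * (enn2real (sqnorm (R h)) + ((exp (\<gamma> * h) - 1) / h - \<gamma>)\<^sup>2 * enn2real (sqnorm F))" for h
  have finF: "sqnorm F < \<infinity>" using F by (simp add: L2_iff)
  have small: "sqnorm (?T h F - exp (\<gamma> * h) *\<^sub>R F) \<le> ennreal (h\<^sup>2 * e h)" if h: "h > 0" for h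
  proof -
    let ?b = "(exp (\<gamma> * h) - 1) / h - \<gamma>"
    have "R h \<in> L2 (ou_measure c \<sigma>)"
      unfolding R_def using F h
      by (intro subspace_scale[OF L2_subspace] subspace_diff[OF L2_subspace] ou_semigroup_L2) auto
    then have finR: "sqnorm (R h) < \<infinity>" by (simp add: L2_iff)
    \<comment> \<open>Both T(h) F and exp (gamma h) F expand as F + h gamma F, so their difference
      consists of the two remainders only.\<close>
    have "?T h F - exp (\<gamma> * h) *\<^sub>R F = h *\<^sub>R (R h + (- ?b) *\<^sub>R F)"
    proof -
      have "h *\<^sub>R R h = ?T h F - F - (h * \<gamma>) *\<^sub>R F"
        using h by (simp add: R_def scaleR_diff_right)
      moreover have "h * (- ?b) = 1 + h * \<gamma> - exp (\<gamma> * h)"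
        using h by (simp add: field_simps)
      then have "h *\<^sub>R ((- ?b) *\<^sub>R F) = (1 + h * \<gamma> - exp (\<gamma> * h)) *\<^sub>R F"
        by (simp only: scaleR_scaleR)
      ultimately show ?thesis
        by (simp only: scaleR_add_right) (simp add: scaleR_add_left scaleR_diff_left)
    qed
    then have "sqnorm (?T h F - exp (\<gamma> * h) *\<^sub>R F) = ennreal (h\<^sup>2) * sqnorm (R h + (- ?b) *\<^sub>R F)"
      by (simp only: sqnorm_scaleR)
    also have "\<dots> \<le> ennreal (h\<^sup>2) * (2 * (sqnorm (R h) + sqnorm ((- ?b) *\<^sub>R F)))"
      by (intro mult_left_mono sqnorm_plus_le) simp
    also have "\<dots> = ennreal (h\<^sup>2 * e h)"
      using finF finR unfolding sqnorm_scaleR e_def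
      by (simp add: ennreal_mult ennreal_plus power2_commute[of \<gamma>])
    finally show ?thesis .
  qed
  have e0: "(e \<longlongrightarrow> 0) (at_right 0)"
  proof -
    have "((\<lambda>h. (exp (\<gamma> * h) - 1) / h - \<gamma>) \<longlongrightarrow> 0) (at_right 0)"
      by real_asymp
    moreover have "((\<lambda>h. (?N (R h))\<^sup>2) \<longlongrightarrow> 0\<^sup>2) (at_right 0)"
      unfolding R_def by (intro tendsto_power lim)
    then have "((\<lambda>h. enn2real (sqnorm (R h))) \<longlongrightarrow> 0) (at_right 0)"
      by (simp add: L2_norm_eq)
    ultimately have "(e \<longlongrightarrow> 2 * (0 + 0\<^sup>2 * enn2real (sqnorm F))) (at_right 0)"
      unfolding e_def by (intro tendsto_mult tendsto_add tendsto_power tendsto_const)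
    then show ?thesis by simp
  qed
  have bound: "sqnorm (?T t F - exp (\<gamma> * t) *\<^sub>R F) \<le> ennreal (t\<^sup>2 * e (t / real (Suc m)))" for m
  proof -
    let ?h = "t / real (Suc m)"
    have h: "?h > 0" using t by simp
    have mh: "real (Suc m) * ?h = t" by (simp del: of_nat_Suc)
    have q: "exp (\<gamma> * ?h) ^ Suc m = exp (\<gamma> * t)"
      using mh by (simp add: exp_of_nat_mult[symmetric] mult.left_commute del: of_nat_Suc power_Suc)
    have "sqnorm (?T t F - exp (\<gamma> * t) *\<^sub>R F) \<le> ennreal ((real (Suc m))\<^sup>2) * sqnorm (?T ?h F - exp (\<gamma> * ?h) *\<^sub>R F)"
    proof -
      have "\<gamma> * ?h \<le> 0" using \<gamma> h by (intro mult_nonpos_nonneg) auto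
      then show ?thesis
        using ou_semigroup_telescope[OF F, of ?h "exp (\<gamma> * ?h)" "Suc m"] h
        unfolding mh q by (simp del: of_nat_Suc)
    qed
    also have "\<dots> \<le> ennreal ((real (Suc m))\<^sup>2) * ennreal (?h\<^sup>2 * e ?h)"
      by (intro mult_left_mono small h) simp
    also have "\<dots> = ennreal ((real (Suc m) * ?h)\<^sup>2 * e ?h)"
      by (subst ennreal_mult'[symmetric]) (simp_all only: power_mult_distrib mult.assoc zero_le_power2)
    finally show ?thesis unfolding mh .
  qed
  have "(\<lambda>m. t\<^sup>2 * e (t / real (Suc m))) \<longlonglongrightarrow> t\<^sup>2 * 0"
  proof (intro tendsto_mult tendsto_const filterlim_compose[OF e0])
    show "filterlim (\<lambda>m. t / real (Suc m)) (at_right 0) sequentially"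
      using t by real_asymp
  qed
  then have "(\<lambda>m. ennreal (t\<^sup>2 * e (t / real (Suc m)))) \<longlonglongrightarrow> ennreal 0"
    by (intro tendsto_ennrealI) simp
  then have "sqnorm (?T t F - exp (\<gamma> * t) *\<^sub>R F) \<le> ennreal 0"
    by (rule tendsto_lowerbound) (use bound in auto)
  then show ?thesis by (simp add: sqnorm_0_iff)
qed

lemma semigroup_eigen_imp_generator_eigen:
  assumes F: "F \<in> L2 (ou_measure c \<sigma>)" and T: "\<And>t. t > 0 \<Longrightarrow> ou_semigroup c \<sigma> t F = exp (\<gamma> * t) *\<^sub>R F"
  shows "ou_has_generator_value c \<sigma> F (\<gamma> *\<^sub>R F)"
proof -
  let ?N = "L2_norm (ou_measure c \<sigma>)"
  have eq: "?N ((1 / t) *\<^sub>R (ou_semigroup c \<sigma> t F - F) - \<gamma> *\<^sub>R F) = \<bar>(exp (\<gamma> * t) - 1) / t - \<gamma>\<bar> * ?N F" if "t > 0" for t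
  proof -
    have "(1 / t) *\<^sub>R (ou_semigroup c \<sigma> t F - F) - \<gamma> *\<^sub>R F = ((exp (\<gamma> * t) - 1) / t - \<gamma>) *\<^sub>R F"
      using that by (simp add: T algebra_simps diff_divide_distrib)
    then show ?thesis by (simp only: L2_norm_eq sqnorm_scaleR) (simp add: enn2real_mult real_sqrt_mult)
  qed
  have "((\<lambda>t. \<bar>(exp (\<gamma> * t) - 1) / t - \<gamma>\<bar> * ?N F) \<longlongrightarrow> 0) (at_right 0)"
    by (intro tendsto_mult_left_zero tendsto_rabs_zero) real_asymp
  then have "((\<lambda>t. ?N ((1 / t) *\<^sub>R (ou_semigroup c \<sigma> t F - F) - \<gamma> *\<^sub>R F)) \<longlongrightarrow> 0) (at_right 0)"
    by (rule Lim_transform_eventually) (auto simp: eq eventually_at_right_field intro!: exI[of _ 1])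
  then show ?thesis
    using F by (simp add: ou_has_generator_value_def subspace_scale[OF L2_subspace])
qed

text \<open>Trades the generator for the semigroup; the limit defining the generator does not occur
  after this point.\<close>

lemma ou_eigenspace_eq:
  assumes "\<gamma> \<le> 0"
  shows "{F \<in> ou_domain c \<sigma>. \<gamma> *\<^sub>R F - ou_operator c \<sigma> F = 0}
    = {F \<in> L2 (ou_measure c \<sigma>). \<forall>t>0. ou_semigroup c \<sigma> t F = exp (\<gamma> * t) *\<^sub>R F}"
proof -
  have op: "ou_operator c \<sigma> F = G" if "ou_has_generator_value c \<sigma> F G" for F G
    unfolding ou_operator_def using that generator_value_unique by blast
  have "F \<in> ou_domain c \<sigma> \<and> \<gamma> *\<^sub>R F - ou_operator c \<sigma> F = 0 \<longleftrightarrow> ou_has_generator_value c \<sigma> F (\<gamma> *\<^sub>R F)" for F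
    using op by (auto simp: ou_domain_def)
  moreover have "ou_has_generator_value c \<sigma> F (\<gamma> *\<^sub>R F) \<longleftrightarrow>
      F \<in> L2 (ou_measure c \<sigma>) \<and> (\<forall>t>0. ou_semigroup c \<sigma> t F = exp (\<gamma> * t) *\<^sub>R F)" for F
    using generator_eigen_imp_semigroup_eigen[OF _ assms] semigroup_eigen_imp_generator_eigen
    by (auto simp: ou_has_generator_value_def)
  ultimately show ?thesis by blast
qed

end

section \<open>Polynomials on \<open>\<real>\<^sup>3\<close>\<close>

text \<open>The functions b j are removed one at a time. If the coefficients of b j converge along a
  subsequence, their limit is the coefficient in f. Otherwise they tend to infinity in absolute
  value, and dividing by them exhibits b j on S as a limit of combinations of the others, so that it
  can be eliminated.\<close>

lemma finite_span_pointwise_limit: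
  fixes b :: "'i \<Rightarrow> 'a \<Rightarrow> real"
  assumes "finite I" and "\<And>x. x \<in> S \<Longrightarrow> (\<lambda>m. \<Sum>i\<in>I. a m i * b i x) \<longlonglongrightarrow> f x"
  shows "\<exists>\<alpha>. \<forall>x\<in>S. f x = (\<Sum>i\<in>I. \<alpha> i * b i x)"
  using assms
proof (induction I arbitrary: a f rule: finite_induct)
  case empty
  then show ?case using LIMSEQ_unique[OF _ tendsto_const] by fastforce
next
  case (insert j I)
  have lim: "(\<lambda>m. a m j * b j x + (\<Sum>i\<in>I. a m i * b i x)) \<longlonglongrightarrow> f x" if "x \<in> S" for x
    using insert.prems[OF that] insert.hyps by simp
  show ?case
  proof (cases "\<exists>r L. strict_mono (r :: nat \<Rightarrow> nat) \<and> (\<lambda>m. a (r m) j) \<longlonglongrightarrow> L")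
    case True
    then obtain r L where r: "strict_mono r" and L: "(\<lambda>m. a (r m) j) \<longlonglongrightarrow> L" by blast
    have "(\<lambda>m. \<Sum>i\<in>I. a (r m) i * b i x) \<longlonglongrightarrow> f x - L * b j x" if "x \<in> S" for x
    proof -
      have "(\<lambda>m. (a (r m) j * b j x + (\<Sum>i\<in>I. a (r m) i * b i x)) - a (r m) j * b j x) \<longlonglongrightarrow> f x - L * b j x"
        using LIMSEQ_subseq_LIMSEQ[OF lim[OF that] r]
        by (intro tendsto_diff tendsto_mult L tendsto_const) (simp add: o_def)
      then show ?thesis by simp
    qed
    from insert.IH[OF this] obtain \<alpha> where "\<forall>x\<in>S. f x - L * b j x = (\<Sum>i\<in>I. \<alpha> i * b i x)" by blast
    then have "\<forall>x\<in>S. f x = (\<Sum>i\<in>insert j I. (\<alpha>(j := L)) i * b i x)"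
      using insert.hyps by (auto simp: algebra_simps intro!: sum.cong)
    then show ?thesis by blast
  next
    case False
    have "filterlim (\<lambda>m. a m j) at_infinity sequentially"
    proof (rule ccontr)
      assume "\<not> ?thesis"
      then obtain K where "\<not> eventually (\<lambda>m. K \<le> norm (a m j)) sequentially"
        using filterlim_at_infinity[of 0 "\<lambda>m. a m j" sequentially] by auto
      then have "infinite {m. norm (a m j) < K}"
        unfolding cofinite_eq_sequentially[symmetric] eventually_cofinite by (simp add: not_le)
      then obtain r :: "nat \<Rightarrow> nat" where r: "strict_mono r" "\<And>m. r m \<in> {m. norm (a m j) < K}"
        using infinite_enumerate by blast
      then have "bounded (range (\<lambda>m. a (r m) j))"
        by (auto simp: bounded_iff intro!: exI[of _ K] less_imp_le)
      from bounded_imp_convergent_subsequence[OF this] obtain L s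
        where "strict_mono s" "((\<lambda>m. a (r m) j) \<circ> s) \<longlonglongrightarrow> L" by blast
      then show False
        using False strict_mono_o[OF r(1)] by (auto simp: o_def)
    qed
    then have inv0: "(\<lambda>m. inverse (a m j)) \<longlonglongrightarrow> 0"
      by (rule filterlim_compose[OF tendsto_inverse_0])
    have ev: "eventually (\<lambda>m. a m j \<noteq> 0) sequentially"
      using \<open>filterlim (\<lambda>m. a m j) at_infinity sequentially\<close>
      by (rule filterlim_at_infinity_imp_eventually_ne)
    have "(\<lambda>m. \<Sum>i\<in>I. (- inverse (a m j) * a m i) * b i x) \<longlonglongrightarrow> b j x" if "x \<in> S" for x
    proof (rule Lim_transform_eventually)
      show "(\<lambda>m. b j x - inverse (a m j) * (a m j * b j x + (\<Sum>i\<in>I. a m i * b i x))) \<longlonglongrightarrow> b j x"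
        using tendsto_diff[OF tendsto_const tendsto_mult[OF inv0 lim[OF that]], of "b j x"] by simp
      show "eventually (\<lambda>m. b j x - inverse (a m j) * (a m j * b j x + (\<Sum>i\<in>I. a m i * b i x))
          = (\<Sum>i\<in>I. (- inverse (a m j) * a m i) * b i x)) sequentially"
        using ev by eventually_elim (simp add: field_simps sum_distrib_left sum_negf sum_divide_distrib)
    qed
    from insert.IH[OF this] obtain \<beta> where \<beta>: "\<And>x. x \<in> S \<Longrightarrow> b j x = (\<Sum>i\<in>I. \<beta> i * b i x)" by blast
    have "(\<lambda>m. \<Sum>i\<in>I. (a m j * \<beta> i + a m i) * b i x) \<longlonglongrightarrow> f x" if "x \<in> S" for x
      using lim[OF that] by (simp add: \<beta>[OF that] sum_distrib_left distrib_right sum.distrib mult.assoc)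
    from insert.IH[OF this] obtain \<alpha> where "\<forall>x\<in>S. f x = (\<Sum>i\<in>I. \<alpha> i * b i x)" by blast
    then have "\<forall>x\<in>S. f x = (\<Sum>i\<in>insert j I. (\<alpha>(j := 0)) i * b i x)"
      using insert.hyps by (auto intro!: sum.cong)
    then show ?thesis by blast
  qed
qed

section \<open>Polynomials whose coefficients depend on a parameter\<close>

definition poly_growth :: "(real^3 \<Rightarrow> real) set" where
  "poly_growth = {u \<in> borel_measurable borel. \<exists>K k. \<forall>z. \<bar>u z\<bar> \<le> K * (1 + norm z) ^ k}"

lemma poly_growth_const: "(\<lambda>_. a) \<in> poly_growth"
proof -
  have "\<forall>z. \<bar>a\<bar> \<le> \<bar>a\<bar> * (1 + norm (z :: real^3)) ^ 0" by simp
  then show ?thesis unfolding poly_growth_def by (intro CollectI conjI) (simp, blast)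
qed

lemma poly_growth_component: "(\<lambda>z. z $ i) \<in> poly_growth"
proof -
  have "\<bar>z $ i\<bar> \<le> 1 * (1 + norm z) ^ 1" for z :: "real^3"
    using component_le_norm_cart[of z i] by simp
  then show ?thesis
    unfolding poly_growth_def
    by (intro CollectI conjI exI allI borel_measurable_continuous_onI continuous_intros)
qed

lemma poly_growth_mult:
  assumes "u \<in> poly_growth" "v \<in> poly_growth"
  shows "(\<lambda>z. u z * v z) \<in> poly_growth"
proof -
  obtain K k L l where b: "\<And>z. \<bar>u z\<bar> \<le> K * (1 + norm z) ^ k" "\<And>z. \<bar>v z\<bar> \<le> L * (1 + norm z) ^ l"
    using assms by (auto simp: poly_growth_def)
  have "\<bar>u z * v z\<bar> \<le> (K * L) * (1 + norm z) ^ (k + l)" for z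
    using mult_mono[OF b(1) b(2), of z z] order_trans[OF abs_ge_zero b(1)[of z]]
    by (simp add: abs_mult power_add mult_ac)
  then show ?thesis using assms by (auto simp: poly_growth_def intro!: exI)
qed

lemma poly_growth_add:
  assumes "u \<in> poly_growth" "v \<in> poly_growth"
  shows "(\<lambda>z. u z + v z) \<in> poly_growth"
proof -
  obtain K k L l where b: "\<And>z. \<bar>u z\<bar> \<le> K * (1 + norm z) ^ k" "\<And>z. \<bar>v z\<bar> \<le> L * (1 + norm z) ^ l"
    using assms by (auto simp: poly_growth_def)
  have "\<bar>u z + v z\<bar> \<le> (\<bar>K\<bar> + \<bar>L\<bar>) * (1 + norm z) ^ (k + l)" for z
  proof -
    have "\<bar>u z\<bar> \<le> \<bar>K\<bar> * (1 + norm z) ^ (k + l)"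
      by (rule order_trans[OF b(1)]) (intro mult_mono power_increasing, auto)
    moreover have "\<bar>v z\<bar> \<le> \<bar>L\<bar> * (1 + norm z) ^ (k + l)"
      by (rule order_trans[OF b(2)]) (intro mult_mono power_increasing, auto)
    ultimately show ?thesis by (simp add: distrib_right)
  qed
  then show ?thesis using assms by (auto simp: poly_growth_def intro!: exI)
qed

fun mon :: "nat \<times> nat \<times> nat \<Rightarrow> real^3 \<Rightarrow> real" where
  "mon (i, j, k) x = x$1 ^ i * x$2 ^ j * x$3 ^ k"

text \<open>Polynomials in the second argument, of degree less than \<open>N\<close>, whose coefficients are
  functions of polynomial growth in the first argument.\<close>

inductive ppoly :: "nat \<Rightarrow> (real^3 \<Rightarrow> real^3 \<Rightarrow> real) \<Rightarrow> bool" for N where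
  ppoly_0: "ppoly N (\<lambda>z x. 0)"
| ppoly_step: "u \<in> poly_growth \<Longrightarrow> i + j + k < N \<Longrightarrow> ppoly N H \<Longrightarrow> ppoly N (\<lambda>z x. u z * mon (i, j, k) x + H z x)"

lemma ppoly_monomial: "u \<in> poly_growth \<Longrightarrow> i + j + k < N \<Longrightarrow> ppoly N (\<lambda>z x. u z * mon (i, j, k) x)"
  using ppoly_step[OF _ _ ppoly_0] by simp

lemma ppoly_mono: "ppoly N H \<Longrightarrow> N \<le> M \<Longrightarrow> ppoly M H"
  by (induction rule: ppoly.induct) (auto intro: ppoly.intros simp del: mon.simps)

lemma ppoly_add: "ppoly N G \<Longrightarrow> ppoly N H \<Longrightarrow> ppoly N (\<lambda>z x. G z x + H z x)"
  by (induction rule: ppoly.induct) (auto intro: ppoly.intros simp: add.assoc simp del: mon.simps)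

lemma ppoly_cmult: "ppoly N H \<Longrightarrow> u \<in> poly_growth \<Longrightarrow> ppoly N (\<lambda>z x. u z * H z x)"
proof (induction rule: ppoly.induct)
  case (ppoly_step v i j k H)
  then show ?case
    using ppoly.ppoly_step[OF poly_growth_mult[OF ppoly_step.prems ppoly_step.hyps(1)] ppoly_step.hyps(2) ppoly_step.IH]
    by (simp add: distrib_left mult.assoc del: mon.simps)
qed (simp add: ppoly_0)

lemma ppoly_mon_mult:
  assumes "ppoly N H" "i + j + k \<le> d"
  shows "ppoly (N + d) (\<lambda>z x. mon (i, j, k) x * H z x)"
  using assms
proof (induction rule: ppoly.induct)
  case (ppoly_step v i' j' k' H)
  have "ppoly (N + d) (\<lambda>z x. v z * mon (i + i', j + j', k + k') x + mon (i, j, k) x * H z x)"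
    using ppoly_step by (intro ppoly.ppoly_step) auto
  then show ?case by (simp add: power_add algebra_simps)
qed (simp add: ppoly_0)

text \<open>Degree bounds are strict, so one factor enters with \<open>Suc N\<close> to make the
  bounds add up.\<close>

lemma ppoly_mult:
  assumes "ppoly M G" "ppoly (Suc N) H"
  shows "ppoly (M + N) (\<lambda>z x. G z x * H z x)"
  using assms(2)
proof (induction rule: ppoly.induct)
  case (ppoly_step v i j k H)
  have "ppoly (M + N) (\<lambda>z x. v z * (mon (i, j, k) x * G z x) + G z x * H z x)"
    using ppoly_step assms(1) by (intro ppoly_add ppoly_cmult ppoly_mon_mult) auto
  then show ?case by (simp add: algebra_simps)
qed (simp add: ppoly_0)

lemma ppoly_coeff: "u \<in> poly_growth \<Longrightarrow> ppoly (Suc N) (\<lambda>z x. u z)"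
  using ppoly_monomial[of u 0 0 0 "Suc N"] by simp

lemma ppoly_var: "ppoly (Suc (Suc N)) (\<lambda>z x. x $ i)"
  using exhaust_3[of i] ppoly_monomial[OF poly_growth_const[of 1], of 1 0 0 "Suc (Suc N)"]
    ppoly_monomial[OF poly_growth_const[of 1], of 0 1 0 "Suc (Suc N)"]
    ppoly_monomial[OF poly_growth_const[of 1], of 0 0 1 "Suc (Suc N)"] by auto

lemma ppoly_power: "ppoly (Suc N) H \<Longrightarrow> ppoly (Suc (k * N)) (\<lambda>z x. H z x ^ k)"
proof (induction k)
  case 0
  show ?case using ppoly_coeff[OF poly_growth_const[of 1], of 0] by simp
next
  case (Suc k)
  then have "ppoly (Suc (k * N) + N) (\<lambda>z x. H z x ^ k * H z x)"
    by (intro ppoly_mult) auto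
  then show ?case by (simp add: mult.commute add.commute)
qed

lemma ppoly_sum: "(\<And>i. i \<in> I \<Longrightarrow> ppoly N (H i)) \<Longrightarrow> ppoly N (\<lambda>z x. \<Sum>i\<in>I. H i z x)"
  by (induction I rule: infinite_finite_induct) (auto intro: ppoly_0 ppoly_add)

lemma ppoly_cmult_const: "ppoly N H \<Longrightarrow> ppoly N (\<lambda>z x. a * H z x)"
  by (rule ppoly_cmult[OF _ poly_growth_const])

lemma ppoly_diff: "ppoly N G \<Longrightarrow> ppoly N H \<Longrightarrow> ppoly N (\<lambda>z x. G z x - H z x)"
  using ppoly_add[OF _ ppoly_cmult_const[of N H "-1"], of G] by simp

lemma ppoly_linear: "ppoly (Suc (Suc N)) (\<lambda>z x. ((A :: real^3^3) *v x) $ i)"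
  unfolding matrix_vector_mult_3 by (intro ppoly_add ppoly_cmult_const ppoly_var)

lemma ppoly_mon_compose:
  assumes "\<And>i. ppoly (Suc (Suc 0)) (\<lambda>z x. L z x $ i)"
  shows "ppoly (Suc (i + j + k)) (\<lambda>z x. mon (i, j, k) (L z x))"
proof -
  have "ppoly (Suc (i * Suc 0) + j * Suc 0 + k * Suc 0) (\<lambda>z x. L z x $ 1 ^ i * L z x $ 2 ^ j * L z x $ 3 ^ k)"
    by (intro ppoly_mult ppoly_power assms)
  then show ?thesis by simp
qed

lemma ppoly_compose:
  assumes "ppoly N (\<lambda>_. g)" "\<And>i. ppoly (Suc (Suc 0)) (\<lambda>z x. L z x $ i)"
  shows "ppoly N (\<lambda>z x. g (L z x))"
proof -
  \<comment> \<open>The rules of \<open>ppoly\<close> do not preserve the shape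
    \<open>\<lambda>_. g\<close>; the induction therefore runs over all H, read at the parameter
    value 0. The same device recurs below.\<close>
  have "ppoly N (\<lambda>z x. H 0 (L z x))" if "ppoly N H" for H
    using that
  proof (induction rule: ppoly.induct)
    case (ppoly_step u i j k H)
    have "ppoly N (\<lambda>z x. u 0 * mon (i, j, k) (L z x) + H 0 (L z x))"
      using ppoly_step by (intro ppoly_add ppoly_cmult_const ppoly_mono[OF ppoly_mon_compose[OF assms(2)]]) auto
    then show ?case .
  qed (rule ppoly_0)
  from this[OF assms(1)] show ?thesis by simp
qed

text \<open>Translation leaves the leading part alone, so the difference loses a degree in h while y
  moves into the coefficients. This degree drop drives the inductions for
  \<open>gauss_avg\<close>.\<close>

lemma ppoly_translate_diff:
  assumes "ppoly (Suc N) (\<lambda>_. g)"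
  shows "ppoly N (\<lambda>y h. g (h + y) - g h)"
proof -
  have pw: "ppoly i (\<lambda>y h. (h + y) $ l ^ i - h $ l ^ i)" and pw': "ppoly (Suc i) (\<lambda>y h. (h + y) $ l ^ i)"
    and pw'': "ppoly (Suc i) (\<lambda>y h. h $ l ^ i)" for i l
  proof -
    have v: "ppoly (Suc (Suc 0)) (\<lambda>y h. (h + y) $ l)"
      by (simp add: ppoly_add ppoly_var ppoly_coeff poly_growth_component)
    have v': "ppoly (Suc (Suc 0)) (\<lambda>y h. h $ l)" by (rule ppoly_var)
    show "ppoly (Suc i) (\<lambda>y h. (h + y) $ l ^ i)" using ppoly_power[OF v, of i] by simp
    have p: "ppoly (Suc i) (\<lambda>y h. h $ l ^ i)" for i using ppoly_power[OF v', of i] by simp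
    show "ppoly (Suc i) (\<lambda>y h. h $ l ^ i)" by (rule p)
    show "ppoly i (\<lambda>y h. (h + y) $ l ^ i - h $ l ^ i)"
    proof (induction i)
      case (Suc i)
      have "ppoly (i + Suc 0) (\<lambda>y h. ((h + y) $ l ^ i - h $ l ^ i) * (h + y) $ l)"
        by (rule ppoly_mult[OF Suc v])
      then have "ppoly (Suc i) (\<lambda>y h. ((h + y) $ l ^ i - h $ l ^ i) * (h + y) $ l + y $ l * h $ l ^ i)"
        by (intro ppoly_add ppoly_cmult p poly_growth_component) simp
      then show ?case by (simp add: algebra_simps)
    qed (simp add: ppoly_0)
  qed
  \<comment> \<open>One coordinate is translated at a time, and each of the three resulting
    differences loses a degree.\<close>
  have mono: "ppoly (i + j + k) (\<lambda>y h. mon (i, j, k) (h + y) - mon (i, j, k) h)" for i j k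
  proof -
    have "ppoly (i + j + k) (\<lambda>y h. ((h + y) $ 1 ^ i - h $ 1 ^ i) * (h + y) $ 2 ^ j * (h + y) $ 3 ^ k)"
      by (intro ppoly_mult pw pw')
    moreover have "ppoly (j + i + k) (\<lambda>y h. ((h + y) $ 2 ^ j - h $ 2 ^ j) * h $ 1 ^ i * (h + y) $ 3 ^ k)"
      by (intro ppoly_mult pw pw' pw'')
    moreover have "ppoly (k + i + j) (\<lambda>y h. ((h + y) $ 3 ^ k - h $ 3 ^ k) * h $ 1 ^ i * h $ 2 ^ j)"
      by (intro ppoly_mult pw pw' pw'')
    ultimately have "ppoly (i + j + k) (\<lambda>y h. ((h + y) $ 1 ^ i - h $ 1 ^ i) * (h + y) $ 2 ^ j * (h + y) $ 3 ^ k
        + ((h + y) $ 2 ^ j - h $ 2 ^ j) * h $ 1 ^ i * (h + y) $ 3 ^ k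
        + ((h + y) $ 3 ^ k - h $ 3 ^ k) * h $ 1 ^ i * h $ 2 ^ j)"
      by (intro ppoly_add) (simp_all add: add_ac)
    then show ?thesis by (simp add: algebra_simps)
  qed
  have "ppoly N (\<lambda>y h. H 0 (h + y) - H 0 h)" if "ppoly (Suc N) H" for H
    using that
  proof (induction rule: ppoly.induct)
    case (ppoly_step u i j k H)
    have "ppoly N (\<lambda>y h. u 0 * (mon (i, j, k) (h + y) - mon (i, j, k) h) + (H 0 (h + y) - H 0 h))"
      using ppoly_step by (intro ppoly_add ppoly_cmult_const ppoly_mono[OF mono]) auto
    then show ?case by (simp add: algebra_simps del: mon.simps)
  qed (simp add: ppoly_0)
  from this[OF assms] show ?thesis by simp
qed

lemma poly_growth_mon: "mon t \<in> poly_growth"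
proof -
  have pw: "(\<lambda>z. z $ l ^ i) \<in> poly_growth" for i l
    by (induction i) (auto intro: poly_growth_const poly_growth_mult poly_growth_component)
  obtain i j k where "t = (i, j, k)" by (cases t)
  then have "mon t = (\<lambda>z. z $ 1 ^ i * z $ 2 ^ j * z $ 3 ^ k)" by auto
  then show ?thesis by (simp add: poly_growth_mult pw)
qed

lemma polynomial_poly_growth:
  assumes "ppoly N (\<lambda>_. g)" shows "g \<in> poly_growth"
proof -
  have "H 0 \<in> poly_growth" if "ppoly N H" for H
    using that
  proof (induction rule: ppoly.induct)
    case (ppoly_step u i j k H)
    have "(\<lambda>x. u 0 * mon (i, j, k) x + H 0 x) \<in> poly_growth"
      by (intro poly_growth_add poly_growth_mult poly_growth_const poly_growth_mon ppoly_step)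
    then show ?case .
  qed (rule poly_growth_const)
  from this[OF assms] show ?thesis by simp
qed

lemma polynomial_continuous:
  assumes "ppoly N (\<lambda>_. g)" shows "continuous_on S g"
proof -
  have "continuous_on S (H 0)" if "ppoly N H" for H
    using that
    by (induction rule: ppoly.induct) (auto intro!: continuous_intros)
  from this[OF assms] show ?thesis by simp
qed

text \<open>The weight w is kept free: it is 1 for Gaussian averages, and the eigenfunction times a
  density for the truncated kernel.\<close>

lemma ppoly_integral:
  assumes "ppoly N H" and w: "\<And>u. u \<in> poly_growth \<Longrightarrow> integrable M (\<lambda>z. w z * u z)"
  shows "ppoly N (\<lambda>_ x. LINT z|M. w z * H z x)"
proof -
  have "(\<forall>x. integrable M (\<lambda>z. w z * H z x)) \<and> ppoly N (\<lambda>_ x. LINT z|M. w z * H z x)"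
    using assms(1)
  proof (induction rule: ppoly.induct)
    case (ppoly_step u i j k H)
    have i: "integrable M (\<lambda>z. w z * u z * mon (i, j, k) x)" for x
      using w[OF ppoly_step.hyps(1)] by (rule integrable_mult_left)
    have "ppoly N (\<lambda>_ x. (LINT z|M. w z * u z) * mon (i, j, k) x + (LINT z|M. w z * H z x))"
      by (intro ppoly.ppoly_step poly_growth_const ppoly_step.hyps) (use ppoly_step.IH in blast)
    moreover have "(LINT z|M. w z * u z) * mon (i, j, k) x + (LINT z|M. w z * H z x)
        = (LINT z|M. w z * (u z * mon (i, j, k) x + H z x))" for x
      using i[of x] ppoly_step.IH w[OF ppoly_step.hyps(1)]
      by (simp add: distrib_left mult.assoc[symmetric] del: mon.simps)
    moreover have "integrable M (\<lambda>z. w z * (u z * mon (i, j, k) x + H z x))" for x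
      using i[of x] ppoly_step.IH by (simp add: distrib_left mult.assoc[symmetric] del: mon.simps)
    ultimately show ?case by simp
  qed (simp add: ppoly_0)
  then show ?thesis by blast
qed

definition mon_index :: "nat \<Rightarrow> (nat \<times> nat \<times> nat) set" where
  "mon_index N = {(i, j, k). i + j + k < N}"

lemma finite_mon_index [simp]: "finite (mon_index N)"
  by (rule finite_subset[of _ "{..N} \<times> {..N} \<times> {..N}"]) (auto simp: mon_index_def)

lemma polynomial_normal_form:
  assumes "ppoly N (\<lambda>_. g)"
  obtains a where "g = (\<lambda>x. \<Sum>t\<in>mon_index N. a t * mon t x)"
proof -
  have "\<exists>a. H 0 = (\<lambda>x. \<Sum>t\<in>mon_index N. a t * mon t x)" if "ppoly N H" for H
    using that
  proof (induction rule: ppoly.induct)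
    case (ppoly_step u i j k H)
    then obtain a where a: "H 0 = (\<lambda>x. \<Sum>t\<in>mon_index N. a t * mon t x)" by blast
    let ?t = "(i, j, k)"
    have t: "?t \<in> mon_index N" using ppoly_step by (simp add: mon_index_def)
    have "u 0 * mon ?t x + H 0 x = (\<Sum>t\<in>mon_index N. (a(?t := a ?t + u 0)) t * mon t x)" for x
      by (simp add: a sum.remove[OF finite_mon_index t] distrib_right del: mon.simps)
    then show ?case by blast
  qed (auto intro: exI[of _ "\<lambda>_. 0"])
  from this[OF assms] show ?thesis using that by auto
qed

lemma polynomial_normal_form_ppoly: "ppoly N (\<lambda>_ x. \<Sum>t\<in>mon_index N. a t * mon t x)"
proof (rule ppoly_sum)
  fix t assume "t \<in> mon_index N"
  then show "ppoly N (\<lambda>_ x. a t * mon t x)"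
    using ppoly_monomial[OF poly_growth_const] by (cases t) (auto simp: mon_index_def simp del: mon.simps)
qed

text \<open>Polynomials are continuous, so they agree on a closed set, and a closed set of full
  Lebesgue measure is the whole space.\<close>

lemma polynomial_AE_eq:
  assumes "ppoly M (\<lambda>_. f)" "ppoly N (\<lambda>_. g)" "AE x in lborel. f x = g x"
  shows "f = g"
proof
  fix x
  have "closed {x. f x = g x}"
    using assms(1,2)[THEN polynomial_continuous] by (intro closed_Collect_eq) auto
  moreover have "AE x in lebesgue. x \<in> {x. f x = g x}"
    using assms(3) by (auto intro: AE_completion)
  ultimately have "x \<in> {x. f x = g x}" by (rule mem_closed_if_AE_lebesgue)
  then show "f x = g x" by simp
qed

section \<open>Polynomial eigenfunctions of the flow\<close>

lemma poly_tendsto_0_imp_0: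
  fixes p :: "real poly"
  assumes "((\<lambda>t. poly p t) \<longlongrightarrow> 0) at_top"
  shows "p = 0"
proof (rule ccontr)
  have pos: False if lim: "((\<lambda>t. poly q t) \<longlongrightarrow> 0) at_top" and lc: "lead_coeff q > 0" for q :: "real poly"
  proof -
    obtain n where "\<forall>x\<ge>n. poly q x \<ge> lead_coeff q" using poly_pinfty_gt_lc[OF lc] by blast
    then have "eventually (\<lambda>x. poly q x \<ge> lead_coeff q) at_top"
      unfolding eventually_at_top_linorder by blast
    then have "lead_coeff q \<le> 0"
      by (intro tendsto_lowerbound[OF lim]) auto
    with lc show False by simp
  qed
  assume "p \<noteq> 0"
  then consider "lead_coeff p > 0" | "lead_coeff (- p) > 0" by (metis leading_coeff_0_iff lead_coeff_minus neg_0_less_iff_less linorder_neqE)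
  then show False
  proof cases
    case 1 then show False using pos assms by blast
  next
    case 2 then show False using pos[of "- p"] tendsto_minus[OF assms] by simp
  qed
qed

lemma exp_poly_tendsto_0:
  fixes c :: real
  assumes "c > 0"
  shows "((\<lambda>t. exp (- c * t) ^ Suc d * poly p t) \<longlongrightarrow> 0) at_top"
proof -
  have "((\<lambda>t. exp (- c * t) ^ Suc d * t ^ i) \<longlongrightarrow> 0) at_top" for i
  proof -
    have "exp (- c * t) ^ Suc d = exp (- (c * real (Suc d)) * t)" for t
      by (simp add: exp_of_nat_mult[symmetric] mult_ac del: of_nat_Suc power_Suc)
    moreover have "((\<lambda>t. exp (- k * t) * t ^ i) \<longlongrightarrow> 0) at_top" if "k > 0" for k :: real
    proof -
      have "((\<lambda>t. (1 / k ^ i) * ((k * t) ^ i / exp (k * t))) \<longlongrightarrow> (1 / k ^ i) * 0) at_top"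
        by (intro tendsto_mult tendsto_const filterlim_compose[OF tendsto_power_div_exp_0]
            filterlim_tendsto_pos_mult_at_top[OF tendsto_const that filterlim_ident])
      then show ?thesis using that by (simp add: power_mult_distrib exp_minus field_simps)
    qed
    then have "((\<lambda>t. exp (- (c * real (Suc d)) * t) * t ^ i) \<longlongrightarrow> 0) at_top"
      using assms by simp
    ultimately show ?thesis by simp
  qed
  then have "((\<lambda>t. \<Sum>i\<le>degree p. coeff p i * (exp (- c * t) ^ Suc d * t ^ i)) \<longlongrightarrow> (\<Sum>i\<le>degree p. coeff p i * 0)) at_top"
    by (intro tendsto_sum tendsto_mult tendsto_const)
  then show ?thesis by (simp add: poly_altdef sum_distrib_left mult.left_commute)
qed

text \<open>As t tends to infinity every term with d > 0 vanishes, so the polynomial P 0 tends to 0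
  and is 0; after division by exp (- c t) the same applies to the next one.\<close>

lemma exp_poly_independent:
  fixes P :: "nat \<Rightarrow> real poly" and c :: real
  assumes "c > 0" and "\<And>t. (\<Sum>d<N. exp (- c * t) ^ d * poly (P d) t) = 0" and "d < N"
  shows "P d = 0"
  using assms(2,3)
proof (induction N arbitrary: P d)
  case (Suc N)
  have split: "poly (P 0) t + exp (- c * t) * (\<Sum>d<N. exp (- c * t) ^ d * poly (P (Suc d)) t) = 0" for t
    using Suc.prems(1)[of t] by (simp add: sum.lessThan_Suc_shift sum_distrib_left mult.assoc del: sum.lessThan_Suc)
  have "((\<lambda>t. - (\<Sum>d<N. exp (- c * t) ^ Suc d * poly (P (Suc d)) t)) \<longlongrightarrow> - (\<Sum>d<N. 0)) at_top"
    by (intro tendsto_minus tendsto_sum exp_poly_tendsto_0 assms(1))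
  moreover have "- (\<Sum>d<N. exp (- c * t) ^ Suc d * poly (P (Suc d)) t) = poly (P 0) t" for t
    using split[of t] by (simp add: sum_distrib_left mult.assoc)
  ultimately have P0: "P 0 = 0" by (intro poly_tendsto_0_imp_0) simp
  have "(\<Sum>d<N. exp (- c * t) ^ d * poly (P (Suc d)) t) = 0" for t
    using split[of t] by (simp add: P0)
  then have "P (Suc d) = 0" if "d < N" for d
    using Suc.IH[of "\<lambda>d. P (Suc d)"] that by blast
  then show ?case using P0 Suc.prems(2) by (cases d) auto
qed simp

definition unipotent :: "real \<Rightarrow> real^3 \<Rightarrow> real^3" where
  "unipotent t h = vector [h$1 + t * h$2 + t\<^sup>2 / 2 * h$3, h$2 + t * h$3, h$3]"

lemma flow_unipotent: "flow c t *v h = exp (- c * t) *\<^sub>R unipotent t h"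
  by (simp add: flow_def unipotent_def matrix_3_simps algebra_simps)

text \<open>A formal polynomial in the time, because \<open>exp_poly_independent\<close> concludes
  about coefficient polynomials.\<close>

definition mon_path :: "nat \<times> nat \<times> nat \<Rightarrow> real^3 \<Rightarrow> real poly" where
  "mon_path = (\<lambda>(i, j, k) h. [:h$1, h$2, h$3 / 2:] ^ i * [:h$2, h$3:] ^ j * [:h$3:] ^ k)"

lemma poly_mon_path: "poly (mon_path s h) t = mon s (unipotent t h)"
  by (cases s) (simp add: mon_path_def unipotent_def algebra_simps power2_eq_square)

definition total_degree :: "nat \<times> nat \<times> nat \<Rightarrow> nat" where
  "total_degree = (\<lambda>(i, j, k). i + j + k)"

lemma mon_scaleR: "mon s (r *\<^sub>R h) = r ^ total_degree s * mon s h"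
  by (cases s) (simp add: total_degree_def power_mult_distrib power_add)

text \<open>Along the flow a polynomial is a combination of the functions \<open>e\<^sup>-\<^sup>c\<^sup>d\<^sup>t t\<^sup>l\<close>, which are
  linearly independent; so an eigenfunction is homogeneous and invariant under the unipotent part.\<close>

lemma flow_eigen_homogeneous:
  fixes c :: real
  assumes c: "c > 0" and g: "ppoly N (\<lambda>_. g)"
    and eig: "\<And>t h. t > 0 \<Longrightarrow> g (flow c t *v h) = exp (- c * t) ^ n * g h"
  obtains a where "\<And>t h. g h = (\<Sum>s | total_degree s = n. a s * mon s (unipotent t h))"
proof -
  \<comment> \<open>Exponential polynomials are compared over all real t; the group law extends the
    equation from positive times.\<close>
  have eig': "g (flow c t *v h) = exp (- c * t) ^ n * g h" for t h
  proof -
    consider "t > 0" | "t = 0" | "t < 0" by linarith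
    then show ?thesis
    proof cases
      case 3
      have "g h = g (flow c (- t) *v (flow c t *v h))"
        by (simp add: matrix_vector_mul_assoc flip: flow_add)
      also have "\<dots> = exp (c * t) ^ n * g (flow c t *v h)" using eig[of "- t"] 3 by simp
      finally have "exp (- c * t) ^ n * g h = (exp (- c * t) ^ n * exp (c * t) ^ n) * g (flow c t *v h)"
        by simp
      also have "exp (- c * t) ^ n * exp (c * t) ^ n = 1"
        by (simp add: exp_minus flip: power_mult_distrib)
      finally show ?thesis by simp
    qed (simp_all add: eig)
  qed
  \<comment> \<open>Enlarged so that n occurs among the degrees below M even if N is small.\<close>
  define M where "M = N + Suc n"
  have "ppoly M (\<lambda>_. g)" by (rule ppoly_mono[OF g]) (simp add: M_def)
  then obtain a where a: "g = (\<lambda>x. \<Sum>s\<in>mon_index M. a s * mon s x)" by (rule polynomial_normal_form)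
  have sets: "{s \<in> mon_index M. total_degree s = d} = {s. total_degree s = d}" if "d < M" for d
    using that by (auto simp: mon_index_def total_degree_def)
  have "g h = (\<Sum>s | total_degree s = n. a s * mon s (unipotent t h))" for t h
  proof -
    \<comment> \<open>For d = n the right-hand side of the eigenvalue equation is moved over as a
      constant polynomial in t.\<close>
    define P where "P d = (\<Sum>s | total_degree s = d. smult (a s) (mon_path s h)) - (if d = n then [:g h:] else 0)" for d
    have "(\<Sum>d<M. exp (- c * t) ^ d * poly (P d) t) = 0" for t
    proof -
      have "g (flow c t *v h) = (\<Sum>s\<in>mon_index M. exp (- c * t) ^ total_degree s * (a s * mon s (unipotent t h)))"
        by (simp add: a flow_unipotent mon_scaleR mult.left_commute del: mon.simps)
      also have "\<dots> = (\<Sum>d<M. \<Sum>s | s \<in> mon_index M \<and> total_degree s = d. exp (- c * t) ^ total_degree s * (a s * mon s (unipotent t h)))"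
        by (rule sum.group[OF finite_mon_index, symmetric]) (auto simp: mon_index_def total_degree_def)
      also have "\<dots> = (\<Sum>d<M. exp (- c * t) ^ d * poly (\<Sum>s | total_degree s = d. smult (a s) (mon_path s h)) t)"
        by (rule sum.cong) (simp_all add: sets poly_sum poly_mon_path sum_distrib_left del: mon.simps)
      finally have "exp (- c * t) ^ n * g h = (\<Sum>d<M. exp (- c * t) ^ d * poly (\<Sum>s | total_degree s = d. smult (a s) (mon_path s h)) t)"
        by (simp add: eig')
      moreover have "(\<Sum>d<M. exp (- c * t) ^ d * poly (if d = n then [:g h:] else 0) t) = exp (- c * t) ^ n * g h"
        by (simp add: if_distrib[of "\<lambda>p. poly p t"] if_distrib[of "(*) _"] M_def cong: if_cong)
      ultimately show ?thesis
        by (simp add: P_def right_diff_distrib sum_subtractf)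
    qed
    then have "P n = 0" by (rule exp_poly_independent[OF c]) (simp add: M_def)
    then have "poly (\<Sum>s | total_degree s = n. smult (a s) (mon_path s h)) t = g h" for t
      by (simp add: P_def)
    then show ?thesis by (simp add: poly_sum poly_mon_path del: mon.simps)
  qed
  then show ?thesis by (rule that)
qed

definition flow_invariant :: "nat \<Rightarrow> nat \<Rightarrow> real^3 \<Rightarrow> real" where
  "flow_invariant n j h = h$3 ^ (n - 2 * j) * (h$2 ^ 2 - 2 * h$1 * h$3) ^ j"

lemma flow_invariant_flow:
  assumes "j \<le> n div 2"
  shows "flow_invariant n j (flow c t *v h) = exp (- c * t) ^ n * flow_invariant n j h"
proof -
  have "(r * h$2)\<^sup>2 - 2 * (r * h$1) * (r * h$3) = r\<^sup>2 * (h$2 ^ 2 - 2 * h$1 * h$3)" for r and h :: "real^3"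
    by (simp add: power2_eq_square algebra_simps)
  then have "flow_invariant n j (r *\<^sub>R h) = r ^ (n - 2 * j) * (r\<^sup>2) ^ j * flow_invariant n j h" for r h
    by (simp add: flow_invariant_def power_mult_distrib)
  moreover have "r ^ (n - 2 * j) * (r\<^sup>2) ^ j = r ^ n" for r :: real
    using assms by (simp flip: power_mult power_add)
  moreover have "flow_invariant n j (unipotent t h) = flow_invariant n j h"
  proof -
    have "(unipotent t h $ 2)\<^sup>2 - 2 * unipotent t h $ 1 * unipotent t h $ 3 = h$2 ^ 2 - 2 * h$1 * h$3"
      by (simp add: unipotent_def power2_eq_square algebra_simps)
    then show ?thesis by (simp add: flow_invariant_def unipotent_def)
  qed
  ultimately show ?thesis by (simp add: flow_unipotent)
qed

lemma flow_invariant_ppoly: "j \<le> n div 2 \<Longrightarrow> ppoly (Suc n) (\<lambda>_. flow_invariant n j)"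
proof -
  assume j: "j \<le> n div 2"
  have v: "ppoly (Suc (Suc 0)) (\<lambda>_ h :: real^3. h $ i)" for i by (rule ppoly_var)
  have "ppoly (Suc (Suc 0) + Suc 0) (\<lambda>_ h :: real^3. h$1 * h$3)"
    by (rule ppoly_mult) (rule v)+
  moreover have "ppoly (Suc (2 * Suc 0)) (\<lambda>_ h :: real^3. h$2 ^ 2)" by (rule ppoly_power[OF v])
  ultimately have "ppoly (Suc (Suc (Suc 0))) (\<lambda>_ h :: real^3. h$2 ^ 2 - 2 * (h$1 * h$3))"
    by (intro ppoly_diff ppoly_cmult_const) (simp_all add: numeral_3_eq_3)
  then have "ppoly (Suc (j * Suc (Suc 0))) (\<lambda>_ h :: real^3. (h$2 ^ 2 - 2 * (h$1 * h$3)) ^ j)"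
    by (rule ppoly_power)
  with ppoly_power[OF v, of "n - 2 * j" 3]
  have "ppoly (Suc ((n - 2 * j) * Suc 0) + j * Suc (Suc 0)) (\<lambda>_ h :: real^3. h$3 ^ (n - 2 * j) * (h$2 ^ 2 - 2 * (h$1 * h$3)) ^ j)"
    by (rule ppoly_mult)
  moreover have "Suc ((n - 2 * j) * Suc 0) + j * Suc (Suc 0) = Suc n" using j by simp
  ultimately show ?thesis by (simp add: flow_invariant_def[abs_def] mult.assoc)
qed

text \<open>Moving a point with \<open>z \<noteq> 0\<close> to the slice \<open>y = 0\<close> exhibits \<open>g\<close> as a polynomial in \<open>z\<^sup>\<plusminus>\<^sup>1\<close> and the
  discriminant \<open>y\<^sup>2 - 2xz\<close>; evaluating at \<open>(0, 1, z)\<close> rules out negative powers of \<open>z\<close>.\<close>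

lemma flow_eigen_polynomial:
  fixes c :: real
  assumes c: "c > 0" and g: "ppoly N (\<lambda>_. g)"
    and eig: "\<And>t h. t > 0 \<Longrightarrow> g (flow c t *v h) = exp (- c * t) ^ n * g h"
  obtains b where "g = (\<lambda>h. \<Sum>j\<le>n div 2. b j * flow_invariant n j h)"
proof -
  obtain a where a: "\<And>t h. g h = (\<Sum>s | total_degree s = n. a s * mon s (unipotent t h))"
    using flow_eigen_homogeneous[OF assms] by blast
  \<comment> \<open>On the slice y = 0 the first coordinate is - D / (2 z), with D the discriminant;
    its i-th power supplies the factor (- 1 / 2)^i, and only monomials without y survive.\<close>
  define b where "b i = a (i, 0, n - i) * (- 1 / 2) ^ i" for i
  let ?D = "\<lambda>h :: real^3. h$2 ^ 2 - 2 * h$1 * h$3"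
  \<comment> \<open>Multiplication by z^n clears denominators: the exponent of z is n + (n - i) -
    i.\<close>
  have slice: "h$3 ^ n * g h = (\<Sum>i\<le>n. b i * ?D h ^ i * h$3 ^ (2 * n - 2 * i))" if z: "h$3 \<noteq> 0" for h
  proof -
    \<comment> \<open>The time at which the second coordinate y + t z vanishes.\<close>
    let ?t = "- h$2 / h$3"
    have u: "unipotent ?t h = vector [- ?D h / (2 * h$3), 0, h$3]"
      using z by (simp add: unipotent_def vec_eq_iff forall_3 field_simps power2_eq_square)
    have "g h = (\<Sum>s | total_degree s = n. a s * mon s (vector [- ?D h / (2 * h$3), 0, h$3]))"
      using a[of h ?t] unfolding u .
    also have "\<dots> = (\<Sum>i\<le>n. a (i, 0, n - i) * (- ?D h / (2 * h$3)) ^ i * h$3 ^ (n - i))"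
    proof -
      let ?F = "\<lambda>s. a s * mon s (vector [- ?D h / (2 * h$3), 0, h$3])"
      have "finite {s. total_degree s = n}"
        by (rule finite_subset[OF _ finite_mon_index[of "Suc n"]]) (auto simp: mon_index_def total_degree_def)
      then have "(\<Sum>s | total_degree s = n. ?F s) = (\<Sum>s\<in>(\<lambda>i. (i, 0, n - i)) ` {..n}. ?F s)"
        by (rule sum.mono_neutral_right) (auto simp: total_degree_def image_iff)
      also have "\<dots> = (\<Sum>i\<le>n. a (i, 0, n - i) * (- ?D h / (2 * h$3)) ^ i * h$3 ^ (n - i))"
        by (subst sum.reindex) (auto simp: inj_on_def mult.assoc)
      finally show ?thesis .
    qed
    finally have "h$3 ^ n * g h = (\<Sum>i\<le>n. h$3 ^ n * (a (i, 0, n - i) * (- ?D h / (2 * h$3)) ^ i * h$3 ^ (n - i)))"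
      by (simp add: sum_distrib_left)
    also have "\<dots> = (\<Sum>i\<le>n. b i * ?D h ^ i * h$3 ^ (2 * n - 2 * i))"
    proof (rule sum.cong[OF refl])
      fix i assume "i \<in> {..n}"
      then have i: "i \<le> n" by simp
      have "- ?D h / (2 * h$3) * h$3 = - 1 / 2 * ?D h" using z by (simp add: field_simps)
      then have e1: "(- ?D h / (2 * h$3)) ^ i * h$3 ^ i = (- 1 / 2) ^ i * ?D h ^ i"
        by (simp only: power_mult_distrib[symmetric])
      have e2: "h$3 ^ n = h$3 ^ i * h$3 ^ (n - i)" using i by (simp flip: power_add)
      have "2 * n - 2 * i = (n - i) + (n - i)" using i by simp
      then have e3: "h$3 ^ (2 * n - 2 * i) = h$3 ^ (n - i) * h$3 ^ (n - i)" by (simp only: power_add)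
      have "h$3 ^ n * (a (i, 0, n - i) * (- ?D h / (2 * h$3)) ^ i * h$3 ^ (n - i))
          = a (i, 0, n - i) * ((- ?D h / (2 * h$3)) ^ i * h$3 ^ i) * (h$3 ^ (n - i) * h$3 ^ (n - i))"
        unfolding e2 by (simp only: mult_ac)
      then show "h$3 ^ n * (a (i, 0, n - i) * (- ?D h / (2 * h$3)) ^ i * h$3 ^ (n - i)) = b i * ?D h ^ i * h$3 ^ (2 * n - 2 * i)"
        unfolding e1 e3 b_def by (simp only: mult.assoc)
    qed
    finally show ?thesis .
  qed
  \<comment> \<open>At (0, 1, z) the discriminant is 1, so z^n g(0, 1, z) is the sum of the b i
    z^{2n - 2i}; the left side is divisible by z^n, which kills every coefficient with 2n - 2i <
    n.\<close>
  have b0: "b i = 0" if i: "i \<le> n" "n < 2 * i" for i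
  proof -
    define G where "G = (\<Sum>s | total_degree s = n. smult (a s) (if fst s = 0 then [:0, 1:] ^ (snd (snd s)) else 0))"
    define q where "q = (\<Sum>i\<le>n. monom (b i) (2 * n - 2 * i))"
    have G: "poly G z = g (vector [0, 1, z])" for z
    proof -
      have u0: "unipotent 0 h = h" for h by (simp add: unipotent_def vec_eq_iff forall_3)
      show ?thesis
        unfolding a[of _ 0] u0 G_def poly_sum
        by (intro sum.cong refl) (auto simp: case_prod_unfold)
    qed
    have "poly ([:0, 1:] * (monom 1 n * G - q)) z = 0" for z
    proof (cases "z = 0")
      case False
      then have "z ^ n * poly G z = (\<Sum>i\<le>n. b i * z ^ (2 * n - 2 * i))"
        using slice[of "vector [0, 1, z]"] by (simp add: G)
      then show ?thesis by (simp add: q_def poly_sum poly_monom)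
    qed simp
    then have "[:0, 1:] * (monom 1 n * G - q) = 0"
      using poly_all_0_iff_0 by blast
    then have "monom 1 n * G = q" by simp
    moreover have "coeff (monom 1 n * G) (2 * n - 2 * i) = 0"
      using i by (simp add: coeff_monom_mult)
    moreover have "coeff q (2 * n - 2 * i) = (\<Sum>i'\<le>n. if i' = i then b i' else 0)"
      unfolding q_def coeff_sum by (rule sum.cong) (use i in auto)
    ultimately show ?thesis using i by simp
  qed
  have nz: "g h = (\<Sum>j\<le>n div 2. b j * flow_invariant n j h)" if z: "h$3 \<noteq> 0" for h
  proof -
    have "h$3 ^ n * g h = (\<Sum>i\<le>n div 2. b i * ?D h ^ i * h$3 ^ (2 * n - 2 * i))"
      unfolding slice[OF z] by (rule sum.mono_neutral_right) (auto intro: b0)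
    also have "\<dots> = h$3 ^ n * (\<Sum>j\<le>n div 2. b j * flow_invariant n j h)"
      unfolding sum_distrib_left
    proof (rule sum.cong[OF refl])
      fix j assume "j \<in> {..n div 2}"
      then have "2 * n - 2 * j = n + (n - 2 * j)" by auto
      then show "b j * ?D h ^ j * h$3 ^ (2 * n - 2 * j) = h$3 ^ n * (b j * flow_invariant n j h)"
        by (simp add: flow_invariant_def power_add)
    qed
    finally show ?thesis using z by simp
  qed
  have "ppoly (Suc n) (\<lambda>_ h. \<Sum>j\<le>n div 2. b j * flow_invariant n j h)"
    by (intro ppoly_sum ppoly_cmult_const flow_invariant_ppoly) simp
  \<comment> \<open>The exceptional plane z = 0 is a null set, and polynomials equal almost
    everywhere are equal.\<close>
  moreover have "AE h in lborel. g h = (\<Sum>j\<le>n div 2. b j * flow_invariant n j h)"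
  proof (rule AE_I)
    show "{h \<in> space lborel. g h \<noteq> (\<Sum>j\<le>n div 2. b j * flow_invariant n j h)} \<subseteq> {h. axis 3 1 \<bullet> h = (0 :: real)}"
      using nz by (auto simp: inner_axis')
    have "negligible {h :: real^3. axis 3 1 \<bullet> h = (0 :: real)}"
      by (rule negligible_hyperplane) (simp add: axis_eq_0_iff)
    moreover have "{h :: real^3. axis 3 1 \<bullet> h = (0 :: real)} \<in> sets lborel"
      by (simp add: borel_closed closed_hyperplane)
    ultimately show "emeasure lborel {h :: real^3. axis 3 1 \<bullet> h = (0 :: real)} = 0"
      "{h :: real^3. axis 3 1 \<bullet> h = (0 :: real)} \<in> sets lborel"
      by (auto simp: negligible_iff_null_sets null_sets_def)
  qed
  ultimately have "g = (\<lambda>h. \<Sum>j\<le>n div 2. b j * flow_invariant n j h)"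
    by (rule polynomial_AE_eq[OF g])
  then show ?thesis by (rule that)
qed

lemma flow_invariant_independent:
  assumes "\<And>h. (\<Sum>j\<le>n div 2. b j * flow_invariant n j h) = 0" "j \<le> n div 2"
  shows "b j = 0"
proof -
  \<comment> \<open>At (- s / 2, 0, 1) the discriminant is s and z is 1.\<close>
  have "poly (\<Sum>j\<le>n div 2. monom (b j) j) s = 0" for s
    using assms(1)[of "vector [- s / 2, 0, 1]"] by (simp add: flow_invariant_def poly_sum poly_monom)
  then have "(\<Sum>j\<le>n div 2. monom (b j) j) = 0" using poly_all_0_iff_0 by blast
  then have "coeff (\<Sum>j\<le>n div 2. monom (b j) j) j = 0" by simp
  then show ?thesis using assms(2) by (simp add: coeff_sum)
qed

section \<open>Eigenfunctions of the semigroup are polynomials\<close>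

lemma quadratic_form_upper_bound:
  fixes A :: "real^3^3"
  obtains K where "K > 0" "\<And>v. v \<bullet> (A *v v) \<le> K * (v \<bullet> v)"
proof
  have "v \<bullet> (A *v v) \<le> (onorm ((*v) A) + 1) * (v \<bullet> v)" for v
  proof -
    have "v \<bullet> (A *v v) \<le> norm v * norm (A *v v)" by (rule norm_cauchy_schwarz)
    also have "\<dots> \<le> norm v * (onorm ((*v) A) * norm v)"
      by (intro mult_left_mono onorm matrix_vector_mul_bounded_linear) simp
    also have "\<dots> \<le> norm v * ((onorm ((*v) A) + 1) * norm v)"
      by (intro mult_left_mono mult_right_mono) auto
    finally show ?thesis by (simp add: dot_square_norm power2_eq_square mult_ac)
  qed
  then show "v \<bullet> (A *v v) \<le> (onorm ((*v) A) + 1) * (v \<bullet> v)" for v .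
  show "onorm ((*v) A) + 1 > 0" using onorm_pos_le[OF matrix_vector_mul_bounded_linear[of A]] by simp
qed

text \<open>An upper bound K for the inverse form, inserted in the nonnegative inverse form at z / K
  - J z, gives the constant 1 / K.\<close>

lemma spd_lower_bound:
  assumes "spd J"
  obtains l where "l > 0" "\<And>z. l * (z \<bullet> z) \<le> z \<bullet> (J *v z)"
proof -
  let ?Q = "matrix_inv J"
  note i = spd_invertible[OF assms]
  obtain K where K: "K > 0" "\<And>v. v \<bullet> (?Q *v v) \<le> K * (v \<bullet> v)" using quadratic_form_upper_bound by blast
  have "1 / K * (z \<bullet> z) \<le> z \<bullet> (J *v z)" for z
  proof -
    let ?w = "(1 / K) *\<^sub>R z"
    have "0 \<le> (?w - J *v z) \<bullet> (?Q *v (?w - J *v z))"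
      by (rule spd_nonneg[OF spd_matrix_inv[OF assms]])
    also have "\<dots> = ?w \<bullet> (?Q *v ?w) - 2 * (?w \<bullet> z) + z \<bullet> (J *v z)"
      using spd_sym[OF spd_matrix_inv[OF assms], of "J *v z" ?w]
      by (simp only: matrix_vector_mult_diff_distrib matrix_inv_cancel_vec[OF i] inner_diff inner_commute)
    finally have "2 * (?w \<bullet> z) - K * (?w \<bullet> ?w) \<le> z \<bullet> (J *v z)" using K(2)[of ?w] by linarith
    then show ?thesis using K(1) by (simp add: field_simps)
  qed
  then show ?thesis using K(1) by (intro that[of "1 / K"]) auto
qed

text \<open>Polarisation at unit vectors. The constant comes from the quadratic form alone, so one K
  serves the inverse covariances for all t >= 1.\<close>

lemma spd_bilinear_bound:
  assumes J: "spd J" and K: "\<And>v. v \<bullet> (J *v v) \<le> K * (v \<bullet> v)"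
  shows "\<bar>z \<bullet> (J *v w)\<bar> \<le> K * norm z * norm w"
proof (cases "z = 0 \<or> w = 0")
  case False
  let ?a = "(1 / norm z) *\<^sub>R z" and ?b = "(1 / norm w) *\<^sub>R w"
  have n: "?a \<bullet> ?a = 1" "?b \<bullet> ?b = 1" using False by (simp_all add: dot_square_norm power2_eq_square)
  have "0 \<le> (?a + ?b) \<bullet> (J *v (?a + ?b))" "0 \<le> (?a - ?b) \<bullet> (J *v (?a - ?b))"
    by (rule spd_nonneg[OF J])+
  then have "\<bar>2 * (?a \<bullet> (J *v ?b))\<bar> \<le> ?a \<bullet> (J *v ?a) + ?b \<bullet> (J *v ?b)"
    using spd_sym[OF J, of ?b ?a]
    by (simp only: matrix_vector_right_distrib matrix_vector_mult_diff_distrib inner_add inner_diff)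
  also have "\<dots> \<le> 2 * K" using K[of ?a] K[of ?b] unfolding n by simp
  finally have "\<bar>?a \<bullet> (J *v ?b)\<bar> \<le> K" by simp
  moreover have "?a \<bullet> (J *v ?b) = (z \<bullet> (J *v w)) / (norm z * norm w)"
    by (simp add: matrix_vector_mult_scaleR)
  ultimately have "\<bar>z \<bullet> (J *v w)\<bar> / (norm z * norm w) \<le> K"
    by (simp only: abs_divide abs_mult abs_norm_cancel)
  then show ?thesis using False by (simp add: field_simps)
qed auto

text \<open>A larger form has a smaller Gaussian integral, and that integral is a constant divided
  by the root of the determinant.\<close>

lemma spd_det_mono:
  assumes P: "spd P" and Q: "spd Q" and le: "\<And>v. v \<bullet> (P *v v) \<le> v \<bullet> (Q *v v)"
  shows "det P \<le> det Q"
proof -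
  let ?I = "\<lambda>J. \<integral>\<^sup>+x. ennreal (exp (- ((J *v x) \<bullet> x) / 4)) \<partial>lborel"
  have "?I Q \<le> ?I P"
    using le by (intro nn_integral_mono ennreal_leI) (simp add: inner_commute)
  then have "(4 * pi) powr (3/2) / sqrt (det Q) \<le> (4 * pi) powr (3/2) / sqrt (det P)"
    unfolding nn_integral_gaussian(1)[OF P] nn_integral_gaussian(1)[OF Q] using spd_det_pos[OF P] by simp
  then have "sqrt (det P) \<le> sqrt (det Q)"
    using spd_det_pos[OF P] spd_det_pos[OF Q] by (simp add: field_simps)
  then show ?thesis by simp
qed

lemma power_le_fact_exp: "x \<ge> 0 \<Longrightarrow> x ^ k \<le> fact k * exp (x::real)"
proof -
  assume x: "x \<ge> 0"
  have "inverse (fact k) *\<^sub>R x ^ k \<le> exp x"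
    unfolding exp_def using sum_le_suminf[OF summable_exp_generic, of "{k}" x] x by simp
  then show ?thesis by (simp add: field_simps)
qed

lemma integrable_gmeas_exp:
  assumes Q: "spd Q"
  shows "integrable (gmeas Q) (\<lambda>z. exp (a * norm z))"
proof -
  let ?J = "matrix_inv Q"
  obtain l where l: "l > 0" "\<And>z. l * (z \<bullet> z) \<le> z \<bullet> (?J *v z)" using spd_lower_bound[OF spd_matrix_inv[OF Q]] by blast
  \<comment> \<open>Half of the quadratic decay is kept for integrability; the other half absorbs
    \<open>a * norm z\<close>.\<close>
  define A :: "real^3^3" where "A = (l / 2) *\<^sub>R mat 1"
  have "transpose A = A" by (simp add: A_def matrix_3_simps)
  then have A: "spd A" using l(1) by (simp add: A_def spd_def matrix_vector_mul_scaleR_left)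
  let ?C = "1 / ((4 * pi) powr (3/2) * det Q powr (1/2)) * exp (2 * a\<^sup>2 / l)"
  have "integrable lborel (\<lambda>z. ?C * exp (- ((A *v z) \<bullet> z) / 4))"
  proof (intro integrable_mult_right integrableI_nonneg)
    show "(\<integral>\<^sup>+z. ennreal (exp (- ((A *v z) \<bullet> z) / 4)) \<partial>lborel) < \<infinity>"
      unfolding nn_integral_gaussian(1)[OF A] by simp
  qed auto
  then have "integrable lborel (\<lambda>z. gauss Q z * exp (a * norm z))"
  proof (rule Bochner_Integration.integrable_bound)
    show "AE z in lborel. norm (gauss Q z * exp (a * norm z)) \<le> norm (?C * exp (- ((A *v z) \<bullet> z) / 4))"
    proof (rule AE_I2)
      fix z :: "real^3"
      \<comment> \<open>Completing the square in |z| is where the constant 2 a^2 / l in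
        \<open>?C\<close> comes from.\<close>
      have "0 \<le> (l * norm z - 4 * a)\<^sup>2 / (8 * l)" using l(1) by simp
      also have "\<dots> = l * (z \<bullet> z) / 8 - a * norm z + 2 * a\<^sup>2 / l"
        using l(1) by (simp add: dot_square_norm power2_eq_square field_simps)
      finally have "- ((?J *v z) \<bullet> z) / 4 + a * norm z \<le> 2 * a\<^sup>2 / l + - ((A *v z) \<bullet> z) / 4"
        using l(2)[of z] by (simp add: A_def matrix_vector_mul_scaleR_left inner_commute)
      then have "exp (- ((?J *v z) \<bullet> z) / 4) * exp (a * norm z) \<le> exp (2 * a\<^sup>2 / l) * exp (- ((A *v z) \<bullet> z) / 4)"
        by (simp only: exp_add[symmetric] exp_le_cancel_iff)
      then have "1 / ((4 * pi) powr (3/2) * det Q powr (1/2)) * (exp (- ((?J *v z) \<bullet> z) / 4) * exp (a * norm z))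
        \<le> 1 / ((4 * pi) powr (3/2) * det Q powr (1/2)) * (exp (2 * a\<^sup>2 / l) * exp (- ((A *v z) \<bullet> z) / 4))"
        by (intro mult_left_mono) auto
      then show "norm (gauss Q z * exp (a * norm z)) \<le> norm (?C * exp (- ((A *v z) \<bullet> z) / 4))"
        by (simp add: abs_mult gauss_def mult.assoc)
    qed
  qed simp
  then show ?thesis
    unfolding gmeas_def by (subst integrable_density) auto
qed

lemma poly_growth_exp_bound:
  assumes "u \<in> poly_growth"
  obtains K where "\<And>z. \<bar>u z\<bar> \<le> K * exp (norm z)"
proof -
  obtain K k where u: "\<And>z. \<bar>u z\<bar> \<le> K * (1 + norm z) ^ k" using assms by (auto simp: poly_growth_def)
  have "\<bar>u z\<bar> \<le> \<bar>K\<bar> * fact k * exp 1 * exp (norm z)" for z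
  proof -
    have "\<bar>u z\<bar> \<le> \<bar>K\<bar> * (1 + norm z) ^ k"
      by (rule order_trans[OF u]) (intro mult_right_mono, auto)
    also have "\<dots> \<le> \<bar>K\<bar> * (fact k * exp (1 + norm z))"
      by (intro mult_left_mono power_le_fact_exp) auto
    finally show ?thesis by (simp add: exp_add mult.assoc)
  qed
  then show ?thesis by (rule that)
qed

lemma poly_growth_measurable: "u \<in> poly_growth \<Longrightarrow> u \<in> borel_measurable borel"
  by (simp add: poly_growth_def)

lemma integrable_poly_growth:
  assumes "spd Q" "u \<in> poly_growth"
  shows "integrable (gmeas Q) u"
proof -
  obtain K where K: "\<And>z. \<bar>u z\<bar> \<le> K * exp (norm z)" using poly_growth_exp_bound[OF assms(2)] by blast
  have [measurable]: "u \<in> borel_measurable borel" by (rule poly_growth_measurable) fact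
  have "integrable (gmeas Q) (\<lambda>z. K * exp (1 * norm z))"
    by (intro integrable_mult_right integrable_gmeas_exp assms(1))
  then show ?thesis
    by (rule Bochner_Integration.integrable_bound) (use K in \<open>auto intro: order_trans[OF _ abs_ge_self]\<close>)
qed

section \<open>The averaging operator S on polynomials\<close>

context
  fixes c \<sigma> :: real
  assumes c: "c > 0" and \<sigma>: "\<sigma> > 0"
begin

abbreviation (input) "\<mu> \<equiv> gmeas (cov_inf c \<sigma>)"

text \<open>The operator S of the overview. On polynomials it is the exponential of the
  constant-coefficient second-order operator with coefficient matrix
  \<open>cov_inf c \<sigma>\<close>.\<close>

definition gauss_avg :: "(real^3 \<Rightarrow> real) \<Rightarrow> real^3 \<Rightarrow> real" where
  "gauss_avg g h = (LINT y|\<mu>. g (h + y))"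

lemma integrable_polynomial_translate:
  assumes "ppoly N (\<lambda>_. g)" "spd Q"
  shows "integrable (gmeas Q) (\<lambda>y. g (h + y))"
proof -
  have "ppoly N (\<lambda>_ y. g (h + y))"
    by (rule ppoly_compose[OF assms(1)]) (simp add: ppoly_add ppoly_var ppoly_coeff poly_growth_const)
  then show ?thesis by (intro integrable_poly_growth assms(2) polynomial_poly_growth)
qed

lemma gauss_avg_diff_ppoly:
  assumes g: "ppoly (Suc N) (\<lambda>_. g)"
  shows "ppoly N (\<lambda>_ h. gauss_avg g h - g h)"
proof -
  interpret prob_space \<mu> by (rule prob_space_inf[OF c \<sigma>])
  have "ppoly N (\<lambda>_ h. LINT y|\<mu>. 1 * (g (h + y) - g h))"
    by (rule ppoly_integral[OF ppoly_translate_diff[OF g]])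
       (simp add: integrable_poly_growth spd_cov_inf[OF c \<sigma>])
  moreover have "(LINT y|\<mu>. 1 * (g (h + y) - g h)) = gauss_avg g h - g h" for h
    using integrable_polynomial_translate[OF g spd_cov_inf[OF c \<sigma>], of h] prob_space
    by (simp add: gauss_avg_def)
  ultimately show ?thesis by simp
qed

lemma gauss_avg_ppoly:
  assumes "ppoly N (\<lambda>_. g)"
  shows "ppoly N (\<lambda>_. gauss_avg g)"
proof -
  have "ppoly N (\<lambda>_ h. (gauss_avg g h - g h) + g h)"
    by (intro ppoly_add gauss_avg_diff_ppoly ppoly_mono[OF assms] assms) simp
  then show ?thesis by simp
qed

lemma gauss_avg_add:
  assumes "ppoly M (\<lambda>_. f)" "ppoly N (\<lambda>_. g)"
  shows "gauss_avg (\<lambda>x. f x + a * g x) h = gauss_avg f h + a * gauss_avg g h"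
  using assms[THEN integrable_polynomial_translate, OF spd_cov_inf[OF c \<sigma>], of h]
  by (simp add: gauss_avg_def)

text \<open>If S g = 0 then g = - (S g - g), which has lower degree; the induction ends at the
  strict bound 0, which admits only the zero polynomial.\<close>

lemma gauss_avg_inj:
  assumes "ppoly N (\<lambda>_. g)" "\<And>h. gauss_avg g h = 0"
  shows "g = (\<lambda>_. 0)"
  using assms
proof (induction N)
  case 0
  then have "\<And>H. ppoly 0 H \<Longrightarrow> H = (\<lambda>_ _. 0)" by (auto elim: ppoly.cases)
  from this[OF 0(1)] show ?case by meson
next
  case (Suc N)
  have "ppoly N (\<lambda>_ h. (- 1) * (gauss_avg g h - g h))"
    by (intro ppoly_cmult_const gauss_avg_diff_ppoly Suc.prems)
  then show ?case using Suc.prems(2) by (intro Suc.IH) simp_all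
qed

text \<open>S g - g has lower degree and so equals S p for some p by induction; then S (g - p) =
  g.\<close>

lemma gauss_avg_surj:
  assumes "ppoly N (\<lambda>_. g)"
  obtains p where "ppoly N (\<lambda>_. p)" "gauss_avg p = g"
proof -
  have "\<exists>p. ppoly N (\<lambda>_. p) \<and> gauss_avg p = g"
    using assms
  proof (induction N arbitrary: g)
    case 0
    have "\<And>H. ppoly 0 H \<Longrightarrow> H = (\<lambda>_ _. 0)" by (auto elim: ppoly.cases)
    from this[OF 0] have "g = (\<lambda>_. 0)" by meson
    then show ?case using ppoly_0 by (intro exI[of _ "\<lambda>_. 0"]) (simp add: gauss_avg_def fun_eq_iff)
  next
    case (Suc N)
    obtain p where p: "ppoly N (\<lambda>_. p)" "gauss_avg p = (\<lambda>h. gauss_avg g h - g h)"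
      using Suc.IH[OF gauss_avg_diff_ppoly[OF Suc.prems]] by blast
    have "ppoly (Suc N) (\<lambda>_ x. g x + (- 1) * p x)"
      by (intro ppoly_add ppoly_cmult_const Suc.prems ppoly_mono[OF p(1)]) simp
    moreover have "gauss_avg (\<lambda>x. g x + (- 1) * p x) = g"
      by (rule ext) (simp only: gauss_avg_add[OF Suc.prems p(1)] p(2), simp)
    ultimately show ?case by blast
  qed
  then show ?thesis using that by blast
qed

lemma ou_fun_ppoly:
  assumes "ppoly N (\<lambda>_. g)" "t > 0"
  shows "ppoly N (\<lambda>_. ou_fun c \<sigma> t g)"
proof -
  have [measurable]: "g \<in> borel_measurable borel"
    using polynomial_poly_growth[OF assms(1)] by (rule poly_growth_measurable)
  have "ppoly N (\<lambda>y x. g (flow c t *v x - y))"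
    by (rule ppoly_compose[OF assms(1)])
       (simp add: ppoly_diff ppoly_linear ppoly_coeff poly_growth_component)
  then have "ppoly N (\<lambda>_ x. LINT y|gmeas (cov_fin c \<sigma> t). 1 * g (flow c t *v x - y))"
    by (rule ppoly_integral) (simp add: integrable_poly_growth spd_cov_fin[OF c \<sigma> assms(2)])
  moreover have "ou_fun c \<sigma> t g = (\<lambda>x. LINT y|gmeas (cov_fin c \<sigma> t). 1 * g (flow c t *v x - y))"
    by (rule ext) (simp add: ou_fun_eq[OF c \<sigma> assms(2)])
  ultimately show ?thesis by simp
qed

text \<open>As a function of x, T(t) g (h + x) is T(t) applied to the translate of g by e^{tB} h,
  and mu does not see T(t).\<close>

lemma gauss_avg_ou_fun:
  assumes g: "ppoly N (\<lambda>_. g)" and t: "t > 0"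
  shows "gauss_avg (ou_fun c \<sigma> t g) h = gauss_avg g (flow c t *v h)"
proof -
  have [measurable]: "g \<in> borel_measurable borel"
    using polynomial_poly_growth[OF g] by (rule poly_growth_measurable)
  let ?f = "\<lambda>v. g (flow c t *v h + v)"
  have [measurable]: "?f \<in> borel_measurable borel" by measurable
  have "ou_fun c \<sigma> t g (h + x) = ou_fun c \<sigma> t ?f x" for x
    by (simp add: ou_fun_eq[OF c \<sigma> t] matrix_vector_right_distrib add_diff_eq)
  then have "gauss_avg (ou_fun c \<sigma> t g) h = (LINT x|\<mu>. ou_fun c \<sigma> t ?f x)"
    by (simp add: gauss_avg_def)
  also have "\<dots> = (LINT x|\<mu>. ?f x)"
    by (rule integral_ou_fun[OF c \<sigma> t integrable_polynomial_translate[OF g spd_cov_inf[OF c \<sigma>]]])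
  finally show ?thesis by (simp add: gauss_avg_def)
qed

lemma ou_fun_eigen_iff:
  assumes g: "ppoly N (\<lambda>_. g)" and t: "t > 0"
  shows "ou_fun c \<sigma> t g = (\<lambda>x. r * g x) \<longleftrightarrow> (\<forall>h. gauss_avg g (flow c t *v h) = r * gauss_avg g h)"
proof -
  have p: "ppoly N (\<lambda>_ x. ou_fun c \<sigma> t g x + (- r) * g x)"
    by (intro ppoly_add ppoly_cmult_const g ou_fun_ppoly t)
  have avg: "gauss_avg (\<lambda>x. ou_fun c \<sigma> t g x + (- r) * g x) h = gauss_avg g (flow c t *v h) - r * gauss_avg g h" for h
    unfolding gauss_avg_add[OF ou_fun_ppoly[OF g t] g] gauss_avg_ou_fun[OF g t] by simp
  have "ou_fun c \<sigma> t g = (\<lambda>x. r * g x) \<longleftrightarrow> (\<lambda>x. ou_fun c \<sigma> t g x + (- r) * g x) = (\<lambda>_. 0)"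
    by (auto simp: fun_eq_iff)
  also have "\<dots> \<longleftrightarrow> (\<forall>h. gauss_avg (\<lambda>x. ou_fun c \<sigma> t g x + (- r) * g x) h = 0)"
  proof
    assume "(\<lambda>x. ou_fun c \<sigma> t g x + (- r) * g x) = (\<lambda>_. 0)"
    then show "\<forall>h. gauss_avg (\<lambda>x. ou_fun c \<sigma> t g x + (- r) * g x) h = 0"
      by (simp only:) (simp add: gauss_avg_def)
  qed (use gauss_avg_inj[OF p] in blast)
  finally show ?thesis by (simp only: avg) auto
qed

lemma polynomial_L2:
  assumes "ppoly N (\<lambda>_. g)"
  shows "abs_ae_fun g \<in> L2 (ou_measure c \<sigma>)"
proof -
  have g: "g \<in> poly_growth" by (rule polynomial_poly_growth[OF assms])
  then have "integrable \<mu> (\<lambda>x. g x * g x)"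
    by (intro integrable_poly_growth spd_cov_inf[OF c \<sigma>] poly_growth_mult)
  then show ?thesis
    by (simp add: L2_iff[OF c \<sigma>] sqnorm_abs[OF c \<sigma>] poly_growth_measurable[OF g] integrable_iff_bounded power2_eq_square abs_mult)
qed

section \<open>Taylor expansion of the kernel relative to the invariant measure\<close>

lemma integrable_L2_mult_exp:
  assumes F: "F \<in> L2 (ou_measure c \<sigma>)" and [measurable]: "v \<in> borel_measurable borel"
    and v: "\<And>z. \<bar>v z\<bar> \<le> K * exp (a * norm z)"
  shows "integrable \<mu> (\<lambda>z. rep_ae_fun F z * v z)"
proof -
  have f: "integrable \<mu> (\<lambda>z. (rep_ae_fun F z)\<^sup>2)"
    using F by (simp add: L2_def ou_measure_eq[OF c \<sigma>])
  have "integrable \<mu> (\<lambda>z. (rep_ae_fun F z)\<^sup>2 + K\<^sup>2 * exp ((2 * a) * norm z))"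
    by (intro Bochner_Integration.integrable_add f integrable_mult_right integrable_gmeas_exp spd_cov_inf[OF c \<sigma>])
  then show ?thesis
  proof (rule Bochner_Integration.integrable_bound)
    show "AE z in \<mu>. norm (rep_ae_fun F z * v z) \<le> norm ((rep_ae_fun F z)\<^sup>2 + K\<^sup>2 * exp ((2 * a) * norm z))"
    proof (rule AE_I2)
      fix z
      have "(v z)\<^sup>2 \<le> (K * exp (a * norm z))\<^sup>2"
        using power_mono[OF v[of z], of 2] by simp
      also have "\<dots> = K\<^sup>2 * exp ((2 * a) * norm z)"
        by (simp add: power_mult_distrib mult.assoc flip: exp_double)
      finally have "(v z)\<^sup>2 \<le> K\<^sup>2 * exp ((2 * a) * norm z)" .
      \<comment> \<open>Membership in L2 controls the first square, and Gaussian decay controls the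
        second.\<close>
      moreover have "2 * \<bar>rep_ae_fun F z * v z\<bar> \<le> (rep_ae_fun F z)\<^sup>2 + (v z)\<^sup>2"
        using sum_squares_bound[of "\<bar>rep_ae_fun F z\<bar>" "\<bar>v z\<bar>"] by (simp add: abs_mult mult.assoc)
      ultimately show "norm (rep_ae_fun F z * v z) \<le> norm ((rep_ae_fun F z)\<^sup>2 + K\<^sup>2 * exp ((2 * a) * norm z))"
        using zero_le_power2[of "rep_ae_fun F z"] zero_le_power2[of "v z"] abs_ge_zero[of "rep_ae_fun F z * v z"]
        unfolding real_norm_def by linarith
    qed
  qed measurable
qed

text \<open>The density of the centred kernel with respect to mu, so that integrals are taken
  against the measure for which F is square integrable.\<close>

definition density_ratio :: "real \<Rightarrow> real^3 \<Rightarrow> real" where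
  "density_ratio t z = gauss (cov_fin c \<sigma> t) z / gauss (cov_inf c \<sigma>) z"

lemma measurable_density_ratio [measurable]: "density_ratio t \<in> borel_measurable borel"
  unfolding density_ratio_def[abs_def] by measurable

lemma density_ratio_nonneg: "0 \<le> density_ratio t z"
  by (simp add: density_ratio_def)

text \<open>The exponents are ordered because Q_t lies below its limit, and the normalisations
  because Q_t lies above Q_1. The restriction t >= 1 keeps det Q_t away from 0.\<close>

lemma density_ratio_bound:
  obtains R where "R \<ge> 0" "\<And>t z. t \<ge> 1 \<Longrightarrow> density_ratio t z \<le> R"
proof -
  let ?d = "\<lambda>Q. (4 * pi) powr (3/2) * det Q powr (1/2)"
  let ?Q1 = "cov_fin c \<sigma> 1" and ?I = "cov_inf c \<sigma>"
  note I = spd_cov_inf[OF c \<sigma>]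
  have "density_ratio t z \<le> ?d ?I / ?d ?Q1" if t: "t \<ge> 1" for t z
  proof -
    let ?Q = "cov_fin c \<sigma> t"
    have Q: "spd ?Q" "spd ?Q1" using t by (auto intro: spd_cov_fin[OF c \<sigma>])
    have "exp (- ((matrix_inv ?Q *v z) \<bullet> z) / 4) \<le> exp (- ((matrix_inv ?I *v z) \<bullet> z) / 4)"
      using spd_inv_antimono[OF Q(1) I cov_fin_le[OF c \<sigma>], of z] by (simp add: inner_commute)
    moreover have "1 / ?d ?Q \<le> 1 / ?d ?Q1"
      using spd_det_mono[OF Q(2,1) cov_fin_mono[OF c \<sigma> t]] spd_det_pos[OF Q(2)]
      by (intro divide_left_mono mult_left_mono powr_mono2 mult_pos_pos) auto
    ultimately have "gauss ?Q z \<le> 1 / ?d ?Q1 * exp (- ((matrix_inv ?I *v z) \<bullet> z) / 4)"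
      unfolding gauss_def by (intro mult_mono) auto
    also have "\<dots> = ?d ?I / ?d ?Q1 * gauss ?I z"
      using spd_det_pos[OF I] by (simp add: gauss_def)
    finally show ?thesis
      using gauss_pos[OF I, of z] by (simp add: density_ratio_def pos_divide_le_eq)
  qed
  then show ?thesis by (intro that[of "?d ?I / ?d ?Q1"]) auto
qed

text \<open>What is left of the exponent of the kernel at w - z, for w = e^{tB} x, once the centred
  exponent in z is split off: affine in z and small with w.\<close>

definition cross_form :: "real \<Rightarrow> real^3 \<Rightarrow> real^3 \<Rightarrow> real" where
  "cross_form t z x = (z \<bullet> (matrix_inv (cov_fin c \<sigma> t) *v (flow c t *v x))) / 2
     - ((flow c t *v x) \<bullet> (matrix_inv (cov_fin c \<sigma> t) *v (flow c t *v x))) / 4"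

lemma measurable_cross_form [measurable]: "(\<lambda>z. cross_form t z x) \<in> borel_measurable borel"
  unfolding cross_form_def by measurable

lemma gauss_shift:
  assumes t: "t > 0"
  shows "gauss (cov_fin c \<sigma> t) (flow c t *v x - z) = gauss (cov_inf c \<sigma>) z * (density_ratio t z * exp (cross_form t z x))"
proof -
  let ?Q = "cov_fin c \<sigma> t" and ?w = "flow c t *v x"
  let ?J = "matrix_inv ?Q"
  have "(?J *v (?w - z)) \<bullet> (?w - z) = (?J *v z) \<bullet> z - 4 * cross_form t z x"
    using spd_sym[OF spd_matrix_inv[OF spd_cov_fin[OF c \<sigma> t]], of z ?w]
    by (simp add: cross_form_def matrix_vector_mult_diff_distrib inner_diff inner_commute)
  then have "exp (- ((?J *v (?w - z)) \<bullet> (?w - z)) / 4) = exp (- ((?J *v z) \<bullet> z) / 4) * exp (cross_form t z x)"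
    by (simp add: diff_divide_distrib flip: exp_add)
  then have "gauss ?Q (?w - z) = gauss ?Q z * exp (cross_form t z x)"
    by (simp add: gauss_def)
  then show ?thesis
    using gauss_pos[OF spd_cov_inf[OF c \<sigma>], of z] by (simp add: density_ratio_def)
qed

lemma ou_fun_density:
  assumes t: "t > 0" and [measurable]: "f \<in> borel_measurable borel"
  shows "ou_fun c \<sigma> t f x = (LINT z|\<mu>. f z * (density_ratio t z * exp (cross_form t z x)))"
proof -
  let ?w = "flow c t *v x" and ?Q = "cov_fin c \<sigma> t"
  have d: "distr lborel borel (\<lambda>y. ?w - y) = (lborel :: (real^3) measure)"
    using lborel_affine[of "-1" ?w] by (simp add: density_1)
  have "ou_fun c \<sigma> t f x = (LINT y|lborel. gauss ?Q y * f (?w - y))"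
    by (simp add: ou_fun_eq[OF c \<sigma> t] integral_gmeas)
  also have "\<dots> = (LINT y|lborel. gauss ?Q (?w - (?w - y)) * f (?w - y))" by simp
  also have "\<dots> = (LINT z|distr lborel borel (\<lambda>y. ?w - y). gauss ?Q (?w - z) * f z)"
    by (rule integral_distr[symmetric]) measurable
  also have "\<dots> = (LINT z|lborel. gauss (cov_inf c \<sigma>) z * (f z * (density_ratio t z * exp (cross_form t z x))))"
    unfolding d gauss_shift[OF t] by (simp add: mult_ac)
  also have "\<dots> = (LINT z|\<mu>. f z * (density_ratio t z * exp (cross_form t z x)))"
    by (rule integral_gmeas[symmetric]) measurable
  finally show ?thesis .
qed

text \<open>The constant belongs to t = 1 and serves all t >= 1, since inverse covariances decrease;
  |w| <= 1 lets the quadratic term in w be bounded by a linear one.\<close>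

lemma cross_form_bound:
  obtains K where "K \<ge> 0" "\<And>t z x. t \<ge> 1 \<Longrightarrow> norm (flow c t *v x) \<le> 1 \<Longrightarrow> \<bar>cross_form t z x\<bar> \<le> K * norm (flow c t *v x) * (1 + norm z)"
proof -
  let ?J = "\<lambda>t. matrix_inv (cov_fin c \<sigma> t)"
  obtain K where K: "K > 0" "\<And>v. v \<bullet> (?J 1 *v v) \<le> K * (v \<bullet> v)" using quadratic_form_upper_bound by blast
  have "\<bar>cross_form t z x\<bar> \<le> K * norm (flow c t *v x) * (1 + norm z)" if t: "t \<ge> 1" and w: "norm (flow c t *v x) \<le> 1" for t z x
  proof -
    let ?w = "flow c t *v x"
    have Q: "spd (cov_fin c \<sigma> t)" "spd (cov_fin c \<sigma> 1)" using t by (auto intro: spd_cov_fin[OF c \<sigma>])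
    have le: "v \<bullet> (?J t *v v) \<le> K * (v \<bullet> v)" for v
      using spd_inv_antimono[OF Q(2,1) cov_fin_mono[OF c \<sigma> t], of v] K(2)[of v] by linarith
    have b: "\<bar>z \<bullet> (?J t *v ?w)\<bar> \<le> K * norm z * norm ?w" "\<bar>?w \<bullet> (?J t *v ?w)\<bar> \<le> K * norm ?w * norm ?w"
      by (intro spd_bilinear_bound[OF spd_matrix_inv[OF Q(1)] le])+
    have "K * norm ?w * norm ?w \<le> K * norm ?w * 1"
      using K(1) w by (intro mult_left_mono) auto
    then have "\<bar>cross_form t z x\<bar> \<le> K * norm z * norm ?w + K * norm ?w"
      unfolding cross_form_def using b by linarith
    then show ?thesis by (simp add: algebra_simps)
  qed
  then show ?thesis using K(1) by (intro that[of K]) auto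
qed

lemma exp_taylor_bound: "\<bar>exp u - (\<Sum>k\<le>n. u ^ k / fact k)\<bar> \<le> \<bar>u\<bar> ^ Suc n * exp \<bar>u\<bar>" for u :: real
proof -
  obtain s where s: "\<bar>s\<bar> \<le> \<bar>u\<bar>" "exp u = (\<Sum>k<Suc n. u ^ k / fact k) + exp s / fact (Suc n) * u ^ Suc n"
    using Maclaurin_exp_le[of u "Suc n"] by blast
  have "exp u - (\<Sum>k\<le>n. u ^ k / fact k) = exp s / fact (Suc n) * u ^ Suc n"
    using s(2) by (simp add: lessThan_Suc_atMost)
  also have "\<bar>\<dots>\<bar> = exp s / fact (Suc n) * \<bar>u\<bar> ^ Suc n"
    by (simp only: abs_mult power_abs abs_divide abs_exp_cancel) simp
  also have "\<dots> \<le> exp \<bar>u\<bar> * \<bar>u\<bar> ^ Suc n"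
  proof (intro mult_right_mono)
    have "exp s / fact (Suc n) \<le> exp s / 1"
      by (intro divide_left_mono) (simp_all add: fact_ge_1 del: fact_Suc)
    also have "\<dots> \<le> exp \<bar>u\<bar>" using s(1) by simp
    finally show "exp s / fact (Suc n) \<le> exp \<bar>u\<bar>" .
  qed simp
  finally show ?thesis by (simp add: mult.commute)
qed

text \<open>T(t) f with the exponential of \<open>cross_form\<close> truncated at order n.\<close>

definition taylor_part :: "nat \<Rightarrow> real \<Rightarrow> (real^3 \<Rightarrow> real) \<Rightarrow> real^3 \<Rightarrow> real" where
  "taylor_part n t f x = (LINT z|\<mu>. f z * density_ratio t z * (\<Sum>k\<le>n. cross_form t z x ^ k / fact k))"

lemma ppoly_cross_form: "ppoly (Suc 2) (cross_form t)"
proof -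
  let ?A = "matrix_inv (cov_fin c \<sigma> t) ** flow c t"
  have l: "ppoly (Suc (Suc 0)) (\<lambda>z x. (B *v x) $ i)" for B :: "real^3^3" and i by (rule ppoly_linear)
  have "ppoly (Suc 2) (\<lambda>z x. (z$1 * (?A *v x)$1 + z$2 * (?A *v x)$2 + z$3 * (?A *v x)$3))"
    by (intro ppoly_add ppoly_cmult poly_growth_component ppoly_mono[OF l]) simp_all
  moreover have q: "ppoly (Suc 2) (\<lambda>z x. (flow c t *v x)$i * (?A *v x)$i)" for i
    using ppoly_mult[OF l l] by (simp add: eval_nat_numeral)
  then have "ppoly (Suc 2) (\<lambda>z x. ((flow c t *v x)$1 * (?A *v x)$1 + (flow c t *v x)$2 * (?A *v x)$2 + (flow c t *v x)$3 * (?A *v x)$3))"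
    by (intro ppoly_add)
  ultimately have "ppoly (Suc 2) (\<lambda>z x. (1/2) * (z$1 * (?A *v x)$1 + z$2 * (?A *v x)$2 + z$3 * (?A *v x)$3)
     - (1/4) * ((flow c t *v x)$1 * (?A *v x)$1 + (flow c t *v x)$2 * (?A *v x)$2 + (flow c t *v x)$3 * (?A *v x)$3))"
    by (intro ppoly_diff ppoly_cmult_const)
  moreover have "v \<bullet> w = v$1 * w$1 + v$2 * w$2 + v$3 * w$3" for v w :: "real^3"
    by (simp add: inner_vec_def sum_3)
  ultimately show ?thesis
    by (simp add: cross_form_def[abs_def] matrix_vector_mul_assoc)
qed

lemma integrable_weight:
  assumes F: "F \<in> L2 (ou_measure c \<sigma>)" and t: "t \<ge> 1" and [measurable]: "v \<in> borel_measurable borel"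
    and v: "\<And>z. \<bar>v z\<bar> \<le> K * exp (a * norm z)"
  shows "integrable \<mu> (\<lambda>z. rep_ae_fun F z * density_ratio t z * v z)"
proof -
  obtain R where R: "R \<ge> 0" "\<And>t z. t \<ge> 1 \<Longrightarrow> density_ratio t z \<le> R" using density_ratio_bound by blast
  have "integrable \<mu> (\<lambda>z. rep_ae_fun F z * (density_ratio t z * v z))"
  proof (rule integrable_L2_mult_exp[OF F])
    show "\<bar>density_ratio t z * v z\<bar> \<le> (R * K) * exp (a * norm z)" for z
      using mult_mono[OF R(2)[OF t, of z] v[of z]] R(1) density_ratio_nonneg[of t z]
      by (simp add: abs_mult mult.assoc)
  qed measurable
  then show ?thesis by (simp add: mult.assoc)
qed

text \<open>\<open>cross_form\<close> is quadratic in x, hence degree 2 n. The bound does not depend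
  on t, so all truncations lie in one finite-dimensional space.\<close>

lemma taylor_part_ppoly:
  assumes F: "F \<in> L2 (ou_measure c \<sigma>)" and t: "t \<ge> 1"
  shows "ppoly (Suc (n * 2)) (\<lambda>_. taylor_part n t (rep_ae_fun F))"
proof -
  have "ppoly (Suc (n * 2)) (\<lambda>z x. (1 / fact k) * cross_form t z x ^ k)" if "k \<le> n" for k
    using that by (intro ppoly_cmult_const ppoly_mono[OF ppoly_power[OF ppoly_cross_form]]) simp
  then have "ppoly (Suc (n * 2)) (\<lambda>z x. \<Sum>k\<le>n. cross_form t z x ^ k / fact k)"
    by (intro ppoly_sum) simp
  then have "ppoly (Suc (n * 2)) (\<lambda>_ x. LINT z|\<mu>. rep_ae_fun F z * density_ratio t z * (\<Sum>k\<le>n. cross_form t z x ^ k / fact k))"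
  proof (rule ppoly_integral)
    fix u assume u: "u \<in> poly_growth"
    obtain K where "\<And>z. \<bar>u z\<bar> \<le> K * exp (1 * norm z)" using poly_growth_exp_bound[OF u] by auto
    then show "integrable \<mu> (\<lambda>z. rep_ae_fun F z * density_ratio t z * u z)"
      by (rule integrable_weight[OF F t poly_growth_measurable[OF u]])
  qed
  then show ?thesis by (simp add: taylor_part_def[abs_def])
qed

text \<open>C is uniform in t and x: by \<open>cross_form_bound\<close> the remainder of the
  exponential is at most |w|^{n+1} times a function V of z alone, and F V is integrable against
  mu.\<close>

lemma taylor_remainder:
  assumes F: "F \<in> L2 (ou_measure c \<sigma>)"
  obtains C where "\<And>t x. t \<ge> 1 \<Longrightarrow> norm (flow c t *v x) \<le> 1 \<Longrightarrow>
     \<bar>ou_fun c \<sigma> t (rep_ae_fun F) x - taylor_part n t (rep_ae_fun F) x\<bar> \<le> C * norm (flow c t *v x) ^ Suc n"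
proof -
  let ?f = "rep_ae_fun F"
  obtain R where R: "R \<ge> 0" "\<And>t z. t \<ge> 1 \<Longrightarrow> density_ratio t z \<le> R" using density_ratio_bound by blast
  obtain K where K: "K \<ge> 0" "\<And>t z x. t \<ge> 1 \<Longrightarrow> norm (flow c t *v x) \<le> 1 \<Longrightarrow> \<bar>cross_form t z x\<bar> \<le> K * norm (flow c t *v x) * (1 + norm z)"
    using cross_form_bound by blast
  \<comment> \<open>The power (1 + |z|)^{n+1} is absorbed by (n + 1)! exp (1 + |z|), hence the 1 in
    1 + K.\<close>
  define V where "V z = K ^ Suc n * fact (Suc n) * exp ((1 + K) * (1 + norm z))" for z :: "real^3"
  have [measurable]: "V \<in> borel_measurable borel" unfolding V_def by measurable
  have V: "integrable \<mu> (\<lambda>z. ?f z * V z)"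
    by (rule integrable_L2_mult_exp[OF F, of V "K ^ Suc n * fact (Suc n) * exp (1 + K)" "1 + K"])
       (use K(1) in \<open>simp_all add: V_def abs_mult power_abs distrib_left exp_add mult_ac del: fact_Suc power_Suc\<close>)
  have "\<bar>ou_fun c \<sigma> t ?f x - taylor_part n t ?f x\<bar> \<le> (R * (LINT z|\<mu>. \<bar>?f z * V z\<bar>)) * norm (flow c t *v x) ^ Suc n"
    if t: "t \<ge> 1" and w: "norm (flow c t *v x) \<le> 1" for t x
  proof -
    let ?w = "norm (flow c t *v x)" and ?u = "\<lambda>z. cross_form t z x"
    let ?p = "\<lambda>z. \<Sum>k\<le>n. ?u z ^ k / fact k"
    have u1: "\<bar>?u z\<bar> \<le> K * (1 + norm z)" for z
    proof -
      have "K * ?w * (1 + norm z) \<le> K * 1 * (1 + norm z)"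
        using K(1) w by (intro mult_right_mono mult_left_mono) auto
      then show ?thesis using K(2)[OF t w, of z] by simp
    qed
    have rem: "\<bar>exp (?u z) - ?p z\<bar> \<le> ?w ^ Suc n * V z" for z
    proof -
      have "\<bar>exp (?u z) - ?p z\<bar> \<le> \<bar>?u z\<bar> ^ Suc n * exp \<bar>?u z\<bar>" by (rule exp_taylor_bound)
      also have "\<dots> \<le> (K * ?w * (1 + norm z)) ^ Suc n * exp (K * (1 + norm z))"
        using K(2)[OF t w] u1 K(1) by (intro mult_mono power_mono zero_le_power mult_nonneg_nonneg) auto
      also have "\<dots> = ?w ^ Suc n * (K ^ Suc n * (1 + norm z) ^ Suc n * exp (K * (1 + norm z)))"
        by (simp add: power_mult_distrib mult_ac del: power_Suc)
      also have "\<dots> \<le> ?w ^ Suc n * (K ^ Suc n * (fact (Suc n) * exp (1 + norm z)) * exp (K * (1 + norm z)))"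
        using K(1) by (intro mult_left_mono mult_right_mono power_le_fact_exp) auto
      also have "\<dots> = ?w ^ Suc n * V z"
        by (simp add: V_def distrib_right exp_add mult_ac del: power_Suc fact_Suc)
      finally show ?thesis .
    qed
    have ie: "integrable \<mu> (\<lambda>z. ?f z * density_ratio t z * exp (?u z))"
    proof (rule integrable_weight[OF F t])
      show "\<bar>exp (?u z)\<bar> \<le> exp K * exp (K * norm z)" for z
        using u1[of z] by (simp add: distrib_left flip: exp_add)
    qed measurable
    have ip: "integrable \<mu> (\<lambda>z. ?f z * density_ratio t z * ?p z)"
    proof -
      have "integrable \<mu> (\<lambda>z. ?f z * density_ratio t z * (exp (?u z) - ?p z))"
      proof (rule integrable_weight[OF F t])
        show "\<bar>exp (?u z) - ?p z\<bar> \<le> (?w ^ Suc n * (K ^ Suc n * fact (Suc n) * exp (1 + K))) * exp ((1 + K) * norm z)" for z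
          using rem[of z] by (simp add: V_def distrib_left exp_add mult_ac del: power_Suc fact_Suc)
      qed measurable
      from Bochner_Integration.integrable_diff[OF ie this] show ?thesis by (simp add: right_diff_distrib)
    qed
    have "ou_fun c \<sigma> t ?f x - taylor_part n t ?f x = (LINT z|\<mu>. ?f z * density_ratio t z * (exp (?u z) - ?p z))"
      using t ie ip by (simp add: ou_fun_density taylor_part_def right_diff_distrib mult.assoc)
    also have "\<bar>\<dots>\<bar> \<le> (LINT z|\<mu>. (R * ?w ^ Suc n) * \<bar>?f z * V z\<bar>)"
    proof (rule order_trans[OF integral_abs_bound integral_mono])
      show "integrable \<mu> (\<lambda>z. \<bar>?f z * density_ratio t z * (exp (?u z) - ?p z)\<bar>)"
        using Bochner_Integration.integrable_diff[OF ie ip] by (simp add: right_diff_distrib)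
      show "integrable \<mu> (\<lambda>z. (R * ?w ^ Suc n) * \<bar>?f z * V z\<bar>)"
        by (intro integrable_mult_right integrable_abs V)
      fix z
      have Vn: "V z \<ge> 0" using K(1) by (simp add: V_def del: fact_Suc)
      have "density_ratio t z * \<bar>exp (?u z) - ?p z\<bar> \<le> R * (?w ^ Suc n * V z)"
        using R(1) by (intro mult_mono R(2)[OF t] rem) auto
      then have "\<bar>?f z\<bar> * (density_ratio t z * \<bar>exp (?u z) - ?p z\<bar>) \<le> \<bar>?f z\<bar> * (R * (?w ^ Suc n * V z))"
        by (rule mult_left_mono) simp
      moreover have "\<bar>?f z * density_ratio t z * (exp (?u z) - ?p z)\<bar>
          = \<bar>?f z\<bar> * (density_ratio t z * \<bar>exp (?u z) - ?p z\<bar>)"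
        by (simp only: abs_mult abs_of_nonneg[OF density_ratio_nonneg] mult.assoc)
      moreover have "(R * ?w ^ Suc n) * \<bar>?f z * V z\<bar> = \<bar>?f z\<bar> * (R * (?w ^ Suc n * V z))"
        by (simp only: abs_mult abs_of_nonneg[OF Vn] mult_ac)
      ultimately show "\<bar>?f z * density_ratio t z * (exp (?u z) - ?p z)\<bar> \<le> (R * ?w ^ Suc n) * \<bar>?f z * V z\<bar>"
        by (simp only:)
    qed
    finally show ?thesis by (simp add: mult_ac del: power_Suc)
  qed
  then show ?thesis by (rule that)
qed

lemma eigenfunction_polynomial:
  assumes F: "F \<in> L2 (ou_measure c \<sigma>)"
    and eig: "\<And>t. t > 0 \<Longrightarrow> ou_semigroup c \<sigma> t F = exp (- real n * c * t) *\<^sub>R F"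
  obtains N g where "ppoly N (\<lambda>_. g)" "F = abs_ae_fun g"
proof -
  let ?f = "rep_ae_fun F"
  let ?t = "\<lambda>m. real (Suc m)"
  \<comment> \<open>The eigenvalue equation holds almost everywhere for each single time;
    restricting to countably many times gives one common set of full measure.\<close>
  define S where "S = {x. \<forall>m. ou_fun c \<sigma> (?t m) ?f x = exp (- real n * c * ?t m) * ?f x}"
  have "AE x in lborel. ou_fun c \<sigma> (?t m) ?f x = exp (- real n * c * ?t m) * ?f x" for m
  proof -
    have "ou_semigroup c \<sigma> (?t m) F = exp (- real n * c * ?t m) *\<^sub>R F" by (rule eig) simp
    with rep_ou_semigroup[of c \<sigma> "?t m" F] rep_ae_fun_scaleR[of "exp (- real n * c * ?t m)" F]
    show ?thesis by (auto elim!: AE_mp)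
  qed
  then have S: "AE x in lborel. x \<in> S" unfolding S_def by (simp add: AE_all_countable)
  obtain C where C: "\<And>t x. t \<ge> 1 \<Longrightarrow> norm (flow c t *v x) \<le> 1 \<Longrightarrow>
     \<bar>ou_fun c \<sigma> t ?f x - taylor_part n t ?f x\<bar> \<le> C * norm (flow c t *v x) ^ Suc n"
    using taylor_remainder[OF F, of n] by blast
  have "\<exists>a. taylor_part n (?t m) ?f = (\<lambda>x. \<Sum>s\<in>mon_index (Suc (n * 2)). a s * mon s x)" for m
  proof -
    have "?t m \<ge> 1" by simp
    from polynomial_normal_form[OF taylor_part_ppoly[OF F this]] show ?thesis by blast
  qed
  then have "\<exists>a. \<forall>m. taylor_part n (?t m) ?f = (\<lambda>x. \<Sum>s\<in>mon_index (Suc (n * 2)). a m s * mon s x)"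
    by (intro choice allI)
  then obtain a where a: "\<And>m. taylor_part n (?t m) ?f = (\<lambda>x. \<Sum>s\<in>mon_index (Suc (n * 2)). a m s * mon s x)"
    by blast
  have lim: "(\<lambda>m. \<Sum>s\<in>mon_index (Suc (n * 2)). (exp (real n * c * ?t m) * a m s) * mon s x) \<longlonglongrightarrow> ?f x" if x: "x \<in> S" for x
  proof -
    \<comment> \<open>Rescaling by e^{nct} leaves e^{-ct} times a polynomial in t, because |w|^{n+1}
      contributes e^{-(n+1)ct}.\<close>
    define B where "B t = exp (real n * c * t) * (C * norm (flow c t *v x) ^ Suc n)" for t
    have tt: "filterlim ?t at_top sequentially"
      by (rule filterlim_compose[OF filterlim_real_sequentially filterlim_Suc])
    have "((\<lambda>t. flow c t *v x) \<longlongrightarrow> 0) at_top" by (rule flow_tendsto_0[OF c \<sigma>])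
    then have "((\<lambda>t. norm (flow c t *v x)) \<longlongrightarrow> 0) at_top" by (rule tendsto_norm_zero)
    then have "eventually (\<lambda>t. norm (flow c t *v x) < 1) at_top" by (rule order_tendstoD) simp
    then have ev: "eventually (\<lambda>m. norm (flow c (?t m) *v x) < 1) sequentially"
      using tt by (rule eventually_compose_filterlim)
    have B0: "(B \<longlongrightarrow> 0) at_top"
    proof (rule Lim_null_comparison)
      show "eventually (\<lambda>t. norm (B t) \<le> exp (- c * t) * (\<bar>C\<bar> * ((1 + t + t\<^sup>2 / 2) * norm x) ^ Suc n)) at_top"
        using eventually_ge_at_top[of 0]
      proof eventually_elim
        case (elim t)
        have "norm (B t) = exp (real n * c * t) * (\<bar>C\<bar> * norm (flow c t *v x) ^ Suc n)"
          by (simp add: B_def abs_mult)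
        also have "\<dots> \<le> exp (real n * c * t) * (\<bar>C\<bar> * (exp (- c * t) * (1 + t + t\<^sup>2 / 2) * norm x) ^ Suc n)"
          using norm_flow_le(1)[OF elim, of c x] by (intro mult_left_mono power_mono) auto
        also have "\<dots> = (exp (real n * c * t) * exp (- c * t) ^ Suc n) * (\<bar>C\<bar> * ((1 + t + t\<^sup>2 / 2) * norm x) ^ Suc n)"
          by (simp only: power_mult_distrib mult_ac)
        also have "exp (real n * c * t) * exp (- c * t) ^ Suc n = exp (- c * t)"
          by (simp add: exp_of_nat_mult[symmetric] algebra_simps flip: exp_add power_Suc)
        finally show ?case .
      qed
      have eq: "exp (- c * t) ^ Suc 0 * poly (smult \<bar>C\<bar> ([:norm x, norm x, norm x / 2:] ^ Suc n)) t
         = exp (- c * t) * (\<bar>C\<bar> * ((1 + t + t\<^sup>2 / 2) * norm x) ^ Suc n)" for t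
        by (simp add: algebra_simps power2_eq_square)
      show "((\<lambda>t. exp (- c * t) * (\<bar>C\<bar> * ((1 + t + t\<^sup>2 / 2) * norm x) ^ Suc n)) \<longlongrightarrow> 0) at_top"
        using exp_poly_tendsto_0[OF c, of 0 "smult \<bar>C\<bar> ([:norm x, norm x, norm x / 2:] ^ Suc n)"] by (simp only: eq)
    qed
    have "(\<lambda>m. exp (real n * c * ?t m) * taylor_part n (?t m) ?f x - ?f x) \<longlonglongrightarrow> 0"
    proof (rule Lim_null_comparison[OF _ filterlim_compose[OF B0 tt]])
      show "eventually (\<lambda>m. norm (exp (real n * c * ?t m) * taylor_part n (?t m) ?f x - ?f x) \<le> B (?t m)) sequentially"
        using ev
      proof eventually_elim
        case (elim m)
        let ?e = "exp (real n * c * ?t m)"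
        have "?e * exp (- real n * c * ?t m) = 1" by (simp flip: exp_add)
        then have fx: "?f x = ?e * ou_fun c \<sigma> (?t m) ?f x"
          using x unfolding S_def by (simp add: mult.assoc[symmetric] del: of_nat_Suc)
        have "norm (?e * taylor_part n (?t m) ?f x - ?f x) = ?e * \<bar>ou_fun c \<sigma> (?t m) ?f x - taylor_part n (?t m) ?f x\<bar>"
          by (subst fx) (simp add: abs_mult abs_minus_commute flip: right_diff_distrib del: of_nat_Suc)
        also have "\<dots> \<le> B (?t m)"
          unfolding B_def using elim by (intro mult_left_mono C) auto
        finally show ?case .
      qed
    qed
    then show ?thesis
      unfolding a sum_distrib_left by (simp add: LIM_zero_iff mult.assoc)
  qed
  \<comment> \<open>The rescaled coefficients are not known to converge; pointwise convergence on S
    within a fixed finite span is enough.\<close>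
  obtain \<alpha> where \<alpha>: "\<forall>x\<in>S. ?f x = (\<Sum>s\<in>mon_index (Suc (n * 2)). \<alpha> s * mon s x)"
    using finite_span_pointwise_limit[where S = S and f = ?f and b = mon
        and a = "\<lambda>m s. exp (real n * c * ?t m) * a m s", OF finite_mon_index lim] by blast
  let ?g = "\<lambda>x. \<Sum>s\<in>mon_index (Suc (n * 2)). \<alpha> s * mon s x"
  have g: "ppoly (Suc (n * 2)) (\<lambda>_. ?g)" by (rule polynomial_normal_form_ppoly)
  have "AE x in lborel. ?f x = ?g x" using S by eventually_elim (use \<alpha> in blast)
  then have "abs_ae_fun ?f = abs_ae_fun ?g"
    by (subst abs_ae_fun_eq_iff) (auto intro: poly_growth_measurable[OF polynomial_poly_growth[OF g]])
  then show ?thesis using that[OF g] by simp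
qed

end

section \<open>The dimension of the eigenspace\<close>

text \<open>Distinctness and independence come together, since the basis is given as an indexed
  family and its members have to be counted.\<close>

lemma independent_image:
  fixes B :: "'i \<Rightarrow> 'a::real_vector"
  assumes I: "finite I" and B: "\<And>b. (\<Sum>i\<in>I. b i *\<^sub>R B i) = 0 \<Longrightarrow> \<forall>i\<in>I. b i = 0"
  shows "inj_on B I" and "independent (B ` I)"
proof -
  show inj: "inj_on B I"
  proof (rule inj_onI, rule ccontr)
    fix i j assume ij: "i \<in> I" "j \<in> I" "B i = B j" "i \<noteq> j"
    have "(\<Sum>k\<in>I. ((if k = i then 1 else 0) - (if k = j then 1 else 0)) *\<^sub>R B k) = B i - B j"
      using I ij by (simp add: scaleR_diff_left sum_subtractf if_distrib[of "\<lambda>r. r *\<^sub>R _"] cong: if_cong)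
    then have "\<forall>k\<in>I. (if k = i then 1 else 0) - (if k = j then 1 else 0) = (0::real)"
      using ij(3) by (intro B) simp
    with ij show False by auto
  qed
  show "independent (B ` I)"
  proof (rule independent_if_scalars_zero)
    fix f x assume "(\<Sum>x\<in>B ` I. f x *\<^sub>R x) = 0" "x \<in> B ` I"
    then show "f x = 0" using B[of "\<lambda>i. f (B i)"] by (auto simp: sum.reindex[OF inj])
  qed (simp add: I)
qed

lemma abs_ae_fun_sum:
  assumes "finite I" "\<And>i. i \<in> I \<Longrightarrow> p i \<in> borel_measurable borel"
  shows "(\<Sum>i\<in>I. b i *\<^sub>R abs_ae_fun (p i)) = abs_ae_fun (\<lambda>x. \<Sum>i\<in>I. b i * p i x)"
  using assms
proof (induction I rule: finite_induct)
  case (insert i I)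
  then have [measurable]: "p j \<in> borel_measurable borel" if "j \<in> insert i I" for j using that by blast
  have "(\<lambda>x. \<Sum>i\<in>I. b i * p i x) \<in> borel_measurable borel" by measurable
  with insert show ?case by (simp add: abs_ae_fun_scaleR abs_ae_fun_plus)
qed (simp add: abs_ae_fun_zero)

lemma gauss_avg_sum:
  assumes "c > 0" "\<sigma> > 0" and "finite I" and "\<And>i. i \<in> I \<Longrightarrow> ppoly N (\<lambda>_. p i)"
  shows "gauss_avg c \<sigma> (\<lambda>x. \<Sum>i\<in>I. b i * p i x) h = (\<Sum>i\<in>I. b i * gauss_avg c \<sigma> (p i) h)"
  using assms(3,4)
proof (induction I rule: finite_induct)
  case empty
  show ?case by (simp add: gauss_avg_def[OF assms(1,2)])
next
  case (insert i I)
  have "ppoly N (\<lambda>_ x. \<Sum>i\<in>I. b i * p i x)"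
    using insert by (intro ppoly_sum ppoly_cmult_const) auto
  with insert show ?case
    using gauss_avg_add[OF assms(1,2), of N "\<lambda>x. \<Sum>i\<in>I. b i * p i x" N "p i" "b i" h]
    by (simp add: add.commute)
qed

theorem corollary3p2:
  fixes c \<sigma> \<gamma> :: real and n r :: nat
  assumes "c > 0" and "\<sigma> > 0"
    and "\<gamma> = - real n * c"
    and "r = nat \<lfloor>real n / 2\<rfloor>"
  shows "geometric_multiplicity (ou_domain c \<sigma>) (ou_operator c \<sigma>) \<gamma> = r + 1"
proof -
  note pos = assms(1,2)
  have r: "r = n div 2" unfolding assms(4) by linarith
  have \<gamma>: "\<gamma> \<le> 0" using pos(1) by (simp add: assms(3))
  have exp\<gamma>: "exp (\<gamma> * t) = exp (- c * t) ^ n" for t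
    by (simp add: assms(3) mult.assoc flip: exp_of_nat_mult)
  define E where "E = {F \<in> L2 (ou_measure c \<sigma>). \<forall>t>0. ou_semigroup c \<sigma> t F = exp (\<gamma> * t) *\<^sub>R F}"
  have eig: "ou_semigroup c \<sigma> t (abs_ae_fun g) = exp (\<gamma> * t) *\<^sub>R abs_ae_fun g \<longleftrightarrow>
      (\<forall>h. gauss_avg c \<sigma> g (flow c t *v h) = exp (- c * t) ^ n * gauss_avg c \<sigma> g h)"
    if g: "ppoly N (\<lambda>_. g)" and t: "t > 0" for N g t
  proof -
    have [measurable]: "g \<in> borel_measurable borel"
      using g by (intro poly_growth_measurable polynomial_poly_growth)
    have p: "ppoly N (\<lambda>_. ou_fun c \<sigma> t g)" "ppoly N (\<lambda>_ x. exp (\<gamma> * t) * g x)"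
      by (intro ou_fun_ppoly[OF pos g t] ppoly_cmult_const g)+
    have "ou_semigroup c \<sigma> t (abs_ae_fun g) = exp (\<gamma> * t) *\<^sub>R abs_ae_fun g \<longleftrightarrow>
       (AE x in lborel. ou_fun c \<sigma> t g x = exp (\<gamma> * t) * g x)"
      by (simp add: ou_semigroup_abs abs_ae_fun_scaleR abs_ae_fun_eq_iff borel_measurable_ou_fun)
    also have "\<dots> \<longleftrightarrow> ou_fun c \<sigma> t g = (\<lambda>x. exp (\<gamma> * t) * g x)"
      using polynomial_AE_eq[OF p] by auto
    also note ou_fun_eigen_iff[OF pos g t]
    finally show ?thesis unfolding exp\<gamma> .
  qed
  \<comment> \<open>The basis consists of the preimages under S of the invariants;
    \<open>eig\<close> translates the eigenvalue equation into invariance under the flow.\<close>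
  have "\<exists>p. ppoly (Suc n) (\<lambda>_. p) \<and> gauss_avg c \<sigma> p = flow_invariant n j" if "j \<in> {..r}" for j
    using gauss_avg_surj[OF pos flow_invariant_ppoly, of j n] that r by auto
  then obtain p where p: "\<And>j. j \<in> {..r} \<Longrightarrow> ppoly (Suc n) (\<lambda>_. p j)"
      and avg: "\<And>j. j \<in> {..r} \<Longrightarrow> gauss_avg c \<sigma> (p j) = flow_invariant n j"
    by metis
  have pm: "p j \<in> borel_measurable borel" if "j \<in> {..r}" for j
    using p[OF that] by (intro poly_growth_measurable polynomial_poly_growth)
  have avg_sum: "gauss_avg c \<sigma> (\<lambda>x. \<Sum>j\<le>r. b j * p j x) h = (\<Sum>j\<le>r. b j * flow_invariant n j h)" for b h
    using gauss_avg_sum[OF pos finite_atMost p, where b = b and h = h] by (simp add: avg)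
  have p_sum: "ppoly (Suc n) (\<lambda>_ x. \<Sum>j\<le>r. b j * p j x)" for b
    by (intro ppoly_sum ppoly_cmult_const p)
  let ?B = "\<lambda>j. abs_ae_fun (p j)"
  have indep: "\<forall>j\<in>{..r}. b j = 0" if "(\<Sum>j\<in>{..r}. b j *\<^sub>R ?B j) = 0" for b
  proof -
    have "abs_ae_fun (\<lambda>x. \<Sum>j\<le>r. b j * p j x) = abs_ae_fun (\<lambda>_. 0)"
      using that abs_ae_fun_sum[OF finite_atMost pm, where b = b] by (simp add: abs_ae_fun_zero)
    then have "AE x in lborel. (\<Sum>j\<le>r. b j * p j x) = 0"
      by (subst (asm) abs_ae_fun_eq_iff) (auto intro: poly_growth_measurable polynomial_poly_growth[OF p_sum])
    then have "(\<lambda>x. \<Sum>j\<le>r. b j * p j x) = (\<lambda>_. 0)"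
      by (rule polynomial_AE_eq[OF p_sum ppoly_0])
    then have "(\<Sum>j\<le>r. b j * flow_invariant n j h) = 0" for h
      using avg_sum[of b h] by (simp add: gauss_avg_def[OF pos])
    then show ?thesis using flow_invariant_independent[where n = n and b = b] unfolding r by auto
  qed
  have "dim E = card (?B ` {..r})"
  proof (rule dim_unique)
    show "?B ` {..r} \<subseteq> E"
    proof (rule image_subsetI)
      fix j assume j: "j \<in> {..r}"
      then show "?B j \<in> E"
        using flow_invariant_flow[of j n c] r
        by (simp add: E_def polynomial_L2[OF pos p[OF j]] eig[OF p[OF j]] avg[OF j])
    qed
    show "E \<subseteq> span (?B ` {..r})"
    proof
      fix F assume F: "F \<in> E"
      obtain N g where g: "ppoly N (\<lambda>_. g)" and Fg: "F = abs_ae_fun g"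
        using eigenfunction_polynomial[OF pos, of F n] F unfolding E_def assms(3) by blast
      have "gauss_avg c \<sigma> g (flow c t *v h) = exp (- c * t) ^ n * gauss_avg c \<sigma> g h" if "t > 0" for t h
        using F eig[OF g that] that unfolding E_def Fg by blast
      from flow_eigen_polynomial[OF pos(1) gauss_avg_ppoly[OF pos g] this]
      obtain b where b: "gauss_avg c \<sigma> g = (\<lambda>h. \<Sum>j\<le>r. b j * flow_invariant n j h)" unfolding r by blast
      \<comment> \<open>S sends both g and the combination of the p j to the same polynomial, and S
        is injective.\<close>
      have "(\<lambda>x. g x + (- 1) * (\<Sum>j\<le>r. b j * p j x)) = (\<lambda>_. 0)"
      proof (rule gauss_avg_inj[OF pos])
        show "ppoly (N + Suc n) (\<lambda>_ x. g x + (- 1) * (\<Sum>j\<le>r. b j * p j x))"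
          by (intro ppoly_add ppoly_cmult_const ppoly_mono[OF g] ppoly_mono[OF p_sum]) auto
        show "gauss_avg c \<sigma> (\<lambda>x. g x + (- 1) * (\<Sum>j\<le>r. b j * p j x)) h = 0" for h
          by (simp only: gauss_avg_add[OF pos g p_sum] avg_sum b)
      qed
      then have "g = (\<lambda>x. \<Sum>j\<le>r. b j * p j x)" by (simp add: fun_eq_iff)
      then have "F = (\<Sum>j\<in>{..r}. b j *\<^sub>R ?B j)"
        unfolding Fg by (simp only: abs_ae_fun_sum[OF finite_atMost pm])
      then show "F \<in> span (?B ` {..r})"
        by (simp only:) (intro span_sum span_scale span_base imageI)
    qed
    show "independent (?B ` {..r})" by (rule independent_image(2)[OF finite_atMost indep])
  qed simp
  also have "\<dots> = r + 1"
    by (simp add: card_image[OF independent_image(1)[OF finite_atMost indep]])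
  finally show ?thesis
    unfolding geometric_multiplicity_def ou_eigenspace_eq[OF pos \<gamma>] E_def .
qed

end
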